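(* Let $m,d\ge1$, let $\xi^1,\xi^2\in L^2$ be $\mathbf R^m$-valued with $\xi^1\ge\xi^2$ (componentwise, a.s.), and let $f^1,f^2:\Omega\times\mathbf R^+\times\mathbf R^m\times\mathbf R^{m\times d}\to\mathbf R^m$ satisfy (h.1) and (h.2) as stated in the context. Suppose the following quasi-monotonicity condition holds: for all $t\ge0$, all $s\in\{1,\dots,m\}$, all $Y,\bar Y\in\mathbf R^m$ and $Z,\bar Z\in\mathbf R^{m\times d}$ such that $Y_s=\bar Y_s$, $Z_s=\bar Z_s$ and $Y_j\ge\bar Y_j$ for all $j\ne s$, one has $$f^1_s(t,Y,Z)\ge f^2_s(t,\bar Y,\bar Z).$$ For $i=1,2$ let $(y^i,z^i)\in\mathcal S^2\times\mathcal H^2$ be the unique solution of $$y^i_t=\xi^i+\int_t^\infty f^i(s,y^i_s,z^i_s)\,ds-\int_t^\infty z^i_s\,dW_s,\qquad t\ge0.$$ Then, almost surely, for all $t\ge0$, $y^1_t\ge y^2_t$, i.e. $y^{1,j}_t\ge y^{2,j}_t$ for every $1\le j\le m$.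
   Context: $W$ is a standard $d$-dimensional Brownian motion on a probability space $(\Omega,\mathcal F,P)$, $\{\mathcal F_t\}_{t\ge0}$ is its completed natural filtration and $\mathcal F_\infty=\bigvee_{t\ge0}\mathcal F_t$. $\mathcal S^2$ is the space of $\mathcal F_t$-adapted processes $v$ with $\mathbf E[\sup_{0\le t\le\infty}|v_t|^2]<\infty$; $\mathcal H^2$ is the space of $\mathcal F_t$-adapted processes with $\mathbf E\int_0^\infty|v_t|^2dt<\infty$; $L^2$ is the space of square-integrable $\mathcal F_\infty$-measurable random variables (of the appropriate dimension). For $Z\in\mathbf R^{m\times d}$, $Z_s$ denotes its $s$-th row; $f^i_s$ and $y^{i,j}$ denote the $s$-th, respectively $j$-th, components. Pointwise conditions on coefficients are understood $dt\times dP$-almost surely. A generator $f$ satisfies (h.1) if for every $(y,z)\in\mathbf R^m\times\mathbf R^{m\times d}$ the process $f(\cdot,y,z)$ is $\{\mathcal F_t\}$-progressively measurable and $\mathbf E\big(\int_0^\infty|f(s,0,0)|ds\big)^2<\infty$. A generator $f$ satisfies (h.2) if there are positive deterministic functions $\psi(t),\delta(t)$ with $\int_0^\infty\psi(s)ds<\infty$ and $\int_0^\infty\delta^2(s)ds<\infty$ such that $|f(t,y^1,z^1)-f(t,y^2,z^2)|\le\psi(t)|y^1-y^2|+\delta(t)|z^1-z^2|$ for all $t\ge0$, $y^1,y^2\in\mathbf R^m$, $z^1,z^2\in\mathbf R^{m\times d}$. Under (h.1), (h.2) and $\xi\in L^2$ each such equation has a unique solution in $\mathcal S^2\times\mathcal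 H^2$ (known result, may be assumed). *)

theory Defs
  imports "HOL-Probability.Probability"
begin

text \<open>Time is indexed by type \<^typ>\<open>real\<close>; only times \<open>t \<ge> 0\<close> are ever constrained.\<close>

definition standard_brownian_motion ::
    "'a measure \<Rightarrow> (real \<Rightarrow> 'a \<Rightarrow> real ^ 'd) \<Rightarrow> bool" where
  "standard_brownian_motion M W \<longleftrightarrow>
     (\<forall>t\<ge>0. W t \<in> borel_measurable M) \<and>
     (AE \<omega> in M. W 0 \<omega> = 0) \<and>
     (AE \<omega> in M. continuous_on {0..} (\<lambda>t. W t \<omega>)) \<and>
     (\<forall>s t. 0 \<le> s \<and> s < t \<longrightarrow>
        distributed M lborel (\<lambda>\<omega>. W t \<omega> - W s \<omega>)
          (\<lambda>x. ennreal (\<Prod>i\<in>UNIV. normal_density 0 (sqrt (t - s)) (x $ i)))) \<and>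
     (\<forall>(n::nat) \<tau>. 0 \<le> \<tau> 0 \<and> (\<forall>k<n. \<tau> k \<le> \<tau> (Suc k)) \<longrightarrow>
        prob_space.indep_vars M (\<lambda>_. borel) (\<lambda>k \<omega>. W (\<tau> (Suc k)) \<omega> - W (\<tau> k) \<omega>) {..<n})"

text \<open>The completion adjoins the null sets of \<^term>\<open>M\<close>. If \<^term>\<open>M\<close> is complete these are
  all subsets of null events; \<^term>\<open>M\<close> itself is not required to be complete, and
  \<^term>\<open>completion M\<close> is an admissible choice of \<^term>\<open>M\<close>.\<close>

definition brownian_filtration ::
    "'a measure \<Rightarrow> (real \<Rightarrow> 'a \<Rightarrow> real ^ 'd) \<Rightarrow> real \<Rightarrow> 'a measure" where
  "brownian_filtration M W t =
     sigma (space M)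
       ({W s -` B \<inter> space M | s B. 0 \<le> s \<and> s \<le> t \<and> B \<in> sets borel} \<union> null_sets M)"

definition brownian_filtration_infty ::
    "'a measure \<Rightarrow> (real \<Rightarrow> 'a \<Rightarrow> real ^ 'd) \<Rightarrow> 'a measure" where
  "brownian_filtration_infty M W =
     sigma (space M) (\<Union>t\<in>{0..}. sets (brownian_filtration M W t))"

definition adapted_process ::
    "'a measure \<Rightarrow> (real \<Rightarrow> 'a \<Rightarrow> real ^ 'd) \<Rightarrow> (real \<Rightarrow> 'a \<Rightarrow> 'b::euclidean_space) \<Rightarrow> bool" where
  "adapted_process M W v \<longleftrightarrow> (\<forall>t\<ge>0. v t \<in> borel_measurable (brownian_filtration M W t))"

definition progressive_process ::
    "'a measure \<Rightarrow> (real \<Rightarrow> 'a \<Rightarrow> real ^ 'd) \<Rightarrow> (real \<Rightarrow> 'a \<Rightarrow> 'b::euclidean_space) \<Rightarrow> bool" where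
  "progressive_process M W v \<longleftrightarrow>
     (\<forall>t\<ge>0. (\<lambda>(s, \<omega>). v s \<omega>)
        \<in> borel_measurable (restrict_space borel {0..t} \<Otimes>\<^sub>M brownian_filtration M W t))"

definition L2_space ::
    "'a measure \<Rightarrow> (real \<Rightarrow> 'a \<Rightarrow> real ^ 'd) \<Rightarrow> ('a \<Rightarrow> 'b::euclidean_space) set" where
  "L2_space M W =
     {\<xi> \<in> borel_measurable (brownian_filtration_infty M W).
        (\<integral>\<^sup>+\<omega>. ennreal ((norm (\<xi> \<omega>))\<^sup>2) \<partial>M) < \<infinity>}"

definition S2_space ::
    "'a measure \<Rightarrow> (real \<Rightarrow> 'a \<Rightarrow> real ^ 'd) \<Rightarrow> (real \<Rightarrow> 'a \<Rightarrow> 'b::euclidean_space) set" where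
  "S2_space M W =
     {v. adapted_process M W v \<and>
         (\<integral>\<^sup>+\<omega>. (SUP t\<in>{0..}. ennreal ((norm (v t \<omega>))\<^sup>2)) \<partial>M) < \<infinity>}"

text \<open>Joint measurability is what gives the time integral a meaning for a process that is
  merely adapted.\<close>

definition H2_space ::
    "'a measure \<Rightarrow> (real \<Rightarrow> 'a \<Rightarrow> real ^ 'd) \<Rightarrow> (real \<Rightarrow> 'a \<Rightarrow> 'b::euclidean_space) set" where
  "H2_space M W =
     {v. adapted_process M W v \<and>
         (\<lambda>(t, \<omega>). v t \<omega>) \<in> borel_measurable (restrict_space borel {0..} \<Otimes>\<^sub>M M) \<and>
         (\<integral>\<^sup>+\<omega>. (\<integral>\<^sup>+t\<in>{0..}. ennreal ((norm (v t \<omega>))\<^sup>2) \<partial>lborel) \<partial>M) < \<infinity>}"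

text \<open>The data \<open>n, \<tau>, H\<close> represent the process that equals \<open>H k\<close> on each interval
  \<open>(\<tau> k, \<tau> (k + 1)]\<close>, \<open>k < n\<close>, and vanishes elsewhere.\<close>

definition simple_integrand ::
    "'a measure \<Rightarrow> (real \<Rightarrow> 'a \<Rightarrow> real ^ 'd) \<Rightarrow> nat \<Rightarrow> (nat \<Rightarrow> real) \<Rightarrow>
     (nat \<Rightarrow> 'a \<Rightarrow> real ^ 'd ^ 'm) \<Rightarrow> bool" where
  "simple_integrand M W n \<tau> H \<longleftrightarrow>
     0 \<le> \<tau> 0 \<and> (\<forall>k<n. \<tau> k \<le> \<tau> (Suc k)) \<and>
     (\<forall>k<n. H k \<in> borel_measurable (brownian_filtration M W (\<tau> k)) \<and>
            (\<exists>C. \<forall>\<omega>\<in>space M. norm (H k \<omega>) \<le> C))"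

definition simple_process ::
    "nat \<Rightarrow> (nat \<Rightarrow> real) \<Rightarrow> (nat \<Rightarrow> 'a \<Rightarrow> real ^ 'd ^ 'm) \<Rightarrow> real \<Rightarrow> 'a \<Rightarrow> real ^ 'd ^ 'm" where
  "simple_process n \<tau> H t \<omega> = (\<Sum>k<n. indicator {\<tau> k<..\<tau> (Suc k)} t *\<^sub>R H k \<omega>)"

definition simple_ito_integral ::
    "(real \<Rightarrow> 'a \<Rightarrow> real ^ 'd) \<Rightarrow> nat \<Rightarrow> (nat \<Rightarrow> real) \<Rightarrow>
     (nat \<Rightarrow> 'a \<Rightarrow> real ^ 'd ^ 'm) \<Rightarrow> 'a \<Rightarrow> real ^ 'm" where
  "simple_ito_integral W n \<tau> H \<omega> = (\<Sum>k<n. H k \<omega> *v (W (\<tau> (Suc k)) \<omega> - W (\<tau> k) \<omega>))"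

text \<open>\<open>has_ito_integral M W z J\<close>: the random variable \<open>J\<close> is a version of
  \<open>\<integral>\<^sub>0\<^sup>\<infinity> z\<^sub>s dW\<^sub>s\<close>, the \<open>L\<^sup>2\<close> extension of the integral of simple processes.\<close>

definition has_ito_integral ::
    "'a measure \<Rightarrow> (real \<Rightarrow> 'a \<Rightarrow> real ^ 'd) \<Rightarrow> (real \<Rightarrow> 'a \<Rightarrow> real ^ 'd ^ 'm) \<Rightarrow>
     ('a \<Rightarrow> real ^ 'm) \<Rightarrow> bool" where
  "has_ito_integral M W z J \<longleftrightarrow>
     J \<in> borel_measurable M \<and>
     (\<exists>n \<tau> H. (\<forall>i::nat. simple_integrand M W (n i) (\<tau> i) (H i)) \<and>
        (\<lambda>i. \<integral>\<^sup>+\<omega>. (\<integral>\<^sup>+s\<in>{0..}.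
                ennreal ((norm (simple_process (n i) (\<tau> i) (H i) s \<omega> - z s \<omega>))\<^sup>2) \<partial>lborel) \<partial>M)
          \<longlonglongrightarrow> 0 \<and>
        (\<lambda>i. \<integral>\<^sup>+\<omega>. ennreal ((norm (simple_ito_integral W (n i) (\<tau> i) (H i) \<omega> - J \<omega>))\<^sup>2) \<partial>M)
          \<longlonglongrightarrow> 0)"

definition generator_h1 ::
    "'a measure \<Rightarrow> (real \<Rightarrow> 'a \<Rightarrow> real ^ 'd) \<Rightarrow>
     ('a \<Rightarrow> real \<Rightarrow> real ^ 'm \<Rightarrow> real ^ 'd ^ 'm \<Rightarrow> real ^ 'm) \<Rightarrow> bool" where
  "generator_h1 M W f \<longleftrightarrow>
     (\<forall>y z. progressive_process M W (\<lambda>t \<omega>. f \<omega> t y z)) \<and>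
     (\<integral>\<^sup>+\<omega>. (\<integral>\<^sup>+s\<in>{0..}. ennreal (norm (f \<omega> s 0 0)) \<partial>lborel)\<^sup>2 \<partial>M) < \<infinity>"

definition generator_h2 ::
    "'a measure \<Rightarrow> ('a \<Rightarrow> real \<Rightarrow> real ^ 'm \<Rightarrow> real ^ 'd ^ 'm \<Rightarrow> real ^ 'm) \<Rightarrow> bool" where
  "generator_h2 M f \<longleftrightarrow>
     (\<exists>\<psi> \<delta> :: real \<Rightarrow> real.
        (\<forall>t\<ge>0. 0 < \<psi> t \<and> 0 < \<delta> t) \<and>
        set_integrable lborel {0..} \<psi> \<and>
        set_integrable lborel {0..} (\<lambda>t. (\<delta> t)\<^sup>2) \<and>
        (AE (t, \<omega>) in lborel \<Otimes>\<^sub>M M. 0 \<le> t \<longrightarrow>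
           (\<forall>y1 y2 z1 z2.
              norm (f \<omega> t y1 z1 - f \<omega> t y2 z2) \<le> \<psi> t * norm (y1 - y2) + \<delta> t * norm (z1 - z2))))"

definition quasi_monotone ::
    "'a measure \<Rightarrow> ('a \<Rightarrow> real \<Rightarrow> real ^ 'm \<Rightarrow> real ^ 'd ^ 'm \<Rightarrow> real ^ 'm) \<Rightarrow>
     ('a \<Rightarrow> real \<Rightarrow> real ^ 'm \<Rightarrow> real ^ 'd ^ 'm \<Rightarrow> real ^ 'm) \<Rightarrow> bool" where
  "quasi_monotone M f1 f2 \<longleftrightarrow>
     (AE (t, \<omega>) in lborel \<Otimes>\<^sub>M M. 0 \<le> t \<longrightarrow>
        (\<forall>s Y Y' Z Z'.
           Y $ s = Y' $ s \<and> Z $ s = Z' $ s \<and> (\<forall>j. j \<noteq> s \<longrightarrow> Y $ j \<ge> Y' $ j) \<longrightarrow>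
           f1 \<omega> t Y Z $ s \<ge> f2 \<omega> t Y' Z' $ s))"

text \<open>The tail integral \<open>J t\<close> is \<open>\<integral>\<^sub>0\<^sup>\<infinity> 1\<^bsub>(t,\<infinity>)\<^esub>(s) z\<^sub>s dW\<^sub>s\<close>, taken in its version with
  continuous paths.\<close>

definition bsde_solution ::
    "'a measure \<Rightarrow> (real \<Rightarrow> 'a \<Rightarrow> real ^ 'd) \<Rightarrow>
     ('a \<Rightarrow> real \<Rightarrow> real ^ 'm \<Rightarrow> real ^ 'd ^ 'm \<Rightarrow> real ^ 'm) \<Rightarrow> ('a \<Rightarrow> real ^ 'm) \<Rightarrow>
     (real \<Rightarrow> 'a \<Rightarrow> real ^ 'm) \<Rightarrow> (real \<Rightarrow> 'a \<Rightarrow> real ^ 'd ^ 'm) \<Rightarrow> bool" where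
  "bsde_solution M W f \<xi> y z \<longleftrightarrow>
     y \<in> S2_space M W \<and> z \<in> H2_space M W \<and>
     (\<exists>J. (\<forall>t\<ge>0. has_ito_integral M W (\<lambda>s \<omega>. indicator {t<..} s *\<^sub>R z s \<omega>) (J t)) \<and>
          (AE \<omega> in M. continuous_on {0..} (\<lambda>t. J t \<omega>)) \<and>
          (AE \<omega> in M.
             set_integrable lborel {0..} (\<lambda>s. f \<omega> s (y s \<omega>) (z s \<omega>)) \<and>
             (\<forall>t\<ge>0. y t \<omega> = \<xi> \<omega> + (LINT s:{t..}|lborel. f \<omega> s (y s \<omega>) (z s \<omega>)) - J t \<omega>)))"

end

theory Submission
  imports Defs
begin

text \<open>Put \<open>D = y2 - y1\<close> and \<open>\<zeta> = z2 - z1\<close>. Quasi-monotonicity and the Lipschitz condition bound the drift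
  of the \<open>j\<close>-th component of \<open>D\<close> by \<open>\<psi> |D\<^sup>+| + \<delta> |\<zeta>\<^sub>j|\<close> wherever \<open>D\<^sub>j > 0\<close>. An Ito inequality for the
  square of the positive part of \<open>D\<^sub>j\<close> has the term \<open>|\<zeta>\<^sub>j|\<^sup>2\<close> on \<open>{D\<^sub>j > 0}\<close> on its good side, which
  absorbs \<open>2 D\<^sub>j\<^sup>+ \<delta> |\<zeta>\<^sub>j|\<close> up to \<open>\<delta>\<^sup>2 (D\<^sub>j\<^sup>+)\<^sup>2\<close>; Gronwall's lemma applied to \<open>E |D\<^sub>t\<^sup>+|\<^sup>2\<close> gives \<open>D\<^sup>+ = 0\<close>.

  No Ito formula is needed: along a partition the square of the positive part satisfies an exact second
  order lower bound as long as the increment stays below a threshold \<open>\<eta>\<close>, and the remaining increments are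
  negligible because \<open>\<zeta>\<close> is approximated by bounded simple integrands, whose integrals over short
  windows are controlled by fourth moments.\<close>

section \<open>Analytic preliminaries\<close>

text \<open>Quasi-monotonicity lets component \<open>j\<close> of the drift feel all components of
  the state, but only row \<open>j\<close> of the integrand. So the square of that one row can
  absorb its own term component by component, whereas the coupling to the other components has to be
  carried along as an abstract process (\<open>\<kappa>\<close>) until the estimates of all
  components are added and Gronwall's lemma closes the loop.

  The event of a large increment is not independent of the increments themselves, so their squares
  on this event have to be estimated through fourth moments, which the integral of a general square
  integrable integrand need not have. This forces the split into the integral of a bounded simple
  integrand and a remainder that is small in L2 uniformly in the grid. The limits are taken in a
  fixed order: the mesh of the grid first, then the auxiliary weights and the simple integrand, then
  \<open>\<eta>\<close>, and the horizon \<open>T\<close> last. The constant in the fourth moment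
  estimate belongs to the simple integrand, so this integrand is fixed before the weight
  \<open>c\<close>.\<close>

lemma sq_add_le: "(x + y)\<^sup>2 \<le> 2 * x\<^sup>2 + 2 * (y::real)\<^sup>2"
  using sum_squares_bound[of x y] by (simp add: power2_sum)

lemma sq_diff_le: "(x - y)\<^sup>2 \<le> 2 * x\<^sup>2 + 2 * (y::real)\<^sup>2"
  using sq_add_le[of x "- y"] by simp

section \<open>Square integrable random variables\<close>

lemma (in prob_space) L2_mult_integrable:
  fixes u v :: "'a \<Rightarrow> real"
  assumes "u \<in> borel_measurable M" "v \<in> borel_measurable M"
    "integrable M (\<lambda>\<omega>. (u \<omega>)\<^sup>2)" "integrable M (\<lambda>\<omega>. (v \<omega>)\<^sup>2)"
  shows "integrable M (\<lambda>\<omega>. u \<omega> * v \<omega>)"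
proof (rule Bochner_Integration.integrable_bound[of _ "\<lambda>\<omega>. (u \<omega>)\<^sup>2 + (v \<omega>)\<^sup>2"])
  have "\<bar>x * y\<bar> \<le> \<bar>x\<^sup>2 + y\<^sup>2\<bar>" for x y :: real
  proof -
    have "2 * (\<bar>x\<bar> * \<bar>y\<bar>) \<le> x\<^sup>2 + y\<^sup>2"
      using sum_squares_bound[of "\<bar>x\<bar>" "\<bar>y\<bar>"] by simp
    moreover have "0 \<le> \<bar>x\<bar> * \<bar>y\<bar>" by simp
    ultimately show ?thesis unfolding abs_mult by linarith
  qed
  then show "AE \<omega> in M. norm (u \<omega> * v \<omega>) \<le> norm ((u \<omega>)\<^sup>2 + (v \<omega>)\<^sup>2)" by simp
qed (use assms in auto)

lemma (in prob_space) L2_bound_integrable: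
  fixes u v :: "'a \<Rightarrow> real"
  assumes "u \<in> borel_measurable M" "integrable M (\<lambda>\<omega>. (v \<omega>)\<^sup>2)" "\<And>\<omega>. \<omega> \<in> space M \<Longrightarrow> \<bar>u \<omega>\<bar> \<le> \<bar>v \<omega>\<bar>"
  shows "integrable M (\<lambda>\<omega>. (u \<omega>)\<^sup>2)"
proof (rule Bochner_Integration.integrable_bound[OF assms(2)])
  show "AE \<omega> in M. norm ((u \<omega>)\<^sup>2) \<le> norm ((v \<omega>)\<^sup>2)"
    using assms(3) by (intro AE_I2) (auto simp: abs_le_square_iff[symmetric])
qed (use assms in auto)

lemma (in prob_space) L2_add_integrable:
  fixes u v :: "'a \<Rightarrow> real"
  assumes "u \<in> borel_measurable M" "v \<in> borel_measurable M"
    "integrable M (\<lambda>\<omega>. (u \<omega>)\<^sup>2)" "integrable M (\<lambda>\<omega>. (v \<omega>)\<^sup>2)"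
  shows "integrable M (\<lambda>\<omega>. (u \<omega> + v \<omega>)\<^sup>2)"
  unfolding power2_sum using assms L2_mult_integrable[OF assms] by (simp add: mult.assoc)

lemma (in prob_space) L2_diff_integrable:
  fixes u v :: "'a \<Rightarrow> real"
  assumes "u \<in> borel_measurable M" "v \<in> borel_measurable M"
    "integrable M (\<lambda>\<omega>. (u \<omega>)\<^sup>2)" "integrable M (\<lambda>\<omega>. (v \<omega>)\<^sup>2)"
  shows "integrable M (\<lambda>\<omega>. (u \<omega> - v \<omega>)\<^sup>2)"
  using L2_add_integrable[of u "\<lambda>\<omega>. - v \<omega>"] assms by simp

section \<open>Passing to the limit in L2 norms\<close>

text \<open>Young's inequality with weight \<open>e\<close>. The factor of the square of
  \<open>norm y\<close> can be brought arbitrarily close to 1, so exact equalities of norms survive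
  a limit; the factor 2 of the plain inequality would lose them.\<close>

lemma weighted_parallelogram:
  fixes x y :: "'b::real_normed_vector"
  assumes "0 < e"
  shows "(norm x)\<^sup>2 \<le> (1 + e) * (norm y)\<^sup>2 + (1 + 1/e) * (norm (x - y))\<^sup>2"
proof -
  let ?u = "norm y" and ?v = "norm (x - y)"
  have "norm x \<le> ?u + ?v" by (metis add.commute diff_add_cancel norm_triangle_ineq)
  then have 1: "(norm x)\<^sup>2 \<le> (?u + ?v)\<^sup>2" by (rule power_mono) simp
  have "0 \<le> (e * ?u - ?v)\<^sup>2 / e" using assms by simp
  also have "\<dots> = e * ?u\<^sup>2 - 2 * ?u * ?v + (1/e) * ?v\<^sup>2"
    using assms by (simp add: power2_eq_square field_simps)
  finally show ?thesis using 1 by (simp add: power2_sum algebra_simps)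
qed

lemma nn_L2_le:
  fixes f g :: "'x \<Rightarrow> 'b::euclidean_space"
  assumes [measurable]: "f \<in> borel_measurable Q" "g \<in> borel_measurable Q" and e: "0 < e"
  shows "(\<integral>\<^sup>+x. ennreal ((norm (f x))\<^sup>2) \<partial>Q) \<le> ennreal (1 + e) * (\<integral>\<^sup>+x. ennreal ((norm (g x))\<^sup>2) \<partial>Q)
     + ennreal (1 + 1/e) * (\<integral>\<^sup>+x. ennreal ((norm (f x - g x))\<^sup>2) \<partial>Q)"
proof -
  have "(\<integral>\<^sup>+x. ennreal ((norm (f x))\<^sup>2) \<partial>Q) \<le> (\<integral>\<^sup>+x. ennreal (1 + e) * ennreal ((norm (g x))\<^sup>2) + ennreal (1 + 1/e) * ennreal ((norm (f x - g x))\<^sup>2) \<partial>Q)"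
  proof (rule nn_integral_mono)
    fix x
    show "ennreal ((norm (f x))\<^sup>2) \<le> ennreal (1 + e) * ennreal ((norm (g x))\<^sup>2) + ennreal (1 + 1/e) * ennreal ((norm (f x - g x))\<^sup>2)"
      using weighted_parallelogram[OF e, of "f x" "g x"] e
      by (simp add: ennreal_mult[symmetric] ennreal_plus[symmetric] del: ennreal_plus)
  qed
  also have "\<dots> = ennreal (1 + e) * (\<integral>\<^sup>+x. ennreal ((norm (g x))\<^sup>2) \<partial>Q)
     + ennreal (1 + 1/e) * (\<integral>\<^sup>+x. ennreal ((norm (f x - g x))\<^sup>2) \<partial>Q)"
    by (simp add: nn_integral_add nn_integral_cmult)
  finally show ?thesis .
qed

text \<open>Two applications of \<open>nn_L2_le\<close> cost a factor \<open>(1 + e)\<^sup>2\<close>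
  and error terms that vanish along the sequences; then \<open>e\<close> tends to 0. The two sides
  live on different spaces because the isometry compares random variables with integrands on the
  product with time. An infinite right side is trivial; for a finite one the case
  \<open>e = 1\<close> first makes the left side finite.\<close>

lemma nn_L2_limit_le:
  fixes f :: "nat \<Rightarrow> 'x \<Rightarrow> 'b::euclidean_space" and g :: "nat \<Rightarrow> 'y \<Rightarrow> 'c::euclidean_space"
  assumes m: "\<And>i. f i \<in> borel_measurable A" "f' \<in> borel_measurable A" "\<And>i. g i \<in> borel_measurable B" "g' \<in> borel_measurable B"
    and f: "(\<lambda>i. \<integral>\<^sup>+x. ennreal ((norm (f i x - f' x))\<^sup>2) \<partial>A) \<longlonglongrightarrow> 0"
    and g: "(\<lambda>i. \<integral>\<^sup>+x. ennreal ((norm (g i x - g' x))\<^sup>2) \<partial>B) \<longlonglongrightarrow> 0"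
    and eq: "\<And>i. (\<integral>\<^sup>+x. ennreal ((norm (f i x))\<^sup>2) \<partial>A) = (\<integral>\<^sup>+x. ennreal ((norm (g i x))\<^sup>2) \<partial>B)"
  shows "(\<integral>\<^sup>+x. ennreal ((norm (f' x))\<^sup>2) \<partial>A) \<le> (\<integral>\<^sup>+x. ennreal ((norm (g' x))\<^sup>2) \<partial>B)"
proof -
  let ?G = "\<integral>\<^sup>+x. ennreal ((norm (g' x))\<^sup>2) \<partial>B" and ?F = "\<integral>\<^sup>+x. ennreal ((norm (f' x))\<^sup>2) \<partial>A"
  have e: "?F \<le> ennreal (1 + e) * (ennreal (1 + e) * ?G)" if "0 < e" for e
  proof -
    let ?r = "\<lambda>i. ennreal (1 + e) * (ennreal (1 + e) * ?G + ennreal (1 + 1/e) * (\<integral>\<^sup>+x. ennreal ((norm (g i x - g' x))\<^sup>2) \<partial>B))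
        + ennreal (1 + 1/e) * (\<integral>\<^sup>+x. ennreal ((norm (f i x - f' x))\<^sup>2) \<partial>A)"
    have "?F \<le> ?r i" for i
    proof -
      have "?F \<le> ennreal (1 + e) * (\<integral>\<^sup>+x. ennreal ((norm (f i x))\<^sup>2) \<partial>A)
         + ennreal (1 + 1/e) * (\<integral>\<^sup>+x. ennreal ((norm (f' x - f i x))\<^sup>2) \<partial>A)"
        by (rule nn_L2_le[OF m(2) m(1) that])
      also have "(\<integral>\<^sup>+x. ennreal ((norm (f i x))\<^sup>2) \<partial>A) \<le> ennreal (1 + e) * ?G + ennreal (1 + 1/e) * (\<integral>\<^sup>+x. ennreal ((norm (g i x - g' x))\<^sup>2) \<partial>B)"
        unfolding eq by (rule nn_L2_le[OF m(3) m(4) that])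
      finally show ?thesis by (simp add: norm_minus_commute mult_left_mono add_right_mono)
    qed
    moreover have "?r \<longlonglongrightarrow> ennreal (1 + e) * (ennreal (1 + e) * ?G + ennreal (1 + 1/e) * 0) + ennreal (1 + 1/e) * 0"
      by (intro tendsto_add tendsto_const ennreal_tendsto_cmult f g) simp_all
    ultimately have "?F \<le> ennreal (1 + e) * (ennreal (1 + e) * ?G + ennreal (1 + 1/e) * 0) + ennreal (1 + 1/e) * 0"
      by (intro LIMSEQ_le_const) auto
    then show ?thesis by simp
  qed
  show ?thesis
  proof (cases "?G < \<infinity>")
    case True
    then obtain G where G: "?G = ennreal G" "0 \<le> G" by (cases ?G) auto
    have "?F \<le> ennreal (1 + 1) * (ennreal (1 + 1) * ?G)" by (rule e) simp
    then have "?F < \<infinity>" using True by (simp add: ennreal_mult_less_top order_le_less_trans)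
    then obtain F where Fr: "?F = ennreal F" "0 \<le> F" by (cases ?F) auto
    have "F \<le> (1 + e) * ((1 + e) * G)" if "0 < e" for e
    proof -
      have "ennreal (1 + e) * (ennreal (1 + e) * ?G) = ennreal ((1 + e) * ((1 + e) * G))"
        using G that by (simp add: ennreal_mult del: ennreal_plus)
      then show ?thesis using e[OF that] G Fr that by (simp add: ennreal_le_iff)
    qed
    then have "eventually (\<lambda>e. F \<le> (1 + e) * ((1 + e) * G)) (at_right 0)"
      by (auto simp: eventually_at_filter)
    moreover have "((\<lambda>e. (1 + e) * ((1 + e) * G)) \<longlongrightarrow> (1 + 0) * ((1 + 0) * G)) (at_right 0)"
      by (intro tendsto_intros)
    ultimately have "F \<le> (1 + 0) * ((1 + 0) * G)" by (intro tendsto_lowerbound) auto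
    then show ?thesis using G Fr by (simp add: ennreal_leI)
  qed (simp add: not_less top_unique)
qed

lemma nn_L2_limit_eq:
  fixes f :: "nat \<Rightarrow> 'x \<Rightarrow> 'b::euclidean_space" and g :: "nat \<Rightarrow> 'y \<Rightarrow> 'c::euclidean_space"
  assumes "\<And>i. f i \<in> borel_measurable A" "f' \<in> borel_measurable A" "\<And>i. g i \<in> borel_measurable B" "g' \<in> borel_measurable B"
    and "(\<lambda>i. \<integral>\<^sup>+x. ennreal ((norm (f i x - f' x))\<^sup>2) \<partial>A) \<longlonglongrightarrow> 0"
    and "(\<lambda>i. \<integral>\<^sup>+x. ennreal ((norm (g i x - g' x))\<^sup>2) \<partial>B) \<longlonglongrightarrow> 0"
    and "\<And>i. (\<integral>\<^sup>+x. ennreal ((norm (f i x))\<^sup>2) \<partial>A) = (\<integral>\<^sup>+x. ennreal ((norm (g i x))\<^sup>2) \<partial>B)"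
  shows "(\<integral>\<^sup>+x. ennreal ((norm (f' x))\<^sup>2) \<partial>A) = (\<integral>\<^sup>+x. ennreal ((norm (g' x))\<^sup>2) \<partial>B)"
  by (intro antisym nn_L2_limit_le[OF assms] nn_L2_limit_le[OF assms(3,4,1,2,6,5) assms(7)[symmetric]])

lemma nn_L2_diff_le:
  fixes f g :: "'x \<Rightarrow> 'b::euclidean_space"
  assumes [measurable]: "f \<in> borel_measurable Q" "g \<in> borel_measurable Q"
  shows "(\<integral>\<^sup>+x. ennreal ((norm (f x - g x))\<^sup>2) \<partial>Q) \<le> 2 * (\<integral>\<^sup>+x. ennreal ((norm (f x))\<^sup>2) \<partial>Q) + 2 * (\<integral>\<^sup>+x. ennreal ((norm (g x))\<^sup>2) \<partial>Q)"
  using nn_L2_le[of "\<lambda>x. f x - g x" Q f 1] by simp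

lemma nn_L2_mult_le:
  fixes f :: "'x \<Rightarrow> 'b::euclidean_space"
  assumes [measurable]: "f \<in> borel_measurable Q" and a: "\<And>x. x \<in> space Q \<Longrightarrow> \<bar>a x\<bar> \<le> C"
  shows "(\<integral>\<^sup>+x. ennreal ((norm (a x *\<^sub>R f x))\<^sup>2) \<partial>Q) \<le> ennreal (C\<^sup>2) * (\<integral>\<^sup>+x. ennreal ((norm (f x))\<^sup>2) \<partial>Q)"
proof -
  have "(\<integral>\<^sup>+x. ennreal ((norm (a x *\<^sub>R f x))\<^sup>2) \<partial>Q) \<le> (\<integral>\<^sup>+x. ennreal (C\<^sup>2) * ennreal ((norm (f x))\<^sup>2) \<partial>Q)"
  proof (rule nn_integral_mono)
    fix x assume "x \<in> space Q"
    then have "(a x)\<^sup>2 \<le> C\<^sup>2" using a power_mono[of "\<bar>a x\<bar>" C 2] by simp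
    then have "(a x)\<^sup>2 * (norm (f x))\<^sup>2 \<le> C\<^sup>2 * (norm (f x))\<^sup>2" by (rule mult_right_mono) simp
    then show "ennreal ((norm (a x *\<^sub>R f x))\<^sup>2) \<le> ennreal (C\<^sup>2) * ennreal ((norm (f x))\<^sup>2)"
      by (simp add: power_mult_distrib ennreal_mult[symmetric] ennreal_leI)
  qed
  also have "\<dots> = ennreal (C\<^sup>2) * (\<integral>\<^sup>+x. ennreal ((norm (f x))\<^sup>2) \<partial>Q)" by (rule nn_integral_cmult) measurable
  finally show ?thesis .
qed

section \<open>Integrals over windows and tails of the time axis\<close>

lemma integrable_indicator_times:
  fixes f :: "real \<Rightarrow> real"
  shows "integrable lborel f \<Longrightarrow> A \<in> sets borel \<Longrightarrow> integrable lborel (\<lambda>u. indicator A u * f u)"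
  using integrable_mult_indicator[of A lborel f] by simp

lemma integral_indicator_times_le:
  fixes f :: "real \<Rightarrow> real"
  assumes "integrable lborel f" "\<And>u. 0 \<le> f u" "A \<in> sets borel"
  shows "(LINT u|lborel. indicator A u * f u) \<le> integral\<^sup>L lborel f"
  using assms by (intro integral_mono integrable_indicator_times) (auto simp: indicator_def)

lemma sum_window:
  fixes f :: "real \<Rightarrow> real" and \<tau> :: "nat \<Rightarrow> real"
  assumes f: "integrable lborel f" and \<tau>: "\<And>k. k < n \<Longrightarrow> \<tau> k \<le> \<tau> (Suc k)"
  shows "(\<Sum>k<n. LINT u|lborel. indicator {\<tau> k<..\<tau> (Suc k)} u * f u) = (LINT u|lborel. indicator {\<tau> 0<..\<tau> n} u * f u)"
  using \<tau>
proof (induction n)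
  case (Suc n)
  have le: "\<tau> 0 \<le> \<tau> m" if "m \<le> n" for m
    using that by (induction m) (use Suc.prems in \<open>auto intro: order_trans\<close>)
  note i = integrable_indicator_times[OF f]
  have "(\<Sum>k<Suc n. LINT u|lborel. indicator {\<tau> k<..\<tau> (Suc k)} u * f u)
     = (LINT u|lborel. indicator {\<tau> 0<..\<tau> n} u * f u) + (LINT u|lborel. indicator {\<tau> n<..\<tau> (Suc n)} u * f u)"
    using Suc by simp
  also have "\<dots> = (LINT u|lborel. indicator {\<tau> 0<..\<tau> n} u * f u + indicator {\<tau> n<..\<tau> (Suc n)} u * f u)"
    by (rule Bochner_Integration.integral_add[symmetric]) (auto intro: i)
  also have "\<dots> = (LINT u|lborel. indicator {\<tau> 0<..\<tau> (Suc n)} u * f u)"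
    using le[of n] Suc.prems[of n] by (intro Bochner_Integration.integral_cong) (auto simp: indicator_def)
  finally show ?case .
qed simp

text \<open>Dominated convergence: along a sequence tending to \<open>a\<close> the indicators
  converge at every point except possibly \<open>a\<close> itself, which is a null set for Lebesgue
  measure.\<close>

lemma tail_integral_continuous:
  fixes f :: "real \<Rightarrow> 'b::euclidean_space"
  assumes f: "integrable lborel f"
  shows "continuous_on UNIV (\<lambda>s. LINT u|lborel. indicator {s..} u *\<^sub>R f u)"
  unfolding continuous_on_sequentially
proof (intro allI ballI impI, elim conjE)
  fix x :: "nat \<Rightarrow> real" and a assume x: "x \<longlonglongrightarrow> a"
  show "((\<lambda>s. LINT u|lborel. indicator {s..} u *\<^sub>R f u) \<circ> x) \<longlonglongrightarrow> (LINT u|lborel. indicator {a..} u *\<^sub>R f u)"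
    unfolding comp_def
  proof (rule integral_dominated_convergence[where w = "\<lambda>u. norm (f u)"])
    have "AE u in lborel. u \<noteq> a" by (rule AE_lborel_singleton)
    then show "AE u in lborel. (\<lambda>n. indicator {x n..} u *\<^sub>R f u) \<longlonglongrightarrow> indicator {a..} u *\<^sub>R f u"
    proof eventually_elim
      case (elim u)
      have "eventually (\<lambda>n. indicator {x n..} u *\<^sub>R f u = indicator {a..} u *\<^sub>R f u) sequentially"
      proof (cases "u < a")
        case True
        from order_tendstoD(1)[OF x True] show ?thesis by eventually_elim (use True in auto)
      next
        case False
        then have "a < u" using elim by simp
        from order_tendstoD(2)[OF x this] show ?thesis by eventually_elim (use \<open>a < u\<close> in auto)
      qed
      then show ?case by (rule tendsto_eventually)
    qed
    show "integrable lborel (\<lambda>u. norm (f u))" using f by simp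
    show "AE u in lborel. norm (indicator {x n..} u *\<^sub>R f u) \<le> norm (f u)" for n
      by (auto simp: indicator_def)
  qed (use f in auto)
qed

lemma tail_tendsto_0:
  fixes f :: "real \<Rightarrow> real"
  assumes f: "integrable lborel f"
  shows "(\<lambda>n. LINT u|lborel. indicator {real n..} u * f u) \<longlonglongrightarrow> 0"
    "(\<lambda>n. LINT u|lborel. indicator {real n<..} u * f u) \<longlonglongrightarrow> 0"
proof -
  have *: "(\<lambda>n. LINT u|lborel. indicator (A n) u * f u) \<longlonglongrightarrow> (LINT (u::real)|lborel. 0)"
    if A: "\<And>n. A n \<in> sets borel" "\<And>n u. u \<in> A n \<Longrightarrow> real n \<le> u" for A :: "nat \<Rightarrow> real set"
  proof (rule integral_dominated_convergence[where w = "\<lambda>u. \<bar>f u\<bar>"])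
    show "AE u in lborel. (\<lambda>n. indicator (A n) u * f u) \<longlonglongrightarrow> 0"
    proof (rule AE_I2)
      fix u
      obtain N :: nat where N: "u < real N" using reals_Archimedean2 by blast
      have "indicator (A n) u = (0::real)" if "n \<ge> N" for n
        using A(2)[of u n] N that by (auto simp: indicator_def)
      then have "eventually (\<lambda>n. indicator (A n) u * f u = 0) sequentially"
        unfolding eventually_sequentially by (intro exI[of _ N]) auto
      then show "(\<lambda>n. indicator (A n) u * f u) \<longlonglongrightarrow> 0" by (rule tendsto_eventually)
    qed
    show "AE u in lborel. norm (indicator (A n) u * f u) \<le> \<bar>f u\<bar>" for n by (auto simp: indicator_def)
    show "(\<lambda>u. indicator (A n) u * f u) \<in> borel_measurable lborel" for n
      using A(1)[of n] borel_measurable_integrable[OF f] by (intro borel_measurable_times borel_measurable_indicator) auto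
  qed (use f in auto)
  show "(\<lambda>n. LINT u|lborel. indicator {real n..} u * f u) \<longlonglongrightarrow> 0"
    using *[of "\<lambda>n. {real n..}"] by simp
  show "(\<lambda>n. LINT u|lborel. indicator {real n<..} u * f u) \<longlonglongrightarrow> 0"
    using *[of "\<lambda>n. {real n<..}"] by simp
qed

text \<open>Turns an almost sure statement for each single time into one for all times at once: the
  rationals need only countably many null events, and path continuity fills the gaps.\<close>

lemma nonpos_if_nonpos_on_rationals:
  fixes h :: "real \<Rightarrow> real"
  assumes h: "continuous_on {0..} h" and q: "\<And>q. q \<in> \<rat> \<Longrightarrow> 0 \<le> q \<Longrightarrow> h q \<le> 0" and t: "0 \<le> t"
  shows "h t \<le> 0"
proof (rule ccontr)
  assume "\<not> h t \<le> 0"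
  then have pos: "0 < h t" by simp
  obtain d where d: "0 < d" "\<And>s. s \<in> {0..} \<Longrightarrow> dist s t < d \<Longrightarrow> dist (h s) (h t) < h t"
    using h t pos unfolding continuous_on_iff by (metis atLeast_iff)
  obtain s where s: "s \<in> \<rat>" "t < s" "s < t + d" using Rats_dense_in_real[of t "t + d"] d(1) by auto
  then have "dist (h s) (h t) < h t" using t by (intro d(2)) (auto simp: dist_real_def)
  then have "0 < h s" unfolding dist_real_def by linarith
  then show False using q[OF s(1)] s t by simp
qed

text \<open>The mass of \<open>k\<close> is cut into portions of 1/2. Where the mass still to come
  is at most 1/2, the integral inequality halves every bound on \<open>u\<close>, so the bound
  \<open>C\<close> improves to \<open>C / 2 ^ n\<close> and \<open>u\<close> vanishes. Going back in
  time, each further portion is treated alike, because \<open>u\<close> is already known to vanish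
  after it.\<close>

lemma gronwall_backward:
  fixes u k :: "real \<Rightarrow> real"
  assumes k: "set_integrable lborel {0..} k" "\<And>t. 0 \<le> t \<Longrightarrow> 0 \<le> k t"
    and u: "\<And>t. 0 \<le> t \<Longrightarrow> 0 \<le> u t" "\<And>t. 0 \<le> t \<Longrightarrow> u t \<le> C"
    and ku: "integrable lborel (\<lambda>s. indicator {0<..} s * (k s * u s))"
    and le: "\<And>t. 0 \<le> t \<Longrightarrow> u t \<le> (LINT s|lborel. indicator {t<..} s * (k s * u s))"
    and t: "0 \<le> t"
  shows "u t = 0"
proof -
  define k0 where "k0 s = indicator {0..} s * k s" for s
  have k0: "integrable lborel k0" using k(1) by (simp add: set_integrable_def k0_def[abs_def])
  have k0nn: "0 \<le> k0 s" for s using k(2) by (simp add: k0_def indicator_def)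
  define A where "A s = (LINT r|lborel. indicator {s..} r * k0 r)" for s
  note ik = integrable_indicator_times[OF k0]
  have Ac: "continuous_on UNIV A"
    using tail_integral_continuous[OF k0] by (simp add: A_def[abs_def])
  have Amono: "A s \<le> A r" if "r \<le> s" for r s
    unfolding A_def using that k0nn by (intro integral_mono ik) (auto simp: indicator_def)
  \<comment> \<open>The iteration of the halving step; \<open>C\<close> is nonnegative because it
    lies above some value of \<open>u\<close>.\<close>
  have half: "u s = 0" if s: "r \<le> s" and r: "0 \<le> r" and step: "\<And>b s. 0 \<le> b \<Longrightarrow> (\<And>x. r \<le> x \<Longrightarrow> u x \<le> b) \<Longrightarrow> r \<le> s \<Longrightarrow> u s \<le> b / 2" for r s
  proof -
    have C0: "0 \<le> C" using u(1)[OF r] u(2)[OF r] by simp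
    have "\<forall>x\<ge>r. u x \<le> C / 2 ^ n" for n
    proof (induction n)
      case 0 then show ?case using u(2) r by auto
    next
      case (Suc n)
      then show ?case using step[of "C / 2^n"] C0 by (auto simp: field_simps)
    qed
    then have "u s \<le> C / 2 ^ n" for n using s by blast
    moreover have "(\<lambda>n. C / 2 ^ n) \<longlonglongrightarrow> 0" by (rule LIMSEQ_divide_realpow_zero) simp
    ultimately have "u s \<le> 0" by (intro LIMSEQ_le_const) auto
    then show ?thesis using u(1)[of s] s r by simp
  qed
  \<comment> \<open>\<open>B\<close> is any set that catches the later times at which
    \<open>u\<close> is nonzero: the whole tail in the base case, the stretch up to \<open>c\<close>
    in the induction step.\<close>
  have bound: "u s \<le> b * (LINT x|lborel. indicator B x * k0 x)"
    if s: "0 \<le> s" and B: "B \<in> sets borel" and b: "0 \<le> b" "\<And>x. s < x \<Longrightarrow> u x \<noteq> 0 \<Longrightarrow> x \<in> B" "\<And>x. s < x \<Longrightarrow> u x \<le> b" for s b B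
  proof -
    have "u s \<le> (LINT x|lborel. indicator {s<..} x * (k x * u x))" by (rule le[OF s])
    also have "\<dots> \<le> (LINT x|lborel. b * (indicator B x * k0 x))"
    proof (rule integral_mono)
      have "integrable lborel (\<lambda>x. indicator {s<..} x * (indicator {0<..} x * (k x * u x)))"
        by (intro integrable_indicator_times ku) simp
      also have "(\<lambda>x. indicator {s<..} x * (indicator {0<..} x * (k x * u x))) = (\<lambda>x. indicator {s<..} x * (k x * u x))"
        using s by (auto simp: indicator_def)
      finally show "integrable lborel (\<lambda>x. indicator {s<..} x * (k x * u x))" .
      show "integrable lborel (\<lambda>x. b * (indicator B x * k0 x))" using ik[OF B] by simp
      fix x
      show "indicator {s<..} x * (k x * u x) \<le> b * (indicator B x * k0 x)"
      proof (cases "s < x \<and> u x \<noteq> 0")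
        case True
        then have "k x * u x \<le> k x * b" using k(2)[of x] b(3)[of x] s by (intro mult_left_mono) auto
        then show ?thesis using True b(2)[of x] s by (simp add: k0_def mult.commute)
      next
        case False
        then have "indicator {s<..} x * (k x * u x) = 0" by (auto simp: indicator_def)
        moreover have "0 \<le> b * (indicator B x * k0 x)" using b(1) k0nn by simp
        ultimately show ?thesis by (simp only:)
      qed
    qed
    finally show ?thesis by simp
  qed
  have Alim: "\<exists>T\<ge>r. A T < e" if "0 < e" for e r :: real
  proof -
    have "(\<lambda>n. A (real n)) \<longlonglongrightarrow> 0" unfolding A_def by (rule tail_tendsto_0(1)[OF k0])
    then have "eventually (\<lambda>n. A (real n) < e) sequentially" using that by (rule order_tendstoD)
    then obtain N where N: "\<And>n. n \<ge> N \<Longrightarrow> A (real n) < e" unfolding eventually_sequentially by blast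
    obtain m :: nat where "r \<le> real m" using real_arch_simple by blast
    then show ?thesis using N[of "max N m"] by (intro exI[of _ "real (max N m)"]) auto
  qed
  \<comment> \<open>\<open>A r\<close> is the mass of \<open>k\<close> from \<open>r\<close> on; the
    induction is on the number of half units that it contains.\<close>
  have "\<forall>r\<ge>0. A r \<le> (real n + 1) / 2 \<longrightarrow> u r = 0" for n
  proof (induction n)
    case 0
    show ?case
    proof (intro allI impI)
      fix r assume r: "0 \<le> r" "A r \<le> (real 0 + 1) / 2"
      show "u r = 0"
      proof (rule half[OF order_refl r(1)])
        fix b s assume b: "0 \<le> b" "\<And>x. r \<le> x \<Longrightarrow> u x \<le> b" and s: "r \<le> s"
        have "u s \<le> b * A s" unfolding A_def by (rule bound) (use b s r in auto)
        also have "\<dots> \<le> b * (1/2)" using Amono[OF s] r b(1) by (intro mult_left_mono) auto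
        finally show "u s \<le> b / 2" by simp
      qed
    qed
  next
    case (Suc n)
    show ?case
    proof (intro allI impI)
      fix r assume r: "0 \<le> r" "A r \<le> (real (Suc n) + 1) / 2"
      show "u r = 0"
      proof (cases "A r \<le> (real n + 1) / 2")
        case True then show ?thesis using Suc r by blast
      next
        case False
        obtain T where T: "r \<le> T" "A T < (real n + 1) / 2" using Alim[of "(real n + 1) / 2" r] by auto
        \<comment> \<open>Since \<open>A\<close> is continuous, some \<open>c\<close> splits off
          exactly the tail that the induction hypothesis covers, and the mass between
          \<open>r\<close> and \<open>c\<close> is at most 1/2.\<close>
        obtain c where c: "r \<le> c" "c \<le> T" "A c = (real n + 1) / 2"
          using IVT2'[of A T "(real n + 1) / 2" r] T False continuous_on_subset[OF Ac, of "{r..T}"] by auto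
        have zero: "u x = 0" if "c \<le> x" for x
          using Suc Amono[OF that] c r that by auto
        show ?thesis
        proof (rule half[OF order_refl r(1)])
          fix b s assume b: "0 \<le> b" "\<And>x. r \<le> x \<Longrightarrow> u x \<le> b" and s: "r \<le> s"
          have "u s \<le> b * (LINT x|lborel. indicator {r..<c} x * k0 x)"
            by (rule bound) (use b s r zero in \<open>auto simp: not_le[symmetric]\<close>)
          also have "(LINT x|lborel. indicator {r..<c} x * k0 x) = A r - A c"
          proof -
            have "(LINT x|lborel. indicator {r..<c} x * k0 x) = (LINT x|lborel. indicator {r..} x * k0 x - indicator {c..} x * k0 x)"
              using c(1) by (intro Bochner_Integration.integral_cong) (auto simp: indicator_def)
            then show ?thesis unfolding A_def by (simp add: ik)
          qed
          also have "b * (A r - A c) \<le> b * (1/2)" using r(2) c(3) b(1) by (intro mult_left_mono) auto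
          finally show "u s \<le> b / 2" by simp
        qed
      qed
    qed
  qed
  moreover obtain n :: nat where "2 * A t \<le> real n" using real_arch_simple by blast
  then have "A t \<le> (real n + 1) / 2" by simp
  ultimately show ?thesis using t by blast
qed

lemma borel_measurable_vec_nth: "(\<lambda>x::real^'n. x $ i) \<in> borel_measurable borel"
  by (intro borel_measurable_continuous_onI continuous_intros)

section \<open>Brownian filtration and increments\<close>

locale brownian = prob_space M for M :: "'a measure" +
  fixes W :: "real \<Rightarrow> 'a \<Rightarrow> real ^ 'd"
  assumes bm: "standard_brownian_motion M W"
begin

abbreviation "F \<equiv> brownian_filtration M W"

lemma W_measurable: "t \<ge> 0 \<Longrightarrow> W t \<in> borel_measurable M"
  using bm by (auto simp: standard_brownian_motion_def)

lemma filtration_generator_closed: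
  "{W s -` B \<inter> space M | s B. 0 \<le> s \<and> s \<le> t \<and> B \<in> sets borel} \<union> null_sets M \<subseteq> Pow (space M)"
  using sets.sets_into_space[OF null_setsD2] by blast

lemma space_F [simp]: "space (F t) = space M"
  unfolding brownian_filtration_def
  by (rule space_measure_of) (rule filtration_generator_closed)

lemma sets_F: "sets (F t) = sigma_sets (space M)
   ({W s -` B \<inter> space M | s B. 0 \<le> s \<and> s \<le> t \<and> B \<in> sets borel} \<union> null_sets M)"
  unfolding brownian_filtration_def
  by (rule sets_measure_of) (rule filtration_generator_closed)

lemma F_subset: "sets (F t) \<subseteq> sets M"
  unfolding sets_F
proof (rule sets.sigma_sets_subset, intro Un_least subsetI)
  fix A assume "A \<in> {W s -` B \<inter> space M | s B. 0 \<le> s \<and> s \<le> t \<and> B \<in> sets borel}"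
  then show "A \<in> sets M" using W_measurable by (force intro: measurable_sets)
qed (rule null_setsD2)

lemma F_mono: "s \<le> t \<Longrightarrow> sets (F s) \<subseteq> sets (F t)"
  unfolding sets_F by (intro sigma_sets_mono' Un_mono Collect_mono) (blast intro: order_trans)+

lemma F_measurable: "f \<in> measurable (F t) N \<Longrightarrow> f \<in> measurable M N"
  using F_subset[of t] by (auto simp: measurable_def)

lemma F_measurable_mono: "f \<in> measurable (F s) N \<Longrightarrow> s \<le> t \<Longrightarrow> f \<in> measurable (F t) N"
  using F_mono[of s t] by (auto simp: measurable_def)

lemma W_F: assumes "0 \<le> s" "s \<le> t" shows "W s \<in> borel_measurable (F t)"
proof (rule measurableI)
  fix B :: "(real^'d) set" assume "B \<in> sets borel"
  then show "W s -` B \<inter> space (F t) \<in> sets (F t)"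
    unfolding sets_F space_F using assms by (intro sigma_sets.Basic) auto
qed auto

text \<open>What completeness of the filtration is for: a process can be altered on a null event and
  stay adapted.\<close>

lemma null_F: "N \<in> null_sets M \<Longrightarrow> N \<in> sets (F t)"
  unfolding sets_F by (intro sigma_sets.Basic) auto

text \<open>Cylinder events are taken up to almost sure equality, so that null events are included and
  \<open>W 0 = 0\<close>, which holds only almost surely, can be used.\<close>

definition cylinder_events :: "real \<Rightarrow> 'a set set" where
  "cylinder_events a = {A \<in> sets M. \<exists>S C. finite S \<and> S \<subseteq> {0..a} \<and> (\<forall>s. C s \<in> sets borel) \<and>
      (AE \<omega> in M. \<omega> \<in> A \<longleftrightarrow> (\<forall>s\<in>S. W s \<omega> \<in> C s))}"

text \<open>The two time sets are joined; at a time that constrains only one of the events, the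
  other contributes \<open>UNIV\<close>.\<close>

lemma cylinder_events_Int_stable: "Int_stable (cylinder_events a)"
proof (rule Int_stableI)
  fix A B assume A: "A \<in> cylinder_events a" and B: "B \<in> cylinder_events a"
  obtain S C where S: "finite S" "S \<subseteq> {0..a}" "\<forall>s. C s \<in> sets borel"
     "AE \<omega> in M. \<omega> \<in> A \<longleftrightarrow> (\<forall>s\<in>S. W s \<omega> \<in> C s)" using A unfolding cylinder_events_def by blast
  obtain T D where T: "finite T" "T \<subseteq> {0..a}" "\<forall>s. D s \<in> sets borel"
     "AE \<omega> in M. \<omega> \<in> B \<longleftrightarrow> (\<forall>s\<in>T. W s \<omega> \<in> D s)" using B unfolding cylinder_events_def by blast
  let ?E = "\<lambda>s. (if s \<in> S then C s else UNIV) \<inter> (if s \<in> T then D s else UNIV)"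
  have "AE \<omega> in M. \<omega> \<in> A \<inter> B \<longleftrightarrow> (\<forall>s\<in>S \<union> T. W s \<omega> \<in> ?E s)"
    using S(4) T(4) by eventually_elim auto
  then show "A \<inter> B \<in> cylinder_events a"
    unfolding cylinder_events_def
  proof (intro CollectI conjI exI[of _ "S \<union> T"] exI[of _ ?E])
    show "A \<inter> B \<in> sets M" using A B by (simp add: cylinder_events_def sets.Int)
    show "finite (S \<union> T)" "S \<union> T \<subseteq> {0..a}" using S T by simp_all
    show "\<forall>s. ?E s \<in> sets borel" using S(3) T(3) by simp
  qed
qed

lemma F_subset_sigma_cylinder_events: assumes "0 \<le> a" shows "sets (F a) \<subseteq> sigma_sets (space M) (cylinder_events a)"
  unfolding sets_F
proof (rule sigma_sets_mono')
  show "{W s -` B \<inter> space M | s B. 0 \<le> s \<and> s \<le> a \<and> B \<in> sets borel} \<union> null_sets M \<subseteq> cylinder_events a"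
  proof (intro Un_least subsetI)
    fix A assume "A \<in> {W s -` B \<inter> space M | s B. 0 \<le> s \<and> s \<le> a \<and> B \<in> sets borel}"
    then obtain s B where "0 \<le> s" "s \<le> a" "B \<in> sets borel" "A = W s -` B \<inter> space M" by auto
    then have "A \<in> sets M \<and> finite {s} \<and> {s} \<subseteq> {0..a} \<and> (\<forall>s. B \<in> sets borel) \<and>
      (AE \<omega> in M. \<omega> \<in> A \<longleftrightarrow> (\<forall>s\<in>{s}. W s \<omega> \<in> B))"
      using W_measurable[of s] by (simp add: measurable_sets)
    then show "A \<in> cylinder_events a" unfolding cylinder_events_def
      by (intro CollectI conjI exI[of _ "{s}"] exI[of _ "\<lambda>_. B"]) simp_all
  next
    fix A assume A: "A \<in> null_sets M"
    then have "AE \<omega> in M. \<omega> \<notin> A" by (rule AE_not_in)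
    \<comment> \<open>A null event agrees almost surely with the impossible constraint
      \<open>W 0 \<omega> \<in> {}\<close>; time 0 is admissible because
      \<open>0 \<le> a\<close>.\<close>
    then have "A \<in> sets M \<and> finite {0::real} \<and> {0} \<subseteq> {0..a} \<and>
      (AE \<omega> in M. \<omega> \<in> A \<longleftrightarrow> (\<forall>s\<in>{0}. W s \<omega> \<in> {}))"
      using A assms by (simp add: null_setsD2)
    then show "A \<in> cylinder_events a" unfolding cylinder_events_def
      by (intro CollectI conjI exI[of _ "{0}"] exI[of _ "\<lambda>_. {}"]) simp_all
  qed
qed

text \<open>The increments over the sorted list of all times involved are independent. Since
  \<open>W 0 = 0\<close> almost surely, the values of \<open>W\<close> up to \<open>a\<close> are
  partial sums of all increments but the last, so up to a null event \<open>A\<close> depends on the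
  first \<open>n\<close> increments only, while the last one is \<open>W b - W a\<close>.\<close>

lemma indep_cylinder_increment:
  assumes a: "0 \<le> a" "a \<le> b" and A: "A \<in> cylinder_events a" and B: "B \<in> sets borel"
  shows "prob (A \<inter> ((\<lambda>\<omega>. W b \<omega> - W a \<omega>) -` B \<inter> space M))
     = prob A * prob ((\<lambda>\<omega>. W b \<omega> - W a \<omega>) -` B \<inter> space M)"
proof -
  obtain S C where S: "finite S" "S \<subseteq> {0..a}" and C: "\<forall>s. C s \<in> sets borel"
     and AE_A: "AE \<omega> in M. \<omega> \<in> A \<longleftrightarrow> (\<forall>s\<in>S. W s \<omega> \<in> C s)" and AM: "A \<in> sets M"
    using A unfolding cylinder_events_def by blast
  \<comment> \<open>With 0 and \<open>a\<close> inserted, the partial sums start at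
    \<open>W 0\<close> and the last increment, the one up to \<open>b\<close>, starts at
    \<open>a\<close>.\<close>
  define L where "L = sorted_list_of_set (insert 0 (insert a S))"
  have setL: "set L = insert 0 (insert a S)" and sortL: "sorted L" "distinct L"
    unfolding L_def using S(1) by (simp_all only: set_sorted_list_of_set sorted_sorted_list_of_set distinct_sorted_list_of_set finite_insert)
  define n where "n = length L - 1"
  have lenL: "length L = Suc n" unfolding n_def using setL by (cases L) simp_all
  define \<tau> where "\<tau> k = (if k \<le> n then L ! k else b)" for k
  have range: "x \<in> set L \<Longrightarrow> 0 \<le> x \<and> x \<le> a" for x using setL S a by auto
  have \<tau>0: "\<tau> 0 = 0"
  proof -
    have "0 \<in> set L" using setL by simp
    then obtain i where "i < length L" "L ! i = 0" by (auto simp: in_set_conv_nth)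
    then have "L ! 0 \<le> 0" using sorted_nth_mono[OF sortL(1), of 0 i] by simp
    then show ?thesis using range[of "L!0"] lenL by (auto simp: \<tau>_def)
  qed
  have \<tau>n: "\<tau> n = a"
  proof -
    have "a \<in> set L" using setL by simp
    then obtain i where "i < length L" "L ! i = a" by (auto simp: in_set_conv_nth)
    then have "a \<le> L ! n" using sorted_nth_mono[OF sortL(1), of i n] lenL by simp
    then show ?thesis using range[of "L!n"] lenL by (auto simp: \<tau>_def)
  qed
  have \<tau>S: "\<tau> (Suc n) = b" by (simp add: \<tau>_def)
  have mono: "\<tau> k \<le> \<tau> (Suc k)" if "k < Suc n" for k
  proof (cases "k < n")
    case True then show ?thesis using sortL lenL by (auto simp: \<tau>_def intro: sorted_nth_mono)
  next
    case False then have "k = n" using that by simp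
    then show ?thesis using \<tau>n \<tau>S a by simp
  qed
  have \<tau>nn: "0 \<le> \<tau> k" if "k \<le> Suc n" for k
    using that range[of "L!k"] lenL a by (auto simp: \<tau>_def)
  define X where "X k \<omega> = W (\<tau> (Suc k)) \<omega> - W (\<tau> k) \<omega>" for k \<omega>
  have ind: "indep_vars (\<lambda>_. borel) X {..<Suc n}"
  proof -
    have "0 \<le> \<tau> 0 \<and> (\<forall>k<Suc n. \<tau> k \<le> \<tau> (Suc k))" using \<tau>0 mono by simp
    then show ?thesis using bm unfolding standard_brownian_motion_def X_def by blast
  qed
  have iv: "indep_var (PiM {..<n} (\<lambda>_. borel)) (\<lambda>\<omega>. restrict (\<lambda>i. X i \<omega>) {..<n})
      (PiM {n} (\<lambda>_. borel)) (\<lambda>\<omega>. restrict (\<lambda>i. X i \<omega>) {n})"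
    by (rule indep_var_restrict[OF ind]) auto
  have "\<forall>s\<in>S. \<exists>k\<le>n. \<tau> k = s"
  proof
    fix s assume "s \<in> S"
    then have "s \<in> set L" using setL by simp
    then obtain i where "i < length L" "L ! i = s" by (auto simp: in_set_conv_nth)
    then show "\<exists>k\<le>n. \<tau> k = s" using lenL by (intro exI[of _ i]) (simp add: \<tau>_def)
  qed
  then obtain idx where idx: "\<And>s. s \<in> S \<Longrightarrow> idx s \<le> n \<and> \<tau> (idx s) = s" by (metis (no_types))
  \<comment> \<open>The event \<open>A\<close> expressed through increments: \<open>W s\<close> is
    the sum of the first \<open>idx s\<close> of them.\<close>
  define Z where "Z = {x \<in> space (PiM {..<n} (\<lambda>_. borel :: (real^'d) measure)). \<forall>s\<in>S. (\<Sum>i<idx s. x i) \<in> C s}"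
  have "(\<lambda>x. \<Sum>i<idx s. x i) \<in> borel_measurable (PiM {..<n} (\<lambda>_. borel :: (real^'d) measure))" if "s \<in> S" for s
    using idx[OF that] by (intro borel_measurable_sum measurable_component_singleton) auto
  then have Z: "Z \<in> sets (PiM {..<n} (\<lambda>_. borel))"
    unfolding Z_def using S C by (intro sets.sets_Collect_finite_All pred_sets2) auto
  have tele: "(\<Sum>i<k. X i \<omega>) = W (\<tau> k) \<omega> - W 0 \<omega>" if "k \<le> n" for k \<omega>
    using that by (induction k) (auto simp: X_def \<tau>0)
  let ?V = "(\<lambda>\<omega>. restrict (\<lambda>i. X i \<omega>) {..<n})"
  have W0: "AE \<omega> in M. W 0 \<omega> = 0" using bm by (auto simp: standard_brownian_motion_def)
  have AEZ: "AE \<omega> in M. \<omega> \<in> A \<longleftrightarrow> \<omega> \<in> ?V -` Z \<inter> space M"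
    using AE_A W0 AE_space
  proof eventually_elim
    case (elim \<omega>)
    have "(\<Sum>i<idx s. ?V \<omega> i) = W s \<omega>" if "s \<in> S" for s
    proof -
      have "(\<Sum>i<idx s. ?V \<omega> i) = (\<Sum>i<idx s. X i \<omega>)" using idx[OF that] by (intro sum.cong) auto
      then show ?thesis using tele idx[OF that] elim by simp
    qed
    then show ?case using elim by (auto simp: Z_def space_PiM)
  qed
  let ?Y = "(\<lambda>\<omega>. restrict (\<lambda>i. X i \<omega>) {n})"
  define Q where "Q = {x \<in> space (PiM {n} (\<lambda>_. borel :: (real^'d) measure)). x n \<in> B}"
  have Q: "Q \<in> sets (PiM {n} (\<lambda>_. borel))"
    unfolding Q_def using B by measurable
  have QX: "?Y -` Q \<inter> space M = X n -` B \<inter> space M"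
    by (auto simp: Q_def space_PiM)
  have rvV: "?V \<in> measurable M (PiM {..<n} (\<lambda>_. borel))" and rvX: "X n \<in> borel_measurable M"
    using iv ind unfolding indep_var_eq indep_vars_def2 by simp_all
  have VM: "?V -` Z \<inter> space M \<in> sets M" using rvV Z by (rule measurable_sets)
  have XM: "X n -` B \<inter> space M \<in> sets M" using rvX B by (rule measurable_sets)
  have Xn: "X n = (\<lambda>\<omega>. W b \<omega> - W a \<omega>)" by (auto simp: X_def \<tau>n \<tau>S)
  have "prob (A \<inter> (X n -` B \<inter> space M)) = prob ((?V -` Z \<inter> space M) \<inter> (X n -` B \<inter> space M))"
    using AEZ by (intro finite_measure_eq_AE) (use AM VM XM in auto)
  also have "\<dots> = prob (?V -` Z \<inter> space M) * prob (X n -` B \<inter> space M)"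
  proof (rule indep_setD)
    show "indep_set (sigma_sets (space M) {?V -` A \<inter> space M | A. A \<in> sets (PiM {..<n} (\<lambda>_. borel))})
      (sigma_sets (space M) {?Y -` A \<inter> space M | A. A \<in> sets (PiM {n} (\<lambda>_. borel))})"
      using iv unfolding indep_var_eq by blast
    show "?V -` Z \<inter> space M \<in> sigma_sets (space M) {?V -` A \<inter> space M | A. A \<in> sets (PiM {..<n} (\<lambda>_. borel))}"
      using Z by (intro sigma_sets.Basic) blast
    show "X n -` B \<inter> space M \<in> sigma_sets (space M) {?Y -` A \<inter> space M | A. A \<in> sets (PiM {n} (\<lambda>_. borel))}"
      using Q QX[symmetric] by (intro sigma_sets.Basic) blast
  qed
  also have "prob (?V -` Z \<inter> space M) = prob A"
    using AEZ by (intro finite_measure_eq_AE) (use AM VM in auto)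
  finally show ?thesis by (simp add: Xn)
qed

lemma increment_measurable: "0 \<le> a \<Longrightarrow> a \<le> b \<Longrightarrow> (\<lambda>\<omega>. W b \<omega> - W a \<omega>) \<in> borel_measurable M"
  using W_measurable[of a] W_measurable[of b] by simp

text \<open>Independence passes from a generating family closed under intersections to the generated
  sigma algebra. The function \<open>k\<close> stays general because both single coordinates of the
  increment and products of two coordinates are used later.\<close>

lemma indep_increment:
  assumes a: "0 \<le> a" "a \<le> b" and h: "h \<in> borel_measurable (F a)" and k: "k \<in> borel_measurable borel"
  shows "indep_var borel h borel (\<lambda>\<omega>. k (W b \<omega> - W a \<omega>))"
proof -
  let ?D = "\<lambda>\<omega>. W b \<omega> - W a \<omega>"
  have 1: "indep_set (cylinder_events a) {?D -` B \<inter> space M | B. B \<in> sets borel}"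
    unfolding indep_sets2_eq
  proof (intro conjI ballI)
    show "cylinder_events a \<subseteq> events" unfolding cylinder_events_def by blast
    show "{?D -` B \<inter> space M | B. B \<in> sets borel} \<subseteq> events"
      using measurable_sets[OF increment_measurable[OF a]] by blast
    fix A D assume A: "A \<in> cylinder_events a" and "D \<in> {?D -` B \<inter> space M | B. B \<in> sets borel}"
    then obtain B where "B \<in> sets borel" "D = ?D -` B \<inter> space M" by blast
    then show "prob (A \<inter> D) = prob A * prob D" using indep_cylinder_increment[OF a A] by simp
  qed
  have "indep_set (sigma_sets (space M) (cylinder_events a)) (sigma_sets (space M) {?D -` B \<inter> space M | B. B \<in> sets borel})"
  proof (rule indep_set_sigma_sets[OF 1 cylinder_events_Int_stable])
    show "Int_stable {?D -` B \<inter> space M | B. B \<in> sets borel}"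
    proof (rule Int_stableI)
      fix P Q assume "P \<in> {?D -` B \<inter> space M | B. B \<in> sets borel}" "Q \<in> {?D -` B \<inter> space M | B. B \<in> sets borel}"
      then obtain B C where "P = ?D -` B \<inter> space M" "Q = ?D -` C \<inter> space M" "B \<in> sets borel" "C \<in> sets borel" by auto
      then show "P \<inter> Q \<in> {?D -` B \<inter> space M | B. B \<in> sets borel}"
        by (intro CollectI exI[of _ "B \<inter> C"]) auto
    qed
  qed
  moreover have "sigma_sets (space M) {h -` A \<inter> space M | A. A \<in> sets borel} \<subseteq> sigma_sets (space M) (cylinder_events a)"
  proof -
    have "{h -` A \<inter> space M | A. A \<in> sets borel} \<subseteq> sets (F a)"
      using measurable_sets[OF h] by (simp add: subset_iff) blast
    then have "sigma_sets (space M) {h -` A \<inter> space M | A. A \<in> sets borel} \<subseteq> sets (F a)"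
      using sets.sigma_sets_subset[of _ "F a"] by simp
    then show ?thesis using F_subset_sigma_cylinder_events[OF a(1)] by auto
  qed
  moreover have "sigma_sets (space M) {(\<lambda>\<omega>. k (?D \<omega>)) -` A \<inter> space M | A. A \<in> sets borel}
     \<subseteq> sigma_sets (space M) {?D -` B \<inter> space M | B. B \<in> sets borel}"
  proof (rule sigma_sets_mono', rule subsetI)
    fix P assume "P \<in> {(\<lambda>\<omega>. k (?D \<omega>)) -` A \<inter> space M | A. A \<in> sets borel}"
    then obtain A where A: "A \<in> sets borel" "P = (\<lambda>\<omega>. k (?D \<omega>)) -` A \<inter> space M" by blast
    then have "P = ?D -` (k -` A) \<inter> space M" by auto
    moreover have "k -` A \<in> sets borel" using measurable_sets[OF k A(1)] by simp
    ultimately show "P \<in> {?D -` B \<inter> space M | B. B \<in> sets borel}" by blast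
  qed
  ultimately have "indep_set (sigma_sets (space M) {h -` A \<inter> space M | A. A \<in> sets borel})
     (sigma_sets (space M) {(\<lambda>\<omega>. k (?D \<omega>)) -` A \<inter> space M | A. A \<in> sets borel})"
    unfolding indep_sets2_eq by (meson subset_iff subset_trans)
  then show ?thesis unfolding indep_var_eq
    using F_measurable[OF h] measurable_compose[OF increment_measurable[OF a] k] by simp
qed

text \<open>Lebesgue measure on vectors is a product over \<open>Basis\<close>, whose elements are
  the vectors \<open>axis i 1\<close>; \<open>inv ?ax\<close> leads back from basis vectors to
  indices. The density factors in the same way, so the integral does too.\<close>

lemma increment_nn_integral_prod:
  assumes ab: "0 \<le> a" "a < b" and g: "\<And>i. g i \<in> borel_measurable borel"
  shows "(\<integral>\<^sup>+\<omega>. (\<Prod>i\<in>UNIV. g i ((W b \<omega> - W a \<omega>) $ i)) \<partial>M)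
      = (\<Prod>i\<in>UNIV. \<integral>\<^sup>+x. ennreal (normal_density 0 (sqrt (b - a)) x) * g i x \<partial>lborel)"
proof -
  let ?n = "normal_density 0 (sqrt (b - a))"
  let ?ax = "\<lambda>i::'d. axis i (1::real)"
  have inj: "inj ?ax" by (auto simp: inj_def axis_eq_axis)
  have Basis: "(Basis :: (real^'d) set) = range ?ax" by (auto simp: Basis_vec_def)
  have g': "g i \<in> borel_measurable lborel" for i using g by simp
  note [measurable] = g
  have D: "distributed M lborel (\<lambda>\<omega>. W b \<omega> - W a \<omega>) (\<lambda>x. ennreal (\<Prod>i\<in>UNIV. ?n (x $ i)))"
    using bm ab by (auto simp: standard_brownian_motion_def)
  have "(\<integral>\<^sup>+\<omega>. (\<Prod>i\<in>UNIV. g i ((W b \<omega> - W a \<omega>) $ i)) \<partial>M)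
     = (\<integral>\<^sup>+x. ennreal (\<Prod>i\<in>UNIV. ?n (x $ i)) * (\<Prod>i\<in>UNIV. g i (x $ i)) \<partial>lborel)"
    by (rule distributed_nn_integral[OF D, symmetric]) measurable
  also have "\<dots> = (\<integral>\<^sup>+x. (\<Prod>i\<in>UNIV. ennreal (?n (x $ i)) * g i (x $ i)) \<partial>lborel)"
    by (simp add: prod_ennreal[symmetric] prod.distrib)
  also have "\<dots> = (\<integral>\<^sup>+x. (\<Prod>e\<in>Basis. ennreal (?n (x \<bullet> e)) * g (inv ?ax e) (x \<bullet> e)) \<partial>lborel)"
    unfolding Basis by (simp add: prod.reindex[OF inj] inv_f_f[OF inj] inner_axis)
  also have "\<dots> = (\<Prod>e\<in>Basis. \<integral>\<^sup>+x. ennreal (?n x) * g (inv ?ax e) x \<partial>lborel)"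
    by (rule nn_integral_lborel_prod) measurable
  also have "\<dots> = (\<Prod>i\<in>UNIV. \<integral>\<^sup>+x. ennreal (?n x) * g i x \<partial>lborel)"
    unfolding Basis by (simp add: prod.reindex[OF inj] inv_f_f[OF inj])
  finally show ?thesis .
qed

abbreviation inc :: "'d \<Rightarrow> real \<Rightarrow> real \<Rightarrow> 'a \<Rightarrow> real" where
  "inc i a b \<omega> \<equiv> (W b \<omega> - W a \<omega>) $ i"

lemma inc_measurable: "0 \<le> a \<Longrightarrow> 0 \<le> b \<Longrightarrow> inc i a b \<in> borel_measurable M"
  by (intro measurable_compose[OF borel_measurable_diff borel_measurable_vec_nth] W_measurable)

lemma nn_integral_normal_density: "0 < s \<Longrightarrow> (\<integral>\<^sup>+x. ennreal (normal_density 0 s x) \<partial>lborel) = 1"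
  using prob_space.emeasure_space_1[OF prob_space_normal_density[of s 0]]
  by (simp add: emeasure_density)

text \<open>Coordinates outside \<open>I\<close> carry the constant 1 and contribute the total mass
  of a normal density.\<close>

lemma increment_nn_integral_coordinates:
  assumes ab: "0 \<le> a" "a < b" and g: "\<And>i. g i \<in> borel_measurable borel"
  shows "(\<integral>\<^sup>+\<omega>. (\<Prod>i\<in>I. g i (inc i a b \<omega>)) \<partial>M)
      = (\<Prod>i\<in>I. \<integral>\<^sup>+x. ennreal (normal_density 0 (sqrt (b - a)) x) * g i x \<partial>lborel)"
proof -
  let ?g = "\<lambda>i. if i \<in> I then g i else (\<lambda>_. 1)"
  have *: "(\<Prod>i\<in>UNIV. if i \<in> I then f i else 1) = prod f I" for f :: "'d \<Rightarrow> ennreal"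
    by (simp add: prod.If_cases)
  have "(\<integral>\<^sup>+\<omega>. (\<Prod>i\<in>UNIV. ?g i (inc i a b \<omega>)) \<partial>M)
      = (\<Prod>i\<in>UNIV. \<integral>\<^sup>+x. ennreal (normal_density 0 (sqrt (b - a)) x) * ?g i x \<partial>lborel)"
    using ab g by (intro increment_nn_integral_prod) auto
  also have "\<dots> = (\<Prod>i\<in>UNIV. if i \<in> I then \<integral>\<^sup>+x. ennreal (normal_density 0 (sqrt (b - a)) x) * g i x \<partial>lborel else 1)"
    using ab by (intro prod.cong) (auto simp: nn_integral_normal_density)
  finally show ?thesis by (simp add: if_distribR * cong: if_cong)
qed

lemma inc_distributed:
  assumes ab: "0 \<le> a" "a < b"
  shows "distributed M lborel (inc i a b) (\<lambda>x. ennreal (normal_density 0 (sqrt (b - a)) x))"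
  unfolding distributed_def
proof (intro conjI)
  show "inc i a b \<in> measurable M lborel" using inc_measurable[of a b i] ab by simp
  then have m: "inc i a b \<in> measurable M lborel" .
  show "distr M lborel (inc i a b) = density lborel (\<lambda>x. ennreal (normal_density 0 (sqrt (b - a)) x))"
  proof (rule measure_eqI)
    fix A assume "A \<in> sets (distr M lborel (inc i a b))"
    then have [measurable]: "A \<in> sets borel" by simp
    have "emeasure (distr M lborel (inc i a b)) A = (\<integral>\<^sup>+x. indicator A x \<partial>distr M lborel (inc i a b))"
      by simp
    also have "\<dots> = (\<integral>\<^sup>+\<omega>. indicator A (inc i a b \<omega>) \<partial>M)"
      using m by (intro nn_integral_distr) auto
    also have "\<dots> = (\<integral>\<^sup>+x. ennreal (normal_density 0 (sqrt (b - a)) x) * indicator A x \<partial>lborel)"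
      using increment_nn_integral_coordinates[OF ab, of "\<lambda>_. indicator A" "{i}"] by simp
    also have "\<dots> = emeasure (density lborel (\<lambda>x. ennreal (normal_density 0 (sqrt (b - a)) x))) A"
      by (simp add: emeasure_density)
    finally show "emeasure (distr M lborel (inc i a b)) A = \<dots>" .
  qed simp
qed simp

text \<open>The case \<open>a = b\<close>, in which the increment has no density, is included
  because truncation of intervals produces empty ones. The factor 3 is the fourth moment of a
  standard normal variable.\<close>

lemma inc_moments:
  assumes ab: "0 \<le> a" "a \<le> b"
  shows "integrable M (inc i a b)" "expectation (inc i a b) = 0"
    "integrable M (\<lambda>\<omega>. (inc i a b \<omega>)\<^sup>2)" "expectation (\<lambda>\<omega>. (inc i a b \<omega>)\<^sup>2) = b - a"
    "integrable M (\<lambda>\<omega>. (inc i a b \<omega>)^4)" "expectation (\<lambda>\<omega>. (inc i a b \<omega>)^4) = 3 * (b - a)\<^sup>2"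
proof -
  have "integrable M (inc i a b) \<and> expectation (inc i a b) = 0 \<and>
    integrable M (\<lambda>\<omega>. (inc i a b \<omega>)\<^sup>2) \<and> expectation (\<lambda>\<omega>. (inc i a b \<omega>)\<^sup>2) = b - a \<and>
    integrable M (\<lambda>\<omega>. (inc i a b \<omega>)^4) \<and> expectation (\<lambda>\<omega>. (inc i a b \<omega>)^4) = 3 * (b - a)\<^sup>2"
  proof (cases "a = b")
    case False
    then have ab': "a < b" using ab by simp
    then have s: "0 < sqrt (b - a)" by simp
    note D = inc_distributed[OF ab(1) ab', of i]
    have int: "integrable M (\<lambda>\<omega>. (inc i a b \<omega>)^k)" for k
      using integrable_normal_moment[OF s, of 0 k] distributed_integrable[OF D, of "\<lambda>x. x^k"] by simp
    have val: "expectation (\<lambda>\<omega>. (inc i a b \<omega>)^k) = (\<integral>x. normal_density 0 (sqrt (b - a)) x * x^k \<partial>lborel)" for k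
      using distributed_integral[OF D, of "\<lambda>x. x^k"] by simp
    have 1: "expectation (inc i a b) = 0"
      using val[of 1] integral_normal_moment_odd[OF s, of 0 0] by simp
    have 2: "expectation (\<lambda>\<omega>. (inc i a b \<omega>)\<^sup>2) = b - a"
      using val[of 2] integral_normal_moment_even[OF s, of 0 1] ab' by (simp add: fact_numeral)
    have 4: "expectation (\<lambda>\<omega>. (inc i a b \<omega>)^4) = 3 * (b - a)\<^sup>2"
      using val[of 4] integral_normal_moment_even[OF s, of 0 2] ab'
      by (simp add: fact_numeral field_simps power2_eq_square)
    show ?thesis using int[of 1] int[of 2] int[of 4] 1 2 4 by simp
  qed simp
  then show "integrable M (inc i a b)" "expectation (inc i a b) = 0"
    "integrable M (\<lambda>\<omega>. (inc i a b \<omega>)\<^sup>2)" "expectation (\<lambda>\<omega>. (inc i a b \<omega>)\<^sup>2) = b - a"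
    "integrable M (\<lambda>\<omega>. (inc i a b \<omega>)^4)" "expectation (\<lambda>\<omega>. (inc i a b \<omega>)^4) = 3 * (b - a)\<^sup>2"
    by blast+
qed

text \<open>The joint density is a product, so different coordinates of one increment are
  independent, and both are centred.\<close>

lemma inc_orthogonal:
  assumes ab: "0 \<le> a" "a \<le> b" and ij: "i \<noteq> j"
  shows "expectation (\<lambda>\<omega>. inc i a b \<omega> * inc j a b \<omega>) = 0"
proof (cases "a = b")
  case False
  then have ab': "a < b" using ab by simp
  have m [measurable]: "inc i a b \<in> borel_measurable M" "inc j a b \<in> borel_measurable M"
    using inc_measurable ab by auto
  have "indep_var borel (inc i a b) borel (inc j a b)"
    unfolding indep_var_def indep_vars_def2
  proof (intro conjI ballI)
    have *: "(\<lambda>x. {case_bool (inc i a b) (inc j a b) x -` A \<inter> space M | A. A \<in> sets (case_bool borel borel x)})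
       = case_bool {inc i a b -` A \<inter> space M | A. A \<in> sets borel} {inc j a b -` A \<inter> space M | A. A \<in> sets borel}"
      by (rule ext) (simp split: bool.split)
    have "indep_set {inc i a b -` A \<inter> space M | A. A \<in> sets borel} {inc j a b -` A \<inter> space M | A. A \<in> sets borel}"
      unfolding indep_sets2_eq
    proof (intro conjI ballI)
      show "{inc i a b -` A \<inter> space M | A. A \<in> sets borel} \<subseteq> events"
        using measurable_sets[OF m(1)] by blast
      show "{inc j a b -` A \<inter> space M | A. A \<in> sets borel} \<subseteq> events"
        using measurable_sets[OF m(2)] by blast
      fix P Q assume "P \<in> {inc i a b -` A \<inter> space M | A. A \<in> sets borel}"
        and "Q \<in> {inc j a b -` A \<inter> space M | A. A \<in> sets borel}"
      then obtain A B where [measurable]: "A \<in> sets borel" "B \<in> sets borel"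
        and PQ: "P = inc i a b -` A \<inter> space M" "Q = inc j a b -` B \<inter> space M" by blast
      let ?g = "\<lambda>k. if k = i then indicator A else (indicator B :: real \<Rightarrow> ennreal)"
      have gm: "?g k \<in> borel_measurable borel" for k by auto
      have [measurable]: "P \<in> sets M" "Q \<in> sets M" unfolding PQ by measurable
      have "emeasure M (P \<inter> Q) = (\<integral>\<^sup>+\<omega>. indicator (P \<inter> Q) \<omega> \<partial>M)" by simp
      also have "\<dots> = (\<integral>\<^sup>+\<omega>. (\<Prod>k\<in>{i,j}. ?g k (inc k a b \<omega>)) \<partial>M)"
        using ij by (intro nn_integral_cong) (auto simp: PQ indicator_def)
      also have "\<dots> = (\<Prod>k\<in>{i,j}. \<integral>\<^sup>+x. ennreal (normal_density 0 (sqrt (b - a)) x) * ?g k x \<partial>lborel)"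
        by (rule increment_nn_integral_coordinates[OF ab(1) ab' gm])
      also have "\<dots> = (\<integral>\<^sup>+x. ennreal (normal_density 0 (sqrt (b - a)) x) * indicator A x \<partial>lborel)
          * (\<integral>\<^sup>+x. ennreal (normal_density 0 (sqrt (b - a)) x) * indicator B x \<partial>lborel)"
        using ij by simp
      also have "(\<integral>\<^sup>+x. ennreal (normal_density 0 (sqrt (b - a)) x) * indicator A x \<partial>lborel)
          = (\<integral>\<^sup>+\<omega>. indicator A (inc i a b \<omega>) \<partial>M)"
        using increment_nn_integral_coordinates[OF ab(1) ab', of "\<lambda>_. indicator A" "{i}"] by simp
      also have "\<dots> = (\<integral>\<^sup>+\<omega>. indicator P \<omega> \<partial>M)"
        by (intro nn_integral_cong) (auto simp: PQ indicator_def)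
      also have "(\<integral>\<^sup>+x. ennreal (normal_density 0 (sqrt (b - a)) x) * indicator B x \<partial>lborel)
          = (\<integral>\<^sup>+\<omega>. indicator B (inc j a b \<omega>) \<partial>M)"
        using increment_nn_integral_coordinates[OF ab(1) ab', of "\<lambda>_. indicator B" "{j}"] by simp
      also have "\<dots> = (\<integral>\<^sup>+\<omega>. indicator Q \<omega> \<partial>M)"
        by (intro nn_integral_cong) (auto simp: PQ indicator_def)
      finally have "emeasure M (P \<inter> Q) = emeasure M P * emeasure M Q" by simp
      then show "prob (P \<inter> Q) = prob P * prob Q"
        by (simp add: emeasure_eq_measure ennreal_mult[symmetric])
    qed
    then show "indep_sets (\<lambda>x. {case_bool (inc i a b) (inc j a b) x -` A \<inter> space M | A. A \<in> sets (case_bool borel borel x)}) UNIV"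
      unfolding * indep_set_def .
  qed (use m in \<open>simp split: bool.split\<close>)
  then have "expectation (\<lambda>\<omega>. inc i a b \<omega> * inc j a b \<omega>) = expectation (inc i a b) * expectation (inc j a b)"
    by (rule indep_var_lebesgue_integral) (use inc_moments ab in auto)
  then show ?thesis using inc_moments[OF ab] by simp
qed simp

end

section \<open>The Ito integral of simple processes and its isometric extension\<close>

text \<open>The tuple \<open>(a, b, i, h)\<close> stands for the integrand \<open>h\<close> on the interval \<open>(a, b]\<close> in direction \<open>i\<close>. A list
  of such tuples, with intervals that may overlap, stands for the sum; this makes the simple integrands
  closed under addition without refining partitions.\<close>

type_synonym ('a, 'd) elem = "real \<times> real \<times> 'd \<times> ('a \<Rightarrow> real)"

context brownian begin

definition elem_ok :: "('a, 'd) elem \<Rightarrow> bool" where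
  "elem_ok e \<longleftrightarrow> (case e of (a, b, i, h) \<Rightarrow> 0 \<le> a \<and> a \<le> b \<and> h \<in> borel_measurable (F a) \<and>
     (\<exists>C. \<forall>\<omega>\<in>space M. \<bar>h \<omega>\<bar> \<le> C))"

definition elem_int :: "('a, 'd) elem \<Rightarrow> 'a \<Rightarrow> real" where
  "elem_int e \<omega> = (case e of (a, b, i, h) \<Rightarrow> h \<omega> * inc i a b \<omega>)"

definition elem_proc :: "('a, 'd) elem \<Rightarrow> real \<Rightarrow> 'a \<Rightarrow> real^'d" where
  "elem_proc e s \<omega> = (case e of (a, b, i, h) \<Rightarrow> axis i (indicator {a<..b} s * h \<omega>))"

lemma bounded_integrable:
  assumes "h \<in> borel_measurable M" "\<And>\<omega>. \<omega> \<in> space M \<Longrightarrow> \<bar>h \<omega>\<bar> \<le> C"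
  shows "integrable M (h :: 'a \<Rightarrow> real)"
  using assms by (intro integrable_const_bound[of _ C]) auto

lemma bounded_mult_integrable:
  assumes "h \<in> borel_measurable M" "\<And>\<omega>. \<omega> \<in> space M \<Longrightarrow> \<bar>h \<omega>\<bar> \<le> C" "integrable M (G :: 'a \<Rightarrow> real)"
  shows "integrable M (\<lambda>\<omega>. h \<omega> * G \<omega>)"
proof (rule Bochner_Integration.integrable_bound[of _ "\<lambda>\<omega>. C * G \<omega>"])
  show "integrable M (\<lambda>\<omega>. C * G \<omega>)" using assms by simp
  show "(\<lambda>\<omega>. h \<omega> * G \<omega>) \<in> borel_measurable M" using assms by simp
  show "AE \<omega> in M. norm (h \<omega> * G \<omega>) \<le> norm (C * G \<omega>)"
  proof (rule AE_I2)
    fix \<omega> assume "\<omega> \<in> space M"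
    then have "\<bar>h \<omega>\<bar> \<le> \<bar>C\<bar>" using assms(2)[of \<omega>] by linarith
    then show "norm (h \<omega> * G \<omega>) \<le> norm (C * G \<omega>)" by (simp add: abs_mult mult_right_mono)
  qed
qed

lemma inc_F: "0 \<le> a \<Longrightarrow> 0 \<le> b \<Longrightarrow> a \<le> c \<Longrightarrow> b \<le> c \<Longrightarrow> inc i a b \<in> borel_measurable (F c)"
  by (intro measurable_compose[OF borel_measurable_diff borel_measurable_vec_nth] W_F)

section \<open>Covariances of weighted increments\<close>

lemma mult_increment:
  assumes ab: "0 \<le> a" "a \<le> b" and G: "G \<in> borel_measurable (F a)" "integrable M G"
  shows "integrable M (\<lambda>\<omega>. G \<omega> * inc i a b \<omega>)" "expectation (\<lambda>\<omega>. G \<omega> * inc i a b \<omega>) = 0"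
proof -
  have I: "indep_var borel G borel (inc i a b)"
    by (rule indep_increment[OF ab G(1) borel_measurable_vec_nth])
  show "integrable M (\<lambda>\<omega>. G \<omega> * inc i a b \<omega>)"
    by (rule indep_var_integrable[OF I G(2) inc_moments(1)[OF ab]])
  show "expectation (\<lambda>\<omega>. G \<omega> * inc i a b \<omega>) = 0"
    using indep_var_lebesgue_integral[OF I G(2) inc_moments(1)[OF ab]] inc_moments(2)[OF ab] by simp
qed

lemma inc_mult_integrable:
  assumes "0 \<le> a" "a \<le> b" "0 \<le> a'" "a' \<le> b'"
  shows "integrable M (\<lambda>\<omega>. inc i a b \<omega> * inc j a' b' \<omega>)"
proof -
  have b: "0 \<le> b" "0 \<le> b'" using assms by simp_all
  show ?thesis
    by (rule L2_mult_integrable[OF inc_measurable[OF assms(1) b(1)] inc_measurable[OF assms(3) b(2)]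
      inc_moments(3)[OF assms(1,2)] inc_moments(3)[OF assms(3,4)]])
qed

lemma covariance_same_interval:
  assumes am: "0 \<le> a" "a \<le> m" and H: "H \<in> borel_measurable (F a)" "\<And>\<omega>. \<omega> \<in> space M \<Longrightarrow> \<bar>H \<omega>\<bar> \<le> C"
  shows "expectation (\<lambda>\<omega>. H \<omega> * (inc i a m \<omega> * inc j a m \<omega>)) = expectation H * (if i = j then m - a else 0)"
proof -
  have I: "indep_var borel H borel (\<lambda>\<omega>. inc i a m \<omega> * inc j a m \<omega>)"
    by (rule indep_increment[OF am H(1), of "\<lambda>x. x $ i * x $ j"])
      (intro borel_measurable_times borel_measurable_vec_nth)
  have "expectation (\<lambda>\<omega>. H \<omega> * (inc i a m \<omega> * inc j a m \<omega>))
     = expectation H * expectation (\<lambda>\<omega>. inc i a m \<omega> * inc j a m \<omega>)"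
    by (rule indep_var_lebesgue_integral[OF I bounded_integrable[OF F_measurable[OF H(1)] H(2)]
      inc_mult_integrable[OF am am]])
  moreover have "expectation (\<lambda>\<omega>. inc i a m \<omega> * inc j a m \<omega>) = (if i = j then m - a else 0)"
    using inc_orthogonal[OF am, of i j] inc_moments(4)[OF am, of j]
    unfolding power2_eq_square by (cases "i = j") simp_all
  ultimately show ?thesis by simp
qed

text \<open>The later increment is independent of everything known at \<open>a'\<close>, which
  includes the earlier increment and the weight.\<close>

lemma covariance_disjoint:
  assumes ab: "0 \<le> a" "a \<le> b" "b \<le> a'" "a' \<le> b'"
    and H: "H \<in> borel_measurable (F a')" "\<And>\<omega>. \<omega> \<in> space M \<Longrightarrow> \<bar>H \<omega>\<bar> \<le> C"
  shows "expectation (\<lambda>\<omega>. H \<omega> * (inc i a b \<omega> * inc j a' b' \<omega>)) = 0"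
proof -
  have "expectation (\<lambda>\<omega>. (H \<omega> * inc i a b \<omega>) * inc j a' b' \<omega>) = 0"
  proof (rule mult_increment)
    show "(\<lambda>\<omega>. H \<omega> * inc i a b \<omega>) \<in> borel_measurable (F a')"
      using ab by (intro borel_measurable_times H(1) inc_F) auto
    show "integrable M (\<lambda>\<omega>. H \<omega> * inc i a b \<omega>)"
      using F_measurable[OF H(1)] H(2) inc_moments(1)[OF ab(1,2)] by (rule bounded_mult_integrable)
  qed (use ab in auto)
  then show ?thesis by (simp only: mult.assoc)
qed

lemma inc_split: "inc i a c \<omega> = inc i a b \<omega> + inc i b c \<omega>" by simp

lemma H_inc_integrable:
  assumes "0 \<le> a" "a \<le> b" "0 \<le> a'" "a' \<le> b'"
    and H: "H \<in> borel_measurable (F c)" "\<And>\<omega>. \<omega> \<in> space M \<Longrightarrow> \<bar>H \<omega>\<bar> \<le> C"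
  shows "integrable M (\<lambda>\<omega>. H \<omega> * (inc i a b \<omega> * inc j a' b' \<omega>))"
  by (rule bounded_mult_integrable[OF F_measurable[OF H(1)] H(2) inc_mult_integrable[OF assms(1-4)]])

text \<open>The longer interval is cut at \<open>m\<close>: its first part is the shorter interval,
  its second part is disjoint from it.\<close>

lemma covariance_same_start:
  assumes am: "0 \<le> a" "a \<le> m" "m \<le> n" and H: "H \<in> borel_measurable (F a)" "\<And>\<omega>. \<omega> \<in> space M \<Longrightarrow> \<bar>H \<omega>\<bar> \<le> C"
  shows "expectation (\<lambda>\<omega>. H \<omega> * (inc i a m \<omega> * inc j a n \<omega>)) = expectation H * (if i = j then m - a else 0)"
proof -
  have Hm: "H \<in> borel_measurable (F m)" using H(1) am(2) by (rule F_measurable_mono)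
  have eq: "(\<lambda>\<omega>. H \<omega> * (inc i a m \<omega> * inc j a n \<omega>))
     = (\<lambda>\<omega>. H \<omega> * (inc i a m \<omega> * inc j a m \<omega>) + H \<omega> * (inc i a m \<omega> * inc j m n \<omega>))"
    by (rule ext, subst inc_split[where i = j and a = a and c = n and b = m], simp only: algebra_simps)
  have "expectation (\<lambda>\<omega>. H \<omega> * (inc i a m \<omega> * inc j a m \<omega>) + H \<omega> * (inc i a m \<omega> * inc j m n \<omega>))
    = expectation (\<lambda>\<omega>. H \<omega> * (inc i a m \<omega> * inc j a m \<omega>)) + expectation (\<lambda>\<omega>. H \<omega> * (inc i a m \<omega> * inc j m n \<omega>))"
    by (rule Bochner_Integration.integral_add; rule H_inc_integrable[OF _ _ _ _ Hm H(2)]) (use am in auto)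
  moreover have "expectation (\<lambda>\<omega>. H \<omega> * (inc i a m \<omega> * inc j m n \<omega>)) = 0"
    using am by (intro covariance_disjoint[OF _ _ _ _ Hm H(2)]) auto
  ultimately show ?thesis
    unfolding eq using covariance_same_interval[OF am(1,2) H(1) H(2), of i j] by simp
qed

text \<open>The interval that begins earlier is cut at \<open>a'\<close>. Its first part is disjoint
  from the other interval and its remainder starts where the other one starts, so only the overlap
  contributes. The weight is taken measurable at the later start because that is what a product of
  two heights offers.\<close>

lemma covariance_le:
  assumes ab: "0 \<le> a" "a \<le> b" "a' \<le> b'" "a \<le> a'"
    and H: "H \<in> borel_measurable (F a')" "\<And>\<omega>. \<omega> \<in> space M \<Longrightarrow> \<bar>H \<omega>\<bar> \<le> C"
  shows "expectation (\<lambda>\<omega>. H \<omega> * (inc i a b \<omega> * inc j a' b' \<omega>))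
     = expectation H * (if i = j then max 0 (min b b' - max a a') else 0)"
proof (cases "b \<le> a'")
  case True
  have "expectation (\<lambda>\<omega>. H \<omega> * (inc i a b \<omega> * inc j a' b' \<omega>)) = 0"
    using ab True by (intro covariance_disjoint[OF _ _ _ _ H(1) H(2)]) auto
  then show ?thesis using True ab by (auto simp: max_def min_def)
next
  case False
  have eq: "(\<lambda>\<omega>. H \<omega> * (inc i a b \<omega> * inc j a' b' \<omega>))
     = (\<lambda>\<omega>. H \<omega> * (inc i a a' \<omega> * inc j a' b' \<omega>) + H \<omega> * (inc i a' b \<omega> * inc j a' b' \<omega>))"
    by (rule ext, subst inc_split[where i = i and a = a and c = b and b = a'], simp only: algebra_simps)
  have "expectation (\<lambda>\<omega>. H \<omega> * (inc i a a' \<omega> * inc j a' b' \<omega>) + H \<omega> * (inc i a' b \<omega> * inc j a' b' \<omega>))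
    = expectation (\<lambda>\<omega>. H \<omega> * (inc i a a' \<omega> * inc j a' b' \<omega>)) + expectation (\<lambda>\<omega>. H \<omega> * (inc i a' b \<omega> * inc j a' b' \<omega>))"
    by (rule Bochner_Integration.integral_add; rule H_inc_integrable[OF _ _ _ _ H(1) H(2)]) (use ab False in auto)
  moreover have "expectation (\<lambda>\<omega>. H \<omega> * (inc i a a' \<omega> * inc j a' b' \<omega>)) = 0"
    using ab False by (intro covariance_disjoint[OF _ _ _ _ H(1) H(2)]) auto
  moreover have "expectation (\<lambda>\<omega>. H \<omega> * (inc i a' b \<omega> * inc j a' b' \<omega>)) = expectation H * (if i = j then min b b' - a' else 0)"
  proof (cases "b \<le> b'")
    case True
    then show ?thesis using ab False covariance_same_start[OF _ _ True H(1) H(2), of i j] by auto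
  next
    case F: False
    have "expectation (\<lambda>\<omega>. H \<omega> * (inc j a' b' \<omega> * inc i a' b \<omega>)) = expectation H * (if j = i then b' - a' else 0)"
      using ab F by (intro covariance_same_start[OF _ _ _ H(1) H(2)]) auto
    then show ?thesis using F by (simp only: mult.commute[of "inc i a' b _"] eq_commute[of i j] min_def if_False)
  qed
  ultimately show ?thesis unfolding eq using False ab by (auto simp: max_def)
qed

text \<open>The formula agrees with the one for the integrands in \<open>elem_proc_integral\<close>,
  and this agreement is the whole isometry. Which interval starts first is settled by
  symmetry.\<close>

lemma elem_int_covariance:
  assumes "elem_ok (a,b,i,h)" "elem_ok (a',b',i',h')"
  shows "integrable M (\<lambda>\<omega>. elem_int (a,b,i,h) \<omega> * elem_int (a',b',i',h') \<omega>)"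
    "expectation (\<lambda>\<omega>. elem_int (a,b,i,h) \<omega> * elem_int (a',b',i',h') \<omega>)
      = expectation (\<lambda>\<omega>. h \<omega> * h' \<omega>) * (if i = i' then max 0 (min b b' - max a a') else 0)"
proof -
  obtain C C' where ab: "0 \<le> a" "a \<le> b" "0 \<le> a'" "a' \<le> b'"
    and h: "h \<in> borel_measurable (F a)" "\<And>\<omega>. \<omega> \<in> space M \<Longrightarrow> \<bar>h \<omega>\<bar> \<le> C"
    and h': "h' \<in> borel_measurable (F a')" "\<And>\<omega>. \<omega> \<in> space M \<Longrightarrow> \<bar>h' \<omega>\<bar> \<le> C'"
    using assms by (auto simp: elem_ok_def)
  let ?H = "\<lambda>\<omega>. h \<omega> * h' \<omega>"
  have Hb: "\<bar>?H \<omega>\<bar> \<le> C * C'" if "\<omega> \<in> space M" for \<omega>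
    unfolding abs_mult using h(2)[OF that] h'(2)[OF that] by (intro mult_mono) auto
  have Hm: "?H \<in> borel_measurable (F c)" if "a \<le> c" "a' \<le> c" for c
    using F_measurable_mono[OF h(1) that(1)] F_measurable_mono[OF h'(1) that(2)] by (rule borel_measurable_times)
  have eq: "(\<lambda>\<omega>. elem_int (a,b,i,h) \<omega> * elem_int (a',b',i',h') \<omega>) = (\<lambda>\<omega>. ?H \<omega> * (inc i a b \<omega> * inc i' a' b' \<omega>))"
    unfolding elem_int_def by (rule ext) (simp only: prod.case mult_ac)
  show "integrable M (\<lambda>\<omega>. elem_int (a,b,i,h) \<omega> * elem_int (a',b',i',h') \<omega>)"
    unfolding eq by (rule H_inc_integrable[OF ab Hm[of "max a a'"] Hb]) auto
  have "expectation (\<lambda>\<omega>. ?H \<omega> * (inc i a b \<omega> * inc i' a' b' \<omega>)) = expectation ?H * (if i = i' then max 0 (min b b' - max a a') else 0)"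
  proof (cases "a \<le> a'")
    case True
    then show ?thesis by (intro covariance_le[OF ab(1,2,4) _ Hm Hb]) auto
  next
    case False
    then have "expectation (\<lambda>\<omega>. ?H \<omega> * (inc i' a' b' \<omega> * inc i a b \<omega>)) = expectation ?H * (if i' = i then max 0 (min b' b - max a' a) else 0)"
      by (intro covariance_le[OF ab(3,4,2) _ Hm Hb]) auto
    then show ?thesis
      by (simp only: mult.commute[of "inc i a b _"] eq_commute[of i] min.commute[of b] max.commute[of a])
  qed
  then show "expectation (\<lambda>\<omega>. elem_int (a,b,i,h) \<omega> * elem_int (a',b',i',h') \<omega>)
      = expectation ?H * (if i = i' then max 0 (min b b' - max a a') else 0)"
    unfolding eq .
qed

lemma elem_proc_inner:
  "elem_proc (a,b,i,h) s \<omega> \<bullet> elem_proc (a',b',i',h') s \<omega>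
     = indicator {max a a'<..min b b'} s * (if i = i' then h \<omega> * h' \<omega> else 0)"
  by (auto simp: elem_proc_def inner_axis_axis indicator_def)

lemma elem_proc_integral:
  "integrable lborel (\<lambda>s. elem_proc (a,b,i,h) s \<omega> \<bullet> elem_proc (a',b',i',h') s \<omega>)"
  "(LINT s|lborel. elem_proc (a,b,i,h) s \<omega> \<bullet> elem_proc (a',b',i',h') s \<omega>)
     = h \<omega> * h' \<omega> * (if i = i' then max 0 (min b b' - max a a') else 0)"
proof -
  have "emeasure lborel {x<..y} < \<infinity>" for x y :: real
    by (cases "x \<le> y") auto
  then show "integrable lborel (\<lambda>s. elem_proc (a,b,i,h) s \<omega> \<bullet> elem_proc (a',b',i',h') s \<omega>)"
    unfolding elem_proc_inner by (intro integrable_mult_left integrable_real_indicator) auto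
  have "measure lborel {max a a'<..min b b'} = max 0 (min b b' - max a a')"
    by (cases "max a a' \<le> min b b'") (auto simp: max_def)
  then show "(LINT s|lborel. elem_proc (a,b,i,h) s \<omega> \<bullet> elem_proc (a',b',i',h') s \<omega>)
     = h \<omega> * h' \<omega> * (if i = i' then max 0 (min b b' - max a a') else 0)"
    unfolding elem_proc_inner by simp
qed

section \<open>Lists of elements and their isometry\<close>

definition simple :: "('a, 'd) elem list \<Rightarrow> bool" where
  "simple l \<longleftrightarrow> (\<forall>e\<in>set l. elem_ok e)"

definition iint :: "('a, 'd) elem list \<Rightarrow> 'a \<Rightarrow> real" where
  "iint l \<omega> = (\<Sum>e\<leftarrow>l. elem_int e \<omega>)"

definition sproc :: "('a, 'd) elem list \<Rightarrow> real \<Rightarrow> 'a \<Rightarrow> real^'d" where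
  "sproc l s \<omega> = (\<Sum>e\<leftarrow>l. elem_proc e s \<omega>)"

lemma simple_simps [simp]: "simple []" "simple (e # l) \<longleftrightarrow> elem_ok e \<and> simple l" "simple (l @ l') \<longleftrightarrow> simple l \<and> simple l'"
  by (auto simp: simple_def)

lemma iint_simps [simp]: "iint [] \<omega> = 0" "iint (e # l) \<omega> = elem_int e \<omega> + iint l \<omega>" "iint (l @ l') \<omega> = iint l \<omega> + iint l' \<omega>"
  by (auto simp: iint_def)

lemma sproc_simps [simp]: "sproc [] s \<omega> = 0" "sproc (e # l) s \<omega> = elem_proc e s \<omega> + sproc l s \<omega>" "sproc (l @ l') s \<omega> = sproc l s \<omega> + sproc l' s \<omega>"
  by (auto simp: sproc_def)

text \<open>The bilinear form of the Ito isometry, bundled with the integrability that linearity of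
  the integrals requires. The quadratic form alone would not pass through an induction on lists,
  since a sum creates mixed products.\<close>

abbreviation polarized_isometry :: "('a \<Rightarrow> real) \<Rightarrow> ('a \<Rightarrow> real) \<Rightarrow> (real \<Rightarrow> 'a \<Rightarrow> real^'d) \<Rightarrow> (real \<Rightarrow> 'a \<Rightarrow> real^'d) \<Rightarrow> bool" where
  "polarized_isometry I J p q \<equiv> integrable M (\<lambda>\<omega>. I \<omega> * J \<omega>) \<and> (\<forall>\<omega>. integrable lborel (\<lambda>s. p s \<omega> \<bullet> q s \<omega>)) \<and>
     integrable M (\<lambda>\<omega>. LINT s|lborel. p s \<omega> \<bullet> q s \<omega>) \<and>
     expectation (\<lambda>\<omega>. I \<omega> * J \<omega>) = expectation (\<lambda>\<omega>. LINT s|lborel. p s \<omega> \<bullet> q s \<omega>)"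

lemma elem_isometry:
  assumes "elem_ok e" "elem_ok e'"
  shows "polarized_isometry (elem_int e) (elem_int e') (elem_proc e) (elem_proc e')"
proof -
  obtain a b i h a' b' i' h' where e: "e = (a,b,i,h)" "e' = (a',b',i',h')" by (metis prod_cases4)
  obtain C C' where h: "h \<in> borel_measurable (F a)" "\<And>\<omega>. \<omega> \<in> space M \<Longrightarrow> \<bar>h \<omega>\<bar> \<le> C"
    and h': "h' \<in> borel_measurable (F a')" "\<And>\<omega>. \<omega> \<in> space M \<Longrightarrow> \<bar>h' \<omega>\<bar> \<le> C'"
    using assms e by (auto simp: elem_ok_def)
  have "integrable M (\<lambda>\<omega>. h \<omega> * h' \<omega>)"
    by (rule bounded_mult_integrable[OF F_measurable[OF h(1)] h(2)
         bounded_integrable[OF F_measurable[OF h'(1)] h'(2)]])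
  then show ?thesis
    using elem_int_covariance[of a b i h a' b' i' h'] elem_proc_integral[of a b i h _ a' b' i' h'] assms
    by (simp add: e)
qed

lemma polarized_isometry_add:
  assumes "polarized_isometry I J p q" "polarized_isometry I' J p' q"
  shows "polarized_isometry (\<lambda>\<omega>. I \<omega> + I' \<omega>) J (\<lambda>s \<omega>. p s \<omega> + p' s \<omega>) q"
proof -
  have "(\<lambda>\<omega>. LINT s|lborel. (p s \<omega> + p' s \<omega>) \<bullet> q s \<omega>) =
      (\<lambda>\<omega>. (LINT s|lborel. p s \<omega> \<bullet> q s \<omega>) + (LINT s|lborel. p' s \<omega> \<bullet> q s \<omega>))"
    using assms by (intro ext) (simp add: inner_add_left)
  moreover have "(\<lambda>\<omega>. (I \<omega> + I' \<omega>) * J \<omega>) = (\<lambda>\<omega>. I \<omega> * J \<omega> + I' \<omega> * J \<omega>)" by (simp add: distrib_right)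
  ultimately show ?thesis using assms by (simp add: inner_add_left)
qed

lemma polarized_isometry_commute: "polarized_isometry I J p q \<Longrightarrow> polarized_isometry J I q p"
  by (simp add: inner_commute mult.commute)

lemma simple_isometry_polarized:
  assumes "simple l" "simple l'"
  shows "polarized_isometry (iint l) (iint l') (sproc l) (sproc l')"
proof -
  have 1: "polarized_isometry (iint l) (elem_int e) (sproc l) (elem_proc e)" if "elem_ok e" "simple l" for e l
    using that(2)
  proof (induction l)
    case (Cons e' l)
    have "polarized_isometry (\<lambda>\<omega>. elem_int e' \<omega> + iint l \<omega>) (elem_int e)
       (\<lambda>s \<omega>. elem_proc e' s \<omega> + sproc l s \<omega>) (elem_proc e)"
      by (rule polarized_isometry_add) (use Cons elem_isometry that(1) in auto)
    then show ?case by simp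
  qed simp
  show ?thesis using assms(2)
  proof (induction l')
    case (Cons e l')
    have "polarized_isometry (\<lambda>\<omega>. elem_int e \<omega> + iint l' \<omega>) (iint l)
       (\<lambda>s \<omega>. elem_proc e s \<omega> + sproc l' s \<omega>) (sproc l)"
      by (rule polarized_isometry_add; rule polarized_isometry_commute) (use Cons 1 assms(1) in auto)
    from polarized_isometry_commute[OF this] show ?case by simp
  qed simp
qed

lemma simple_isometry:
  assumes "simple l"
  shows "(\<integral>\<^sup>+\<omega>. ennreal ((iint l \<omega>)\<^sup>2) \<partial>M) = (\<integral>\<^sup>+\<omega>. (\<integral>\<^sup>+s. ennreal ((norm (sproc l s \<omega>))\<^sup>2) \<partial>lborel) \<partial>M)"
    "(\<integral>\<^sup>+\<omega>. ennreal ((iint l \<omega>)\<^sup>2) \<partial>M) < \<infinity>"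
proof -
  note P = simple_isometry_polarized[OF assms assms]
  have 1: "(\<integral>\<^sup>+\<omega>. ennreal ((iint l \<omega>)\<^sup>2) \<partial>M) = ennreal (expectation (\<lambda>\<omega>. iint l \<omega> * iint l \<omega>))"
    unfolding power2_eq_square using P by (intro nn_integral_eq_integral) auto
  have 2: "(\<integral>\<^sup>+s. ennreal ((norm (sproc l s \<omega>))\<^sup>2) \<partial>lborel) = ennreal (LINT s|lborel. sproc l s \<omega> \<bullet> sproc l s \<omega>)" for \<omega>
    unfolding power2_norm_eq_inner using P by (intro nn_integral_eq_integral) auto
  have 3: "(\<integral>\<^sup>+\<omega>. (\<integral>\<^sup>+s. ennreal ((norm (sproc l s \<omega>))\<^sup>2) \<partial>lborel) \<partial>M)
     = ennreal (expectation (\<lambda>\<omega>. LINT s|lborel. sproc l s \<omega> \<bullet> sproc l s \<omega>))"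
    unfolding 2 using P by (intro nn_integral_eq_integral) (auto intro!: AE_I2 integral_nonneg)
  show "(\<integral>\<^sup>+\<omega>. ennreal ((iint l \<omega>)\<^sup>2) \<partial>M) = (\<integral>\<^sup>+\<omega>. (\<integral>\<^sup>+s. ennreal ((norm (sproc l s \<omega>))\<^sup>2) \<partial>lborel) \<partial>M)"
    using P unfolding 1 3 by simp
  show "(\<integral>\<^sup>+\<omega>. ennreal ((iint l \<omega>)\<^sup>2) \<partial>M) < \<infinity>" unfolding 1 by simp
qed

section \<open>The extension to L2 limits of simple integrands\<close>

text \<open>Time is the second factor, so that sections and inner integrals are taken in time along
  a fixed path. All real times are included; processes given only for nonnegative times are cut off
  or extended before use.\<close>

definition joint_measurable :: "(real \<Rightarrow> 'a \<Rightarrow> 'b::euclidean_space) \<Rightarrow> bool" where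
  "joint_measurable p \<longleftrightarrow> (\<lambda>x. p (snd x) (fst x)) \<in> borel_measurable (M \<Otimes>\<^sub>M lborel)"

definition norm2 :: "(real \<Rightarrow> 'a \<Rightarrow> real^'d) \<Rightarrow> ennreal" where
  "norm2 p = (\<integral>\<^sup>+\<omega>. (\<integral>\<^sup>+s. ennreal ((norm (p s \<omega>))\<^sup>2) \<partial>lborel) \<partial>M)"

lemma norm2_product: "joint_measurable p \<Longrightarrow> norm2 p = (\<integral>\<^sup>+x. ennreal ((norm (p (snd x) (fst x)))\<^sup>2) \<partial>(M \<Otimes>\<^sub>M lborel))"
  unfolding norm2_def joint_measurable_def by (subst lborel.nn_integral_fst[symmetric]) auto

lemma norm2_mono:
  "(\<And>\<omega> s. \<omega> \<in> space M \<Longrightarrow> norm (p s \<omega>) \<le> norm (q s \<omega>)) \<Longrightarrow> norm2 p \<le> norm2 q"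
  unfolding norm2_def by (intro nn_integral_mono ennreal_leI power_mono) auto

lemma joint_measurable_elem_proc: "elem_ok e \<Longrightarrow> joint_measurable (elem_proc e)"
proof -
  assume "elem_ok e"
  then obtain a b i h where e: "e = (a,b,i,h)" and "h \<in> borel_measurable (F a)"
    by (cases e) (auto simp: elem_ok_def)
  then have [measurable]: "h \<in> borel_measurable M" by (blast intro: F_measurable)
  have "elem_proc e s \<omega> = (indicator {a<..b} s * h \<omega>) *\<^sub>R axis i 1" for s \<omega>
    by (simp add: e elem_proc_def axis_def vec_eq_iff)
  then show ?thesis unfolding joint_measurable_def by simp
qed

lemma joint_measurable_sproc: "simple l \<Longrightarrow> joint_measurable (sproc l)"
proof (induction l)
  case (Cons e l)
  then show ?case using joint_measurable_elem_proc[of e] unfolding joint_measurable_def by simp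
qed (simp add: joint_measurable_def)

lemma joint_measurable_diff: "joint_measurable p \<Longrightarrow> joint_measurable q \<Longrightarrow> joint_measurable (\<lambda>s \<omega>. p s \<omega> - q s \<omega>)"
  unfolding joint_measurable_def by simp

lemma iint_measurable: "simple l \<Longrightarrow> iint l \<in> borel_measurable M"
proof (induction l)
  case (Cons e l)
  obtain a b i h where e: "e = (a,b,i,h)" by (cases e) auto
  then have "h \<in> borel_measurable (F a)" and ab: "0 \<le> a" "0 \<le> b"
    using Cons.prems by (auto simp: elem_ok_def)
  then have "h \<in> borel_measurable M" "inc i a b \<in> borel_measurable M"
    by (blast intro: F_measurable, intro inc_measurable)
  then have "elem_int e \<in> borel_measurable M"
    unfolding e elem_int_def[abs_def] prod.case by (rule borel_measurable_times)
  moreover have "iint (e # l) = (\<lambda>\<omega>. elem_int e \<omega> + iint l \<omega>)" by (rule ext) simp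
  ultimately show ?case using Cons by simp
next
  case Nil
  have "iint [] = (\<lambda>_. 0)" by (rule ext) simp
  then show ?case by simp
qed

text \<open>The scalar counterpart of \<open>has_ito_integral\<close>: one row of the integrand,
  lists of elements as approximants, and the whole real line as time axis. As a relation it
  determines \<open>I\<close> only almost surely.\<close>

definition ito :: "(real \<Rightarrow> 'a \<Rightarrow> real^'d) \<Rightarrow> ('a \<Rightarrow> real) \<Rightarrow> bool" where
  "ito p I \<longleftrightarrow> joint_measurable p \<and> I \<in> borel_measurable M \<and> (\<exists>l. (\<forall>i. simple (l i)) \<and>
     (\<lambda>i. norm2 (\<lambda>s \<omega>. sproc (l i) s \<omega> - p s \<omega>)) \<longlonglongrightarrow> 0 \<and>
     (\<lambda>i. \<integral>\<^sup>+\<omega>. ennreal ((iint (l i) \<omega> - I \<omega>)\<^sup>2) \<partial>M) \<longlonglongrightarrow> 0)"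

lemma ito_isometry:
  assumes "ito p I"
  shows "(\<integral>\<^sup>+\<omega>. ennreal ((I \<omega>)\<^sup>2) \<partial>M) = norm2 p"
proof -
  obtain l where jp: "joint_measurable p" and I: "I \<in> borel_measurable M" and l: "\<And>i. simple (l i)"
    and p: "(\<lambda>i. norm2 (\<lambda>s \<omega>. sproc (l i) s \<omega> - p s \<omega>)) \<longlonglongrightarrow> 0"
    and Ic: "(\<lambda>i. \<integral>\<^sup>+\<omega>. ennreal ((iint (l i) \<omega> - I \<omega>)\<^sup>2) \<partial>M) \<longlonglongrightarrow> 0"
    using assms unfolding ito_def by blast
  have "(\<integral>\<^sup>+\<omega>. ennreal ((norm (I \<omega>))\<^sup>2) \<partial>M) = (\<integral>\<^sup>+x. ennreal ((norm (p (snd x) (fst x)))\<^sup>2) \<partial>(M \<Otimes>\<^sub>M lborel))"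
  proof (rule nn_L2_limit_eq[where f = "\<lambda>i. iint (l i)" and g = "\<lambda>i x. sproc (l i) (snd x) (fst x)"])
    show "(\<lambda>i. \<integral>\<^sup>+ x. ennreal ((norm (sproc (l i) (snd x) (fst x) - p (snd x) (fst x)))\<^sup>2) \<partial>(M \<Otimes>\<^sub>M lborel)) \<longlonglongrightarrow> 0"
      using p unfolding norm2_product[OF joint_measurable_diff[OF joint_measurable_sproc[OF l] jp]] .
    show "(\<integral>\<^sup>+ x. ennreal ((norm (iint (l i) x))\<^sup>2) \<partial>M) = (\<integral>\<^sup>+ x. ennreal ((norm (sproc (l i) (snd x) (fst x)))\<^sup>2) \<partial>(M \<Otimes>\<^sub>M lborel))" for i
      using simple_isometry(1)[OF l[of i]] norm2_product[OF joint_measurable_sproc[OF l[of i]]] by (simp add: norm2_def)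
  qed (use I Ic jp l joint_measurable_sproc iint_measurable in \<open>auto simp: joint_measurable_def\<close>)
  then show ?thesis by (simp add: norm2_product[OF jp])
qed

lemma norm2_diff_le: "joint_measurable p \<Longrightarrow> joint_measurable q \<Longrightarrow> norm2 (\<lambda>s \<omega>. p s \<omega> - q s \<omega>) \<le> 2 * norm2 p + 2 * norm2 q"
  using nn_L2_diff_le[of "\<lambda>x. p (snd x) (fst x)" "M \<Otimes>\<^sub>M lborel" "\<lambda>x. q (snd x) (fst x)"]
  by (simp add: norm2_product joint_measurable_diff) (simp add: joint_measurable_def)

lemma norm2_simple_finite: "simple l \<Longrightarrow> norm2 (sproc l) < \<infinity>"
  using simple_isometry[of l] by (simp add: norm2_def)

text \<open>Some approximant lies at distance below 1, and its own norm is finite by the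
  isometry.\<close>

lemma ito_norm2_finite:
  assumes "ito p I" shows "norm2 p < \<infinity>"
proof -
  obtain l where jp: "joint_measurable p" and l: "\<And>i. simple (l i)"
    and p: "(\<lambda>i. norm2 (\<lambda>s \<omega>. sproc (l i) s \<omega> - p s \<omega>)) \<longlonglongrightarrow> 0"
    using assms unfolding ito_def by blast
  have "eventually (\<lambda>i. norm2 (\<lambda>s \<omega>. sproc (l i) s \<omega> - p s \<omega>) < 1) sequentially"
    using p by (rule order_tendstoD) simp
  then obtain i where i: "norm2 (\<lambda>s \<omega>. sproc (l i) s \<omega> - p s \<omega>) < 1" using eventually_sequentially by auto
  have "norm2 (\<lambda>s \<omega>. sproc (l i) s \<omega> - (sproc (l i) s \<omega> - p s \<omega>)) \<le>
     2 * norm2 (sproc (l i)) + 2 * norm2 (\<lambda>s \<omega>. sproc (l i) s \<omega> - p s \<omega>)"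
    by (intro norm2_diff_le joint_measurable_diff joint_measurable_sproc l jp)
  also have "\<dots> < \<infinity>" using norm2_simple_finite[OF l[of i]] i
    by (simp add: ennreal_mult_less_top less_trans[OF i])
  finally show ?thesis by simp
qed

lemma ito_square_integrable:
  assumes "ito p I"
  shows "integrable M (\<lambda>\<omega>. (I \<omega>)\<^sup>2)" "integrable M I"
proof -
  have m: "I \<in> borel_measurable M" using assms by (simp add: ito_def)
  show 1: "integrable M (\<lambda>\<omega>. (I \<omega>)\<^sup>2)"
    using ito_isometry[OF assms] ito_norm2_finite[OF assms] m
    by (intro integrableI_bounded) auto
  show "integrable M I" by (rule square_integrable_imp_integrable[OF m 1])
qed

section \<open>Scaling, differences and truncation\<close>

definition smul :: "('a \<Rightarrow> real) \<Rightarrow> ('a, 'd) elem list \<Rightarrow> ('a, 'd) elem list" where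
  "smul A l = map (\<lambda>(a,b,i,h). (a,b,i,\<lambda>\<omega>. A \<omega> * h \<omega>)) l"

text \<open>A factor known at time \<open>t\<close> may be absorbed into the heights when no
  interval begins before \<open>t\<close>: each height then stays measurable at the start of its
  interval.\<close>

definition starts :: "real \<Rightarrow> ('a, 'd) elem list \<Rightarrow> bool" where
  "starts t l \<longleftrightarrow> (\<forall>(a,b,i,h)\<in>set l. t \<le> a)"

lemma iint_smul: "iint (smul A l) \<omega> = A \<omega> * iint l \<omega>"
  by (induction l) (auto simp: smul_def elem_int_def algebra_simps)

lemma sproc_smul: "sproc (smul A l) s \<omega> = A \<omega> *\<^sub>R sproc l s \<omega>"
  by (induction l) (auto simp: smul_def elem_proc_def vec_eq_iff axis_def algebra_simps)

lemma simple_smul: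
  assumes "simple l" "starts t l" "A \<in> borel_measurable (F t)" "\<And>\<omega>. \<omega> \<in> space M \<Longrightarrow> \<bar>A \<omega>\<bar> \<le> C"
  shows "simple (smul A l)"
  unfolding simple_def
proof
  fix e assume "e \<in> set (smul A l)"
  then obtain a b i h where e: "(a,b,i,h) \<in> set l" "e = (a,b,i,\<lambda>\<omega>. A \<omega> * h \<omega>)" by (auto simp: smul_def)
  then obtain D where ok: "0 \<le> a" "a \<le> b" "h \<in> borel_measurable (F a)" "\<And>\<omega>. \<omega> \<in> space M \<Longrightarrow> \<bar>h \<omega>\<bar> \<le> D" "t \<le> a"
    using assms(1,2) by (fastforce simp: simple_def elem_ok_def starts_def)
  have "\<bar>A \<omega> * h \<omega>\<bar> \<le> C * D" if "\<omega> \<in> space M" for \<omega>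
    unfolding abs_mult using assms(4)[OF that] ok(4)[OF that] by (intro mult_mono) auto
  then show "elem_ok e"
    using ok F_measurable_mono[OF assms(3) ok(5)] unfolding e elem_ok_def by (auto intro!: exI[of _ "C * D"])
qed

lemma starts_0: "simple l \<Longrightarrow> starts 0 l"
  by (auto simp: simple_def elem_ok_def starts_def)

lemma simple_neg: "simple l \<Longrightarrow> simple (smul (\<lambda>_. -1) l)"
  by (rule simple_smul[of _ 0 _ 1]) (auto simp: starts_0)

lemma ito_simple: "simple l \<Longrightarrow> ito (sproc l) (iint l)"
  unfolding ito_def using joint_measurable_sproc iint_measurable by (auto intro!: exI[of _ "\<lambda>_. l"] simp: norm2_def)

lemma tendsto_0_le_ennreal:
  assumes "\<And>i. f i \<le> g i" "g \<longlonglongrightarrow> c" "c = 0"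
  shows "f \<longlonglongrightarrow> (0::ennreal)"
  using assms by (intro tendsto_sandwich[of "\<lambda>_. 0" f _ g]) auto

text \<open>Appending the negated second list to the first subtracts both the processes and the
  integrals, whatever the positions of the intervals.\<close>

lemma ito_diff:
  assumes "ito p I" "ito q J"
  shows "ito (\<lambda>s \<omega>. p s \<omega> - q s \<omega>) (\<lambda>\<omega>. I \<omega> - J \<omega>)"
proof -
  obtain l where jp: "joint_measurable p" and I: "I \<in> borel_measurable M" and l: "\<And>i. simple (l i)"
    and p: "(\<lambda>i. norm2 (\<lambda>s \<omega>. sproc (l i) s \<omega> - p s \<omega>)) \<longlonglongrightarrow> 0"
    and Ic: "(\<lambda>i. \<integral>\<^sup>+\<omega>. ennreal ((iint (l i) \<omega> - I \<omega>)\<^sup>2) \<partial>M) \<longlonglongrightarrow> 0"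
    using assms unfolding ito_def by blast
  obtain k where jq: "joint_measurable q" and J: "J \<in> borel_measurable M" and k: "\<And>i. simple (k i)"
    and q: "(\<lambda>i. norm2 (\<lambda>s \<omega>. sproc (k i) s \<omega> - q s \<omega>)) \<longlonglongrightarrow> 0"
    and Jc: "(\<lambda>i. \<integral>\<^sup>+\<omega>. ennreal ((iint (k i) \<omega> - J \<omega>)\<^sup>2) \<partial>M) \<longlonglongrightarrow> 0"
    using assms unfolding ito_def by blast
  let ?m = "\<lambda>i. l i @ smul (\<lambda>_. -1) (k i)"
  show ?thesis unfolding ito_def
  proof (intro conjI exI[of _ ?m] allI)
    show "simple (?m i)" for i using l k simple_neg by simp
    have "norm2 (\<lambda>s \<omega>. sproc (?m i) s \<omega> - (p s \<omega> - q s \<omega>)) \<le>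
        2 * norm2 (\<lambda>s \<omega>. sproc (l i) s \<omega> - p s \<omega>) + 2 * norm2 (\<lambda>s \<omega>. sproc (k i) s \<omega> - q s \<omega>)" for i
      using norm2_diff_le[OF joint_measurable_diff[OF joint_measurable_sproc[OF l] jp] joint_measurable_diff[OF joint_measurable_sproc[OF k] jq], of i i]
      by (simp add: sproc_smul algebra_simps)
    moreover have "(\<lambda>i. 2 * norm2 (\<lambda>s \<omega>. sproc (l i) s \<omega> - p s \<omega>) + 2 * norm2 (\<lambda>s \<omega>. sproc (k i) s \<omega> - q s \<omega>)) \<longlonglongrightarrow> 2 * 0 + 2 * 0"
      by (intro tendsto_add ennreal_tendsto_cmult p q) auto
    ultimately show "(\<lambda>i. norm2 (\<lambda>s \<omega>. sproc (?m i) s \<omega> - (p s \<omega> - q s \<omega>))) \<longlonglongrightarrow> 0"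
      by (rule tendsto_0_le_ennreal) simp
    have "(\<integral>\<^sup>+\<omega>. ennreal ((iint (?m i) \<omega> - (I \<omega> - J \<omega>))\<^sup>2) \<partial>M) \<le>
        2 * (\<integral>\<^sup>+\<omega>. ennreal ((iint (l i) \<omega> - I \<omega>)\<^sup>2) \<partial>M) + 2 * (\<integral>\<^sup>+\<omega>. ennreal ((iint (k i) \<omega> - J \<omega>)\<^sup>2) \<partial>M)" for i
      using nn_L2_diff_le[OF borel_measurable_diff[OF iint_measurable[OF l] I] borel_measurable_diff[OF iint_measurable[OF k] J], of i i]
      by (simp add: iint_smul algebra_simps)
    moreover have "(\<lambda>i. 2 * (\<integral>\<^sup>+\<omega>. ennreal ((iint (l i) \<omega> - I \<omega>)\<^sup>2) \<partial>M) + 2 * (\<integral>\<^sup>+\<omega>. ennreal ((iint (k i) \<omega> - J \<omega>)\<^sup>2) \<partial>M)) \<longlonglongrightarrow> 2 * 0 + 2 * 0"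
      by (intro tendsto_add ennreal_tendsto_cmult Ic Jc) auto
    ultimately show "(\<lambda>i. \<integral>\<^sup>+\<omega>. ennreal ((iint (?m i) \<omega> - (I \<omega> - J \<omega>))\<^sup>2) \<partial>M) \<longlonglongrightarrow> 0"
      by (rule tendsto_0_le_ennreal) simp
  qed (use jp jq I J joint_measurable_diff in auto)
qed

lemma ito_cong: "ito p I \<Longrightarrow> (\<And>s \<omega>. p s \<omega> = q s \<omega>) \<Longrightarrow> (\<And>\<omega>. I \<omega> = J \<omega>) \<Longrightarrow> ito q J"
proof -
  assume "ito p I" "\<And>s \<omega>. p s \<omega> = q s \<omega>" "\<And>\<omega>. I \<omega> = J \<omega>"
  moreover from this have "p = q" "I = J" by (intro ext; simp)+
  ultimately show ?thesis by simp
qed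

text \<open>Both end points are raised to at least \<open>t\<close>. An interval that ends before
  \<open>t\<close> collapses to an empty one, and heights stay measurable because starts only move
  to later times.\<close>

definition trunc :: "real \<Rightarrow> ('a, 'd) elem list \<Rightarrow> ('a, 'd) elem list" where
  "trunc t l = map (\<lambda>(a,b,i,h). (max a t, max b t, i, h)) l"

lemma sproc_trunc: "sproc (trunc t l) s \<omega> = indicator {t<..} s *\<^sub>R sproc l s \<omega>"
proof (induction l)
  case (Cons e l)
  obtain a b i h where e: "e = (a,b,i,h)" by (cases e) auto
  have "elem_proc (max a t, max b t, i, h) s \<omega> = indicator {t<..} s *\<^sub>R elem_proc e s \<omega>"
    by (auto simp: e elem_proc_def indicator_def axis_def vec_eq_iff)
  then show ?case using Cons by (simp add: trunc_def e scaleR_add_right)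
qed (simp add: trunc_def)

lemma starts_trunc: "starts t (trunc t l)"
  by (auto simp: starts_def trunc_def)

lemma simple_trunc: "0 \<le> t \<Longrightarrow> simple l \<Longrightarrow> simple (trunc t l)"
  by (fastforce simp: simple_def trunc_def elem_ok_def intro: F_measurable_mono)

text \<open>Truncation at \<open>t\<close> does not increase the distance to an integrand that
  vanishes up to \<open>t\<close>. The change that it causes in the integrals is measured by the
  isometry: it is the norm of the approximants on times up to \<open>t\<close>, again a part of
  their distance to \<open>p\<close>.\<close>

lemma ito_approx_from:
  assumes "ito p I" and t: "0 \<le> t" and z: "\<And>s \<omega>. s \<le> t \<Longrightarrow> p s \<omega> = 0"
  obtains l where "\<And>i. simple (l i)" "\<And>i. starts t (l i)"
    "(\<lambda>i. norm2 (\<lambda>s \<omega>. sproc (l i) s \<omega> - p s \<omega>)) \<longlonglongrightarrow> 0"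
    "(\<lambda>i. \<integral>\<^sup>+\<omega>. ennreal ((iint (l i) \<omega> - I \<omega>)\<^sup>2) \<partial>M) \<longlonglongrightarrow> 0"
proof -
  obtain l where jp: "joint_measurable p" and I: "I \<in> borel_measurable M" and l: "\<And>i. simple (l i)"
    and p: "(\<lambda>i. norm2 (\<lambda>s \<omega>. sproc (l i) s \<omega> - p s \<omega>)) \<longlonglongrightarrow> 0"
    and Ic: "(\<lambda>i. \<integral>\<^sup>+\<omega>. ennreal ((iint (l i) \<omega> - I \<omega>)\<^sup>2) \<partial>M) \<longlonglongrightarrow> 0"
    using assms(1) unfolding ito_def by blast
  let ?k = "\<lambda>i. trunc t (l i)"
  have k: "simple (?k i)" for i by (rule simple_trunc[OF t l])
  have "norm2 (\<lambda>s \<omega>. sproc (?k i) s \<omega> - p s \<omega>) \<le> norm2 (\<lambda>s \<omega>. sproc (l i) s \<omega> - p s \<omega>)" for i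
    using z by (intro norm2_mono) (auto simp: sproc_trunc indicator_def not_less)
  then have 1: "(\<lambda>i. norm2 (\<lambda>s \<omega>. sproc (?k i) s \<omega> - p s \<omega>)) \<longlonglongrightarrow> 0"
    using p by (rule tendsto_0_le_ennreal) simp
  have "(\<integral>\<^sup>+\<omega>. ennreal ((iint (?k i) \<omega> - I \<omega>)\<^sup>2) \<partial>M) \<le>
        2 * norm2 (\<lambda>s \<omega>. sproc (l i) s \<omega> - p s \<omega>) + 2 * (\<integral>\<^sup>+\<omega>. ennreal ((iint (l i) \<omega> - I \<omega>)\<^sup>2) \<partial>M)" for i
  proof -
    have "(\<integral>\<^sup>+\<omega>. ennreal ((iint (?k i) \<omega> - I \<omega>)\<^sup>2) \<partial>M) \<le>
      2 * (\<integral>\<^sup>+\<omega>. ennreal ((iint (l i) \<omega> - I \<omega>)\<^sup>2) \<partial>M) + 2 * (\<integral>\<^sup>+\<omega>. ennreal ((iint (l i) \<omega> - iint (?k i) \<omega>)\<^sup>2) \<partial>M)"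
      using nn_L2_diff_le[OF borel_measurable_diff[OF iint_measurable[OF l] I] borel_measurable_diff[OF iint_measurable[OF l] iint_measurable[OF k]], of i i i]
      by simp
    also have "(\<integral>\<^sup>+\<omega>. ennreal ((iint (l i) \<omega> - iint (?k i) \<omega>)\<^sup>2) \<partial>M) = norm2 (\<lambda>s \<omega>. sproc (l i) s \<omega> - sproc (?k i) s \<omega>)"
      by (rule ito_isometry[OF ito_diff[OF ito_simple[OF l] ito_simple[OF k]]])
    also have "\<dots> \<le> norm2 (\<lambda>s \<omega>. sproc (l i) s \<omega> - p s \<omega>)"
      using z by (intro norm2_mono) (auto simp: sproc_trunc indicator_def not_less)
    finally show ?thesis by (simp add: add.commute mult_left_mono add_left_mono)
  qed
  moreover have "(\<lambda>i. 2 * norm2 (\<lambda>s \<omega>. sproc (l i) s \<omega> - p s \<omega>) + 2 * (\<integral>\<^sup>+\<omega>. ennreal ((iint (l i) \<omega> - I \<omega>)\<^sup>2) \<partial>M)) \<longlonglongrightarrow> 2 * 0 + 2 * 0"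
    by (intro tendsto_add ennreal_tendsto_cmult p Ic) auto
  ultimately have 2: "(\<lambda>i. \<integral>\<^sup>+\<omega>. ennreal ((iint (?k i) \<omega> - I \<omega>)\<^sup>2) \<partial>M) \<longlonglongrightarrow> 0"
    by (rule tendsto_0_le_ennreal) simp
  show ?thesis by (rule that[OF k starts_trunc 1 2])
qed

text \<open>A bounded factor known at time \<open>t\<close> moves inside the integral over later
  times. Together with \<open>ito_isometry\<close> and \<open>ito_mean\<close> this takes the place
  of conditional expectations.\<close>

lemma ito_mult:
  assumes "ito p I" and t: "0 \<le> t" and z: "\<And>s \<omega>. s \<le> t \<Longrightarrow> p s \<omega> = 0"
    and A: "A \<in> borel_measurable (F t)" "\<And>\<omega>. \<omega> \<in> space M \<Longrightarrow> \<bar>A \<omega>\<bar> \<le> C"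
  shows "ito (\<lambda>s \<omega>. A \<omega> *\<^sub>R p s \<omega>) (\<lambda>\<omega>. A \<omega> * I \<omega>)"
proof -
  obtain l where l: "\<And>i. simple (l i)" "\<And>i. starts t (l i)"
    and p: "(\<lambda>i. norm2 (\<lambda>s \<omega>. sproc (l i) s \<omega> - p s \<omega>)) \<longlonglongrightarrow> 0"
    and Ic: "(\<lambda>i. \<integral>\<^sup>+\<omega>. ennreal ((iint (l i) \<omega> - I \<omega>)\<^sup>2) \<partial>M) \<longlonglongrightarrow> 0"
    using ito_approx_from[OF assms(1) t z] by blast
  have jp: "joint_measurable p" and I: "I \<in> borel_measurable M" using assms(1) by (auto simp: ito_def)
  have [measurable]: "A \<in> borel_measurable M" using A(1) by (rule F_measurable)
  show ?thesis unfolding ito_def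
  proof (intro conjI exI[of _ "\<lambda>i. smul A (l i)"] allI)
    show "joint_measurable (\<lambda>s \<omega>. A \<omega> *\<^sub>R p s \<omega>)" using jp unfolding joint_measurable_def by simp
    show "(\<lambda>\<omega>. A \<omega> * I \<omega>) \<in> borel_measurable M" using I by simp
    show "simple (smul A (l i))" for i by (rule simple_smul[OF l A])
    have "norm2 (\<lambda>s \<omega>. sproc (smul A (l i)) s \<omega> - A \<omega> *\<^sub>R p s \<omega>) \<le> ennreal (C\<^sup>2) * norm2 (\<lambda>s \<omega>. sproc (l i) s \<omega> - p s \<omega>)" for i
    proof -
      note j = joint_measurable_diff[OF joint_measurable_sproc[OF l(1)[of i]] jp]
      then have j': "joint_measurable (\<lambda>s \<omega>. A \<omega> *\<^sub>R (sproc (l i) s \<omega> - p s \<omega>))" unfolding joint_measurable_def by simp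
      have eq: "(\<lambda>s \<omega>. sproc (smul A (l i)) s \<omega> - A \<omega> *\<^sub>R p s \<omega>) = (\<lambda>s \<omega>. A \<omega> *\<^sub>R (sproc (l i) s \<omega> - p s \<omega>))"
        by (simp add: sproc_smul scaleR_diff_right)
      show ?thesis unfolding eq norm2_product[OF j] norm2_product[OF j']
        by (rule nn_L2_mult_le) (use j A(2) in \<open>auto simp: joint_measurable_def space_pair_measure\<close>)
    qed
    moreover have "(\<lambda>i. ennreal (C\<^sup>2) * norm2 (\<lambda>s \<omega>. sproc (l i) s \<omega> - p s \<omega>)) \<longlonglongrightarrow> ennreal (C\<^sup>2) * 0"
      by (intro ennreal_tendsto_cmult p) auto
    ultimately show "(\<lambda>i. norm2 (\<lambda>s \<omega>. sproc (smul A (l i)) s \<omega> - A \<omega> *\<^sub>R p s \<omega>)) \<longlonglongrightarrow> 0"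
      by (rule tendsto_0_le_ennreal) simp
    have "(\<integral>\<^sup>+\<omega>. ennreal ((iint (smul A (l i)) \<omega> - A \<omega> * I \<omega>)\<^sup>2) \<partial>M) \<le> ennreal (C\<^sup>2) * (\<integral>\<^sup>+\<omega>. ennreal ((iint (l i) \<omega> - I \<omega>)\<^sup>2) \<partial>M)" for i
      using nn_L2_mult_le[OF borel_measurable_diff[OF iint_measurable[OF l(1)] I] A(2)]
      by (simp add: iint_smul right_diff_distrib abs_mult)
    moreover have "(\<lambda>i. ennreal (C\<^sup>2) * (\<integral>\<^sup>+\<omega>. ennreal ((iint (l i) \<omega> - I \<omega>)\<^sup>2) \<partial>M)) \<longlonglongrightarrow> ennreal (C\<^sup>2) * 0"
      by (intro ennreal_tendsto_cmult Ic) auto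
    ultimately show "(\<lambda>i. \<integral>\<^sup>+\<omega>. ennreal ((iint (smul A (l i)) \<omega> - A \<omega> * I \<omega>)\<^sup>2) \<partial>M) \<longlonglongrightarrow> 0"
      by (rule tendsto_0_le_ennreal) simp
  qed
qed

lemma simple_mean: "simple l \<Longrightarrow> integrable M (iint l) \<and> expectation (iint l) = 0"
proof (induction l)
  case (Cons e l)
  obtain a b i h where e: "e = (a,b,i,h)" by (cases e) auto
  then obtain C where ok: "0 \<le> a" "a \<le> b" "h \<in> borel_measurable (F a)" "\<And>\<omega>. \<omega> \<in> space M \<Longrightarrow> \<bar>h \<omega>\<bar> \<le> C"
    using Cons.prems by (auto simp: elem_ok_def)
  have "integrable M (elem_int e) \<and> expectation (elem_int e) = 0"
    unfolding e elem_int_def[abs_def] prod.case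
    using mult_increment[OF ok(1,2,3) bounded_integrable[OF F_measurable[OF ok(3)] ok(4)]] by blast
  moreover have "iint (e # l) = (\<lambda>\<omega>. elem_int e \<omega> + iint l \<omega>)" by (rule ext) simp
  ultimately show ?case using Cons by simp
next
  case Nil
  have "iint [] = (\<lambda>_. 0)" by (rule ext) simp
  then show ?case by simp
qed

text \<open>Approximants have mean zero, and the square of a mean is at most the mean of the square,
  so the mean of \<open>I\<close> is controlled by the L2 distance to the approximants.\<close>

lemma ito_mean:
  assumes "ito p I"
  shows "expectation I = 0"
proof -
  obtain l where I: "I \<in> borel_measurable M" and l: "\<And>i. simple (l i)"
    and Ic: "(\<lambda>i. \<integral>\<^sup>+\<omega>. ennreal ((iint (l i) \<omega> - I \<omega>)\<^sup>2) \<partial>M) \<longlonglongrightarrow> 0"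
    using assms unfolding ito_def by blast
  have "ennreal ((expectation I)\<^sup>2) \<le> (\<integral>\<^sup>+\<omega>. ennreal ((iint (l i) \<omega> - I \<omega>)\<^sup>2) \<partial>M)" for i
  proof -
    have d: "ito (\<lambda>s \<omega>. sproc (l i) s \<omega> - p s \<omega>) (\<lambda>\<omega>. iint (l i) \<omega> - I \<omega>)"
      by (rule ito_diff[OF ito_simple[OF l] assms])
    note sq = ito_square_integrable[OF d]
    have "expectation (\<lambda>\<omega>. iint (l i) \<omega> - I \<omega>) = - expectation I"
      using simple_mean[OF l[of i]] ito_square_integrable[OF assms] by simp
    then have "(expectation I)\<^sup>2 = (expectation (\<lambda>\<omega>. iint (l i) \<omega> - I \<omega>))\<^sup>2" by simp
    also have "\<dots> \<le> expectation (\<lambda>\<omega>. (iint (l i) \<omega> - I \<omega>)\<^sup>2)"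
      using variance_positive[of "\<lambda>\<omega>. iint (l i) \<omega> - I \<omega>"] variance_eq[OF sq(2,1)] by simp
    finally show ?thesis
      using sq(1) by (subst nn_integral_eq_integral) (auto intro: ennreal_leI)
  qed
  then have "ennreal ((expectation I)\<^sup>2) \<le> 0" by (intro LIMSEQ_le_const[OF Ic]) auto
  then show ?thesis by (simp add: ennreal_eq_0_iff)
qed

section \<open>Windows of simple integrals on small events\<close>

text \<open>\<open>B\<close> may depend on the increment, so independence is of no use here. This is
  Cauchy-Schwarz with a free weight \<open>c\<close> in place of the square root of
  \<open>prob B\<close>; the fourth moment makes the bound linear in \<open>b - a\<close>, so that
  it can be summed over a partition.\<close>

lemma inc_sq_indicator:
  assumes ab: "0 \<le> a" "a \<le> b" and B: "B \<in> sets M" and c: "0 < c"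
  shows "expectation (\<lambda>\<omega>. (inc i a b \<omega>)\<^sup>2 * indicator B \<omega>) \<le> (b - a) * (2 * c + prob B / c)"
proof (cases "a = b")
  case False
  then have r: "0 < b - a" using ab by simp
  \<comment> \<open>Completing the square. The weights contain \<open>b - a\<close> so that both
    terms become linear in it after integration, the fourth moment being
    \<open>3 * (b - a)\<^sup>2\<close>.\<close>
  have pt: "x\<^sup>2 * \<beta> \<le> c / (2 * (b - a)) * x^4 + (b - a) / (2 * c) * \<beta>" if "\<beta> = 0 \<or> \<beta> = 1" for x \<beta> :: real
  proof -
    have "0 \<le> (c * x\<^sup>2 - (b - a))\<^sup>2 / (2 * c * (b - a))" using r c by simp
    also have "\<dots> = c / (2 * (b - a)) * x^4 + (b - a) / (2 * c) - x\<^sup>2"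
      using r c by (simp add: power2_eq_square power4_eq_xxxx field_simps)
    finally show ?thesis using that r c by auto
  qed
  have i1: "integrable M (\<lambda>\<omega>. c / (2 * (b - a)) * (inc i a b \<omega>)^4)"
    by (intro integrable_mult_right inc_moments(5)[OF ab])
  have i2: "integrable M (\<lambda>\<omega>. (b - a) / (2 * c) * indicator B \<omega>)"
    using B by (intro integrable_mult_right integrable_real_indicator) (auto simp: emeasure_eq_measure)
  have "expectation (\<lambda>\<omega>. (inc i a b \<omega>)\<^sup>2 * indicator B \<omega>)
     \<le> expectation (\<lambda>\<omega>. c / (2 * (b - a)) * (inc i a b \<omega>)^4 + (b - a) / (2 * c) * indicator B \<omega>)"
  proof (rule integral_mono)
    show "integrable M (\<lambda>\<omega>. (inc i a b \<omega>)\<^sup>2 * indicator B \<omega>)"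
      using inc_moments(3)[OF ab, of i] B by (rule integrable_real_mult_indicator[rotated])
    show "integrable M (\<lambda>\<omega>. c / (2 * (b - a)) * (inc i a b \<omega>)^4 + (b - a) / (2 * c) * indicator B \<omega>)"
      by (rule Bochner_Integration.integrable_add[OF i1 i2])
    show "(inc i a b \<omega>)\<^sup>2 * indicator B \<omega> \<le> c / (2 * (b - a)) * (inc i a b \<omega>)^4 + (b - a) / (2 * c) * indicator B \<omega>" for \<omega>
      by (rule pt) (auto simp: indicator_def)
  qed
  also have "\<dots> = c / (2 * (b - a)) * (3 * (b - a)\<^sup>2) + (b - a) / (2 * c) * prob B"
    using B inc_moments(6)[OF ab, of i] by (subst Bochner_Integration.integral_add[OF i1 i2]) simp
  also have "\<dots> = (b - a) * (3/2 * c + prob B / c / 2)"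
    using r c by (simp add: power2_eq_square field_simps)
  also have "\<dots> \<le> (b - a) * (2 * c + prob B / c)"
  proof (rule mult_left_mono)
    have q: "3/2 * c + q / 2 \<le> 2 * c + q" if "0 \<le> q" for q :: real using c that by simp
    show "3/2 * c + prob B / c / 2 \<le> 2 * c + prob B / c" by (rule q) (use c in simp)
  qed (use r in simp)
  finally show ?thesis .
qed simp

text \<open>\<open>window l s t\<close> is the integral over \<open>(s, t]\<close>. It is a difference of two tails because cutting an
  element \<open>(a, b, i, h)\<close> with \<open>a > t\<close> off at \<open>t\<close> would give a start before \<open>h\<close> is measurable.\<close>

abbreviation window :: "('a, 'd) elem list \<Rightarrow> real \<Rightarrow> real \<Rightarrow> 'a \<Rightarrow> real" where
  "window l s t \<omega> \<equiv> iint (trunc s l) \<omega> - iint (trunc t l) \<omega>"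

lemma ito_window:
  assumes "simple l" "0 \<le> s" "s \<le> t"
  shows "ito (\<lambda>u \<omega>. indicator {s<..t} u *\<^sub>R sproc l u \<omega>) (window l s t)"
  by (rule ito_cong[OF ito_diff[OF ito_simple[OF simple_trunc[of s l]] ito_simple[OF simple_trunc[of t l]]]])
    (use assms in \<open>auto simp: sproc_trunc indicator_def\<close>)

text \<open>The constant depends on the list alone, not on the window, the event or
  \<open>c\<close>, so a whole partition contributes only its total length. This is where
  boundedness of the heights enters.\<close>

lemma window_bound:
  assumes "simple l"
  shows "\<exists>C\<ge>0. \<forall>s t B c. 0 \<le> s \<longrightarrow> s \<le> t \<longrightarrow> B \<in> sets M \<longrightarrow> 0 < c \<longrightarrow>
    expectation (\<lambda>\<omega>. (window l s t \<omega>)\<^sup>2 * indicator B \<omega>) \<le> C * ((t - s) * (2 * c + prob B / c))"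
  using assms
proof (induction l)
  case Nil
  show ?case by (intro exI[of _ 0]) (simp add: trunc_def)
next
  case (Cons e l)
  then have l: "simple l" and e: "simple [e]" by auto
  obtain C where C: "C \<ge> 0" "\<And>s t B c. 0 \<le> s \<Longrightarrow> s \<le> t \<Longrightarrow> B \<in> sets M \<Longrightarrow> 0 < c \<Longrightarrow>
    expectation (\<lambda>\<omega>. (window l s t \<omega>)\<^sup>2 * indicator B \<omega>) \<le> C * ((t - s) * (2 * c + prob B / c))"
    using Cons.IH[OF l] by blast
  obtain a b i h where eq: "e = (a,b,i,h)" by (cases e) auto
  then obtain D where ok: "0 \<le> a" "a \<le> b" "h \<in> borel_measurable (F a)" "\<And>\<omega>. \<omega> \<in> space M \<Longrightarrow> \<bar>h \<omega>\<bar> \<le> D"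
    using e by (auto simp: elem_ok_def)
  have hm: "h \<in> borel_measurable M" using ok(3) by (rule F_measurable)
  have D0: "0 \<le> D" using ok(4) not_empty by force
  \<comment> \<open>The new element contributes \<open>4 * D\<^sup>2\<close>:
    \<open>D\<^sup>2\<close> from its height and \<open>2 + 2\<close> from the two increments whose
    difference it is. Splitting the square of element plus list doubles both constants.\<close>
  show ?case
  proof (intro exI[of _ "2 * C + 8 * D\<^sup>2"] conjI allI impI)
    show "0 \<le> 2 * C + 8 * D\<^sup>2" using C(1) by simp
    fix s t :: real and B c assume st: "0 \<le> s" "s \<le> t" and B: "B \<in> sets M" and c: "0 < (c::real)"
    let ?K = "(t - s) * (2 * c + prob B / c)"
    have K0: "0 \<le> 2 * c + prob B / c" using c by simp
    let ?p = "\<lambda>x \<omega>. inc i (max x s) (max x t) \<omega>"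
    have px: "expectation (\<lambda>\<omega>. (?p x \<omega>)\<^sup>2 * indicator B \<omega>) \<le> ?K" for x
    proof -
      have "expectation (\<lambda>\<omega>. (?p x \<omega>)\<^sup>2 * indicator B \<omega>) \<le> (max x t - max x s) * (2 * c + prob B / c)"
        using st by (intro inc_sq_indicator B c) auto
      also have "\<dots> \<le> ?K" by (rule mult_right_mono[OF _ K0]) (use st in auto)
      finally show ?thesis .
    qed
    have pi: "integrable M (\<lambda>\<omega>. (?p x \<omega>)\<^sup>2 * indicator B \<omega>)" for x
      using st by (intro integrable_real_mult_indicator B inc_moments(3)) auto
    \<comment> \<open>The four Brownian values at the ends of the two truncated intervals are
      regrouped into the increments over the parts of \<open>(s, t]\<close> after \<open>a\<close>
      and after \<open>b\<close>; each has length at most \<open>t - s\<close>, which the two tails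
      do not.\<close>
    have we: "window [e] s t \<omega> = h \<omega> * (?p a \<omega> - ?p b \<omega>)" for \<omega>
      by (simp add: eq trunc_def elem_int_def algebra_simps)
    have we2: "(window [e] s t \<omega>)\<^sup>2 * indicator B \<omega> \<le> 2 * D\<^sup>2 * ((?p a \<omega>)\<^sup>2 * indicator B \<omega> + (?p b \<omega>)\<^sup>2 * indicator B \<omega>)"
      if "\<omega> \<in> space M" for \<omega>
    proof -
      have 1: "(?p a \<omega> - ?p b \<omega>)\<^sup>2 \<le> 2 * (?p a \<omega>)\<^sup>2 + 2 * (?p b \<omega>)\<^sup>2"
        by (rule sq_diff_le)
      have 2: "(h \<omega>)\<^sup>2 \<le> D\<^sup>2" using power_mono[OF ok(4)[OF that], of 2] by simp
      have "(window [e] s t \<omega>)\<^sup>2 \<le> D\<^sup>2 * (2 * (?p a \<omega>)\<^sup>2 + 2 * (?p b \<omega>)\<^sup>2)"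
        unfolding we power_mult_distrib by (rule mult_mono[OF 2 1]) auto
      then show ?thesis by (auto simp: indicator_def algebra_simps)
    qed
    have wi: "integrable M (\<lambda>\<omega>. (window k s t \<omega>)\<^sup>2 * indicator B \<omega>)" if "simple k" for k
      by (rule integrable_real_mult_indicator[OF B ito_square_integrable(1)[OF ito_window[OF that st]]])
    have "expectation (\<lambda>\<omega>. (window [e] s t \<omega>)\<^sup>2 * indicator B \<omega>)
       \<le> expectation (\<lambda>\<omega>. 2 * D\<^sup>2 * ((?p a \<omega>)\<^sup>2 * indicator B \<omega> + (?p b \<omega>)\<^sup>2 * indicator B \<omega>))"
      by (rule integral_mono[OF wi[OF e]]) (use pi we2 in \<open>simp_all del: vector_minus_component\<close>)
    also have "\<dots> = 2 * D\<^sup>2 * (expectation (\<lambda>\<omega>. (?p a \<omega>)\<^sup>2 * indicator B \<omega>) + expectation (\<lambda>\<omega>. (?p b \<omega>)\<^sup>2 * indicator B \<omega>))"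
      using pi by (simp del: vector_minus_component)
    also have "\<dots> \<le> 2 * D\<^sup>2 * (?K + ?K)"
      by (intro mult_left_mono add_mono px) simp
    finally have E: "expectation (\<lambda>\<omega>. (window [e] s t \<omega>)\<^sup>2 * indicator B \<omega>) \<le> 4 * D\<^sup>2 * ?K" by simp
    have split: "window (e # l) s t \<omega> = window [e] s t \<omega> + window l s t \<omega>" for \<omega>
      by (simp add: trunc_def split: prod.split)
    have "expectation (\<lambda>\<omega>. (window (e # l) s t \<omega>)\<^sup>2 * indicator B \<omega>)
      \<le> expectation (\<lambda>\<omega>. 2 * ((window [e] s t \<omega>)\<^sup>2 * indicator B \<omega>) + 2 * ((window l s t \<omega>)\<^sup>2 * indicator B \<omega>))"
    proof (rule integral_mono[OF wi[OF Cons.prems]])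
      show "integrable M (\<lambda>\<omega>. 2 * ((window [e] s t \<omega>)\<^sup>2 * indicator B \<omega>) + 2 * ((window l s t \<omega>)\<^sup>2 * indicator B \<omega>))"
        using wi[OF e] wi[OF l] by simp
      show "(window (e # l) s t \<omega>)\<^sup>2 * indicator B \<omega> \<le> 2 * ((window [e] s t \<omega>)\<^sup>2 * indicator B \<omega>) + 2 * ((window l s t \<omega>)\<^sup>2 * indicator B \<omega>)" for \<omega>
        unfolding split using sq_add_le[of "window [e] s t \<omega>" "window l s t \<omega>"] by (auto simp: indicator_def)
    qed
    also have "\<dots> = 2 * expectation (\<lambda>\<omega>. (window [e] s t \<omega>)\<^sup>2 * indicator B \<omega>) + 2 * expectation (\<lambda>\<omega>. (window l s t \<omega>)\<^sup>2 * indicator B \<omega>)"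
      using wi[OF e] wi[OF l] by simp
    also have "\<dots> \<le> 2 * (4 * D\<^sup>2 * ?K) + 2 * (C * ?K)"
      using E C(2)[OF st B c] by linarith
    finally show "expectation (\<lambda>\<omega>. (window (e # l) s t \<omega>)\<^sup>2 * indicator B \<omega>) \<le> (2 * C + 8 * D\<^sup>2) * ?K"
      by (simp add: algebra_simps)
  qed
qed

text \<open>The form of the isometry that allows subtraction. By Fubini the time integral exists
  along almost every path, hence the first clause.\<close>

lemma ito_isometry_real:
  assumes "ito p I"
  shows "AE \<omega> in M. integrable lborel (\<lambda>s. (norm (p s \<omega>))\<^sup>2)"
    "integrable M (\<lambda>\<omega>. LINT s|lborel. (norm (p s \<omega>))\<^sup>2)"
    "expectation (\<lambda>\<omega>. (I \<omega>)\<^sup>2) = expectation (\<lambda>\<omega>. LINT s|lborel. (norm (p s \<omega>))\<^sup>2)"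
proof -
  have jp: "joint_measurable p" using assms by (simp add: ito_def)
  let ?f = "\<lambda>(\<omega>, s). (norm (p s \<omega>))\<^sup>2"
  have "(\<lambda>x. p (snd x) (fst x)) \<in> borel_measurable (M \<Otimes>\<^sub>M lborel)" using jp by (simp add: joint_measurable_def)
  then have m: "?f \<in> borel_measurable (M \<Otimes>\<^sub>M lborel)" by (simp add: case_prod_beta)
  have n: "norm2 p = (\<integral>\<^sup>+x. ennreal (?f x) \<partial>(M \<Otimes>\<^sub>M lborel))"
    using norm2_product[OF jp] by (simp add: case_prod_beta)
  have i: "integrable (M \<Otimes>\<^sub>M lborel) ?f"
    using m ito_norm2_finite[OF assms] n by (intro integrableI_nonneg) (auto simp: case_prod_beta)
  interpret L: pair_sigma_finite M lborel ..
  show "AE \<omega> in M. integrable lborel (\<lambda>s. (norm (p s \<omega>))\<^sup>2)" using L.AE_integrable_fst[OF i] .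
  show "integrable M (\<lambda>\<omega>. LINT s|lborel. (norm (p s \<omega>))\<^sup>2)" using L.integrable_fst[OF i] .
  have "(\<integral>\<^sup>+x. ennreal (?f x) \<partial>(M \<Otimes>\<^sub>M lborel)) = ennreal (integral\<^sup>L (M \<Otimes>\<^sub>M lborel) ?f)"
    by (rule nn_integral_eq_integral[OF i]) (auto simp: case_prod_beta)
  moreover have "(\<integral>\<^sup>+\<omega>. ennreal ((I \<omega>)\<^sup>2) \<partial>M) = ennreal (expectation (\<lambda>\<omega>. (I \<omega>)\<^sup>2))"
    by (rule nn_integral_eq_integral[OF ito_square_integrable(1)[OF assms]]) simp
  ultimately have "ennreal (expectation (\<lambda>\<omega>. (I \<omega>)\<^sup>2)) = ennreal (integral\<^sup>L (M \<Otimes>\<^sub>M lborel) ?f)"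
    using ito_isometry[OF assms] n by simp
  then have "expectation (\<lambda>\<omega>. (I \<omega>)\<^sup>2) = integral\<^sup>L (M \<Otimes>\<^sub>M lborel) ?f"
    by (subst (asm) ennreal_inj) (auto intro!: integral_nonneg_AE AE_I2)
  then show "expectation (\<lambda>\<omega>. (I \<omega>)\<^sup>2) = expectation (\<lambda>\<omega>. LINT s|lborel. (norm (p s \<omega>))\<^sup>2)"
    using L.integral_fst[OF i] by simp
qed

text \<open>Times are rounded down to the grid of mesh \<open>1 / Suc n\<close>. Each rounded
  process uses only countably many of the variables \<open>Y t\<close>, and path continuity gives
  the limit.\<close>

lemma joint_measurable_continuous:
  fixes Y :: "real \<Rightarrow> 'a \<Rightarrow> 'b::euclidean_space"
  assumes m: "\<And>t. Y t \<in> borel_measurable M" and c: "\<And>\<omega>. \<omega> \<in> space M \<Longrightarrow> continuous_on UNIV (\<lambda>t. Y t \<omega>)"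
  shows "joint_measurable Y"
  unfolding joint_measurable_def
proof (rule borel_measurable_LIMSEQ_metric)
  let ?r = "\<lambda>n s. real_of_int \<lfloor>s * real (Suc n)\<rfloor> / real (Suc n)"
  fix n
  have 1: "(\<lambda>x. Y (real_of_int k / real (Suc n)) (fst x)) \<in> borel_measurable (M \<Otimes>\<^sub>M lborel)" for k :: int
    using m by (intro measurable_compose[OF measurable_fst]) auto
  have 2: "(\<lambda>x. \<lfloor>snd x * real (Suc n)\<rfloor>) \<in> measurable (M \<Otimes>\<^sub>M lborel) (count_space UNIV)" by measurable
  show "(\<lambda>x. Y (?r n (snd x)) (fst x)) \<in> borel_measurable (M \<Otimes>\<^sub>M lborel)"
    using measurable_compose_countable[OF 1 2] by simp
next
  let ?r = "\<lambda>n s. real_of_int \<lfloor>s * real (Suc n)\<rfloor> / real (Suc n)"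
  fix x assume x: "x \<in> space (M \<Otimes>\<^sub>M (lborel::real measure))"
  have r: "(\<lambda>n. ?r n s) \<longlonglongrightarrow> s" for s :: real
  proof (rule tendsto_sandwich[of "\<lambda>n. s - 1 / real (Suc n)" _ _ "\<lambda>n. s"])
    have "s - 1 / real (Suc n) \<le> ?r n s" for n
    proof -
      have "s * real (Suc n) - 1 \<le> real_of_int \<lfloor>s * real (Suc n)\<rfloor>" by linarith
      then have "(s * real (Suc n) - 1) / real (Suc n) \<le> ?r n s" by (rule divide_right_mono) simp
      then show ?thesis by (simp add: diff_divide_distrib)
    qed
    then show "\<forall>\<^sub>F n in sequentially. s - 1 / real (Suc n) \<le> ?r n s" by simp
    have "?r n s \<le> s" for n
    proof -
      have "?r n s \<le> s * real (Suc n) / real (Suc n)" by (rule divide_right_mono) auto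
      then show ?thesis by simp
    qed
    then show "\<forall>\<^sub>F n in sequentially. ?r n s \<le> s" by simp
    have "(\<lambda>n. s - inverse (real (Suc n))) \<longlonglongrightarrow> s - 0" by (intro tendsto_diff tendsto_const LIMSEQ_inverse_real_of_nat)
    then show "(\<lambda>n. s - 1 / real (Suc n)) \<longlonglongrightarrow> s" by (simp add: inverse_eq_divide)
  qed simp
  have "isCont (\<lambda>t. Y t (fst x)) (snd x)"
    using c[of "fst x"] x by (simp add: continuous_on_eq_continuous_at space_pair_measure mem_Times_iff)
  then show "(\<lambda>n. Y (?r n (snd x)) (fst x)) \<longlonglongrightarrow> Y (snd x) (fst x)"
    using r by (rule isCont_tendsto_compose)
qed

end

section \<open>An Ito inequality for the squared positive part\<close>

text \<open>A continuous minorant of the indicator of \<open>(0, \<infinity>)\<close> that vanishes on \<open>(-\<infinity>, \<eta>]\<close>.\<close>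

definition cutoff :: "real \<Rightarrow> real \<Rightarrow> real" where
  "cutoff \<eta> x = max 0 (min 1 ((x - \<eta>) / \<eta>))"

lemma cutoff_range: "0 \<le> cutoff \<eta> x" "cutoff \<eta> x \<le> 1"
  by (auto simp: cutoff_def)

lemma cutoff_sq_le_1: "(cutoff \<eta> x)\<^sup>2 \<le> 1"
  using cutoff_range power_le_one by blast

lemma cutoff_eq_0: "0 < \<eta> \<Longrightarrow> x \<le> \<eta> \<Longrightarrow> cutoff \<eta> x = 0"
  using divide_nonpos_pos[of "x - \<eta>" \<eta>] by (simp add: cutoff_def)

lemma cutoff_continuous: "continuous_on S (cutoff \<eta>)"
  unfolding cutoff_def[abs_def] divide_inverse by (intro continuous_intros)

lemma cutoff_measurable [measurable]: "cutoff \<eta> \<in> borel_measurable borel"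
  by (rule borel_measurable_continuous_onI[OF cutoff_continuous])

text \<open>The tangent line at \<open>a\<close> of a convex function. It holds for steps of any
  size and so also serves those beyond the threshold.\<close>

lemma pos_sq_convex: "(max 0 a)\<^sup>2 + 2 * max 0 a * (b - a) \<le> (max 0 (b::real))\<^sup>2"
proof (cases "a \<le> 0")
  case False
  show ?thesis
  proof (cases "b \<le> 0")
    case True
    then have "a * b \<le> 0" using False by (simp add: mult_nonneg_nonpos)
    then have "a\<^sup>2 + 2 * a * (b - a) \<le> 0" using zero_le_square[of a] unfolding power2_eq_square right_diff_distrib by linarith
    then show ?thesis using False True by simp
  next
    case F: False
    have "0 \<le> (b - a)\<^sup>2" by simp
    then show ?thesis using False F by (simp add: power2_eq_square algebra_simps)
  qed
qed simp

text \<open>Starting above \<open>\<eta>\<close>, a step of size at most \<open>\<eta>\<close>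
  cannot become negative, so the function is the plain square and its expansion is exact with
  coefficient 1. At or below \<open>\<eta>\<close> the cutoff vanishes and convexity is
  enough.\<close>

lemma pos_sq_second_order:
  assumes "0 < \<eta>" "\<bar>b - a\<bar> \<le> \<eta>"
  shows "(max 0 a)\<^sup>2 + 2 * max 0 a * (b - a) + (cutoff \<eta> a)\<^sup>2 * (b - a)\<^sup>2 \<le> (max 0 (b::real))\<^sup>2"
proof (cases "a \<le> \<eta>")
  case True
  then show ?thesis using pos_sq_convex[of a b] assms by (simp add: cutoff_eq_0)
next
  case False
  then have "0 < a" "0 \<le> b" using assms by auto
  moreover have "(cutoff \<eta> a)\<^sup>2 * (b - a)\<^sup>2 \<le> 1 * (b - a)\<^sup>2" by (rule mult_right_mono[OF cutoff_sq_le_1]) simp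
  ultimately show ?thesis by (simp add: power2_eq_square algebra_simps)
qed

text \<open>In the application \<open>a\<close> and \<open>b\<close> are consecutive values, \<open>I\<close> is the martingale and \<open>-G\<close> the drift
  part of the increment, \<open>I = S' + e\<close> splits off the integral of a simple approximation, and \<open>\<beta>\<close> indicates a
  path with large oscillation on the grid.\<close>

lemma discrete_step:
  fixes a b I G e S' \<eta> \<epsilon> \<beta> :: real
  assumes "0 < \<eta>" "0 < \<epsilon>" and G: "G = a - b + I" and I: "I = S' + e"
    and \<beta>: "\<beta> = 0 \<or> \<beta> = 1" "\<bar>b - a\<bar> > \<eta> \<Longrightarrow> \<beta> = 1"
  shows "(max 0 a)\<^sup>2 \<le> (max 0 b)\<^sup>2 - 2 * (max 0 a * I) + (2 * (max 0 a * G) - (cutoff \<eta> a * I)\<^sup>2)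
     + \<epsilon> * I\<^sup>2 + (1/\<epsilon> + 2) * G\<^sup>2 + 4 * e\<^sup>2 + 4 * (S'\<^sup>2 * \<beta>)"
proof -
  let ?\<theta> = "(cutoff \<eta> a)\<^sup>2"
  have d: "b - a = I - G" using G by simp
  \<comment> \<open>On a large step the quadratic term is not justified; subtracting the full square
    outweighs it and leaves the convexity bound.\<close>
  have base: "(max 0 a)\<^sup>2 + 2 * max 0 a * (b - a) + ?\<theta> * (b - a)\<^sup>2 - (b - a)\<^sup>2 * \<beta> \<le> (max 0 b)\<^sup>2"
  proof (cases "\<beta> = 1")
    case True
    have "?\<theta> * (b - a)\<^sup>2 \<le> 1 * (b - a)\<^sup>2" by (rule mult_right_mono[OF cutoff_sq_le_1]) simp
    then show ?thesis using True pos_sq_convex[of a b] by simp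
  next
    case False
    then have "\<beta> = 0" "\<bar>b - a\<bar> \<le> \<eta>" using \<beta> by (auto simp: not_le[symmetric])
    then show ?thesis using pos_sq_second_order[OF assms(1), of b a] by simp
  qed
  \<comment> \<open>Young's inequality for the mixed term of \<open>(I - G)\<^sup>2\<close>. It is
    the source of \<open>\<epsilon> * I\<^sup>2\<close> and of the factor
    \<open>1/\<epsilon>\<close>; the further 2 in front of \<open>G\<^sup>2\<close> comes from the
    correction on large steps.\<close>
  have "0 \<le> (\<epsilon> * \<bar>I\<bar> - \<bar>G\<bar>)\<^sup>2 / \<epsilon>" using assms(2) by simp
  also have "\<dots> = \<epsilon> * I\<^sup>2 + G\<^sup>2 / \<epsilon> - 2 * (\<bar>I\<bar> * \<bar>G\<bar>)"
    using assms(2) by (simp add: power2_diff power_mult_distrib field_simps power2_eq_square)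
  finally have IG: "2 * \<bar>I * G\<bar> \<le> \<epsilon> * I\<^sup>2 + G\<^sup>2 / \<epsilon>" by (simp add: abs_mult)
  have "?\<theta> * (2 * (I * G)) \<le> ?\<theta> * (2 * \<bar>I * G\<bar>)"
    by (intro mult_left_mono) auto
  also have "\<dots> \<le> 1 * (2 * \<bar>I * G\<bar>)"
    by (intro mult_right_mono cutoff_sq_le_1) auto
  finally have "?\<theta> * (2 * (I * G)) \<le> 1 * (2 * \<bar>I * G\<bar>)" .
  then have "?\<theta> * I\<^sup>2 - (\<epsilon> * I\<^sup>2 + G\<^sup>2 / \<epsilon>) \<le> ?\<theta> * I\<^sup>2 - ?\<theta> * (2 * (I * G)) + ?\<theta> * G\<^sup>2"
    using IG mult_nonneg_nonneg[OF zero_le_power2[of "cutoff \<eta> a"] zero_le_power2[of G]] by linarith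
  also have "\<dots> = ?\<theta> * (b - a)\<^sup>2" unfolding d by (simp add: power2_diff algebra_simps)
  finally have 1: "?\<theta> * I\<^sup>2 - (\<epsilon> * I\<^sup>2 + G\<^sup>2 / \<epsilon>) \<le> ?\<theta> * (b - a)\<^sup>2" .
  \<comment> \<open>Two doublings, first over martingale and drift and then over simple part and
    error, produce the two factors 4.\<close>
  have "(b - a)\<^sup>2 \<le> 2 * I\<^sup>2 + 2 * G\<^sup>2" unfolding d using sq_add_le[of I "-G"] by simp
  also have "\<dots> \<le> 4 * S'\<^sup>2 + 4 * e\<^sup>2 + 2 * G\<^sup>2" unfolding I using sq_add_le[of S' e] by simp
  finally have "(b - a)\<^sup>2 * \<beta> \<le> 4 * (S'\<^sup>2 * \<beta>) + 4 * e\<^sup>2 + 2 * G\<^sup>2"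
    using \<beta>(1) by auto
  then have "(max 0 a)\<^sup>2 + 2 * max 0 a * (I - G) + (?\<theta> * I\<^sup>2 - (\<epsilon> * I\<^sup>2 + G\<^sup>2 / \<epsilon>)) - (4 * (S'\<^sup>2 * \<beta>) + 4 * e\<^sup>2 + 2 * G\<^sup>2) \<le> (max 0 b)\<^sup>2"
    using base 1 unfolding d by linarith
  then show ?thesis by (simp add: power_mult_distrib algebra_simps)
qed

text \<open>One component of the difference of two solutions, in abstract form. \<open>J t\<close>
  is the integral from \<open>t\<close> on, so the martingale increment over \<open>(s, t]\<close>
  is \<open>J s - J t\<close>; \<open>drift\<close> is the rest of the increment, with the sign that
  makes it the time integral of the driver. Continuity and domination are required of every path,
  which is later achieved by altering the process on a null event.\<close>

locale ito_process = brownian M W for M :: "'a measure" and W :: "real \<Rightarrow> 'a \<Rightarrow> real ^ 'd" +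
  fixes X J :: "real \<Rightarrow> 'a \<Rightarrow> real" and \<zeta> :: "real \<Rightarrow> 'a \<Rightarrow> real^'d" and S :: "'a \<Rightarrow> real"
  assumes X_F: "0 \<le> t \<Longrightarrow> X t \<in> borel_measurable (F t)"
    and X_cont: "\<omega> \<in> space M \<Longrightarrow> continuous_on {0..} (\<lambda>t. X t \<omega>)"
    and X_le: "\<omega> \<in> space M \<Longrightarrow> 0 \<le> t \<Longrightarrow> \<bar>X t \<omega>\<bar> \<le> S \<omega>"
    and S_measurable: "S \<in> borel_measurable M"
    and S_sq: "integrable M (\<lambda>\<omega>. (S \<omega>)\<^sup>2)"
    and J_ito: "0 \<le> t \<Longrightarrow> ito (\<lambda>u \<omega>. indicator {t<..} u *\<^sub>R \<zeta> u \<omega>) (J t)"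
begin

abbreviation drift :: "real \<Rightarrow> real \<Rightarrow> 'a \<Rightarrow> real" where
  "drift s t \<omega> \<equiv> X s \<omega> - X t \<omega> + (J s \<omega> - J t \<omega>)"

text \<open>The increment of the quadratic variation. The inner indicator makes every window a
  restriction of one function that is integrable on the whole line, the form that
  \<open>sum_window\<close> works with.\<close>

definition bracket :: "real \<Rightarrow> real \<Rightarrow> 'a \<Rightarrow> real" where
  "bracket s t \<omega> = (LINT u|lborel. indicator {s<..t} u * (indicator {0<..} u * (norm (\<zeta> u \<omega>))\<^sup>2))"

definition total_bracket :: "'a \<Rightarrow> real" where
  "total_bracket \<omega> = (LINT u|lborel. indicator {0<..} u * (norm (\<zeta> u \<omega>))\<^sup>2)"

definition approx_err :: "('a, 'd) elem list \<Rightarrow> real \<Rightarrow> real \<Rightarrow> 'a \<Rightarrow> real" where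
  "approx_err l s t \<omega> = (LINT u|lborel. indicator {s<..t} u * (indicator {0<..} u * (norm (sproc l u \<omega> - \<zeta> u \<omega>))\<^sup>2))"

definition total_err :: "('a, 'd) elem list \<Rightarrow> 'a \<Rightarrow> real" where
  "total_err l \<omega> = (LINT u|lborel. indicator {0<..} u * (norm (sproc l u \<omega> - \<zeta> u \<omega>))\<^sup>2)"

lemma X_measurable: "0 \<le> t \<Longrightarrow> X t \<in> borel_measurable M"
  using X_F F_measurable by blast

lemma J_measurable: "0 \<le> t \<Longrightarrow> J t \<in> borel_measurable M"
  using J_ito by (auto simp: ito_def)

lemma J_sq: "0 \<le> t \<Longrightarrow> integrable M (\<lambda>\<omega>. (J t \<omega>)\<^sup>2)"
  using ito_square_integrable(1)[OF J_ito] .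

lemma X_sq: "0 \<le> t \<Longrightarrow> integrable M (\<lambda>\<omega>. (X t \<omega>)\<^sup>2)"
  using X_le by (intro L2_bound_integrable[OF X_measurable S_sq]) fastforce+

lemma ito_increment:
  assumes "0 \<le> s" "s \<le> t"
  shows "ito (\<lambda>u \<omega>. indicator {s<..t} u *\<^sub>R \<zeta> u \<omega>) (\<lambda>\<omega>. J s \<omega> - J t \<omega>)"
  by (rule ito_cong[OF ito_diff[OF J_ito[of s] J_ito[of t]]]) (use assms in \<open>auto simp: indicator_def\<close>)

lemma ito_scaled_increment:
  assumes "0 \<le> s" "s \<le> t" "A \<in> borel_measurable (F s)" "\<And>\<omega>. \<omega> \<in> space M \<Longrightarrow> \<bar>A \<omega>\<bar> \<le> C"
  shows "ito (\<lambda>u \<omega>. A \<omega> *\<^sub>R (indicator {s<..t} u *\<^sub>R \<zeta> u \<omega>)) (\<lambda>\<omega>. A \<omega> * (J s \<omega> - J t \<omega>))"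
  by (rule ito_mult[OF ito_increment assms(1) _ assms(3,4)]) (use assms in auto)

text \<open>The isometry conditional on time \<open>s\<close> in weak form: tested against bounded
  weights known at \<open>s\<close>.\<close>

lemma scaled_bracket:
  assumes "0 \<le> s" "s \<le> t" "A \<in> borel_measurable (F s)" "\<And>\<omega>. \<omega> \<in> space M \<Longrightarrow> \<bar>A \<omega>\<bar> \<le> C"
  shows "integrable M (\<lambda>\<omega>. (A \<omega>)\<^sup>2 * bracket s t \<omega>)"
    "expectation (\<lambda>\<omega>. (A \<omega> * (J s \<omega> - J t \<omega>))\<^sup>2) = expectation (\<lambda>\<omega>. (A \<omega>)\<^sup>2 * bracket s t \<omega>)"
proof -
  have eq: "(LINT u|lborel. (norm (A \<omega> *\<^sub>R (indicator {s<..t} u *\<^sub>R \<zeta> u \<omega>)))\<^sup>2) = (A \<omega>)\<^sup>2 * bracket s t \<omega>" for \<omega>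
  proof -
    have "(LINT u|lborel. (norm (A \<omega> *\<^sub>R (indicator {s<..t} u *\<^sub>R \<zeta> u \<omega>)))\<^sup>2)
      = (LINT u|lborel. (A \<omega>)\<^sup>2 * (indicator {s<..t} u * (indicator {0<..} u * (norm (\<zeta> u \<omega>))\<^sup>2)))"
      using assms(1) by (intro Bochner_Integration.integral_cong) (auto simp: indicator_def power_mult_distrib)
    then show ?thesis by (simp add: bracket_def)
  qed
  show "integrable M (\<lambda>\<omega>. (A \<omega>)\<^sup>2 * bracket s t \<omega>)"
    "expectation (\<lambda>\<omega>. (A \<omega> * (J s \<omega> - J t \<omega>))\<^sup>2) = expectation (\<lambda>\<omega>. (A \<omega>)\<^sup>2 * bracket s t \<omega>)"
    using ito_isometry_real(2,3)[OF ito_scaled_increment[OF assms]] unfolding eq by auto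
qed

lemma bracket_isometry:
  assumes "0 \<le> s" "s \<le> t"
  shows "integrable M (bracket s t)" "expectation (\<lambda>\<omega>. (J s \<omega> - J t \<omega>)\<^sup>2) = expectation (bracket s t)"
  using scaled_bracket[OF assms, of "\<lambda>_. 1" 1] by auto

lemma zeta_sq_integrable: "AE \<omega> in M. integrable lborel (\<lambda>u. indicator {0<..} u * (norm (\<zeta> u \<omega>))\<^sup>2)"
  and total_bracket_integrable: "integrable M total_bracket"
proof -
  have eq: "(norm (indicator {0<..} u *\<^sub>R \<zeta> u \<omega>))\<^sup>2 = indicator {0<..} u * (norm (\<zeta> u \<omega>))\<^sup>2" for u :: real and \<omega>
    by (auto simp: indicator_def)
  show "AE \<omega> in M. integrable lborel (\<lambda>u. indicator {0<..} u * (norm (\<zeta> u \<omega>))\<^sup>2)"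
    using ito_isometry_real(1)[OF J_ito[of 0]] unfolding eq by simp
  show "integrable M total_bracket"
    using ito_isometry_real(2)[OF J_ito[of 0]] unfolding eq by (simp add: total_bracket_def[abs_def])
qed

lemma ito_error:
  assumes "simple l" "0 \<le> s" "s \<le> t"
  shows "integrable M (approx_err l s t)"
    "expectation (\<lambda>\<omega>. ((J s \<omega> - J t \<omega>) - window l s t \<omega>)\<^sup>2) = expectation (approx_err l s t)"
proof -
  note d = ito_diff[OF ito_increment[OF assms(2,3)] ito_window[OF assms]]
  have eq: "(LINT u|lborel. (norm (indicator {s<..t} u *\<^sub>R \<zeta> u \<omega> - indicator {s<..t} u *\<^sub>R sproc l u \<omega>))\<^sup>2) = approx_err l s t \<omega>" for \<omega>
    unfolding approx_err_def using assms(2)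
    by (intro Bochner_Integration.integral_cong) (auto simp: indicator_def norm_minus_commute)
  show "integrable M (approx_err l s t)"
    "expectation (\<lambda>\<omega>. ((J s \<omega> - J t \<omega>) - window l s t \<omega>)\<^sup>2) = expectation (approx_err l s t)"
    using ito_isometry_real(2,3)[OF d] unfolding eq by auto
qed

lemma error_sq_integrable:
  assumes "simple l"
  shows "AE \<omega> in M. integrable lborel (\<lambda>u. indicator {0<..} u * (norm (sproc l u \<omega> - \<zeta> u \<omega>))\<^sup>2)"
   "integrable M (total_err l)"
   "norm2 (\<lambda>u \<omega>. indicator {0<..} u *\<^sub>R (sproc l u \<omega> - \<zeta> u \<omega>)) = ennreal (expectation (total_err l))"
proof -
  have d: "ito (\<lambda>u \<omega>. indicator {0<..} u *\<^sub>R (sproc l u \<omega> - \<zeta> u \<omega>)) (\<lambda>\<omega>. iint (trunc 0 l) \<omega> - J 0 \<omega>)"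
    by (rule ito_cong[OF ito_diff[OF ito_simple[OF simple_trunc[OF order_refl assms]] J_ito[of 0]]])
      (simp_all add: sproc_trunc scaleR_diff_right)
  have eq: "(norm (indicator {0<..} u *\<^sub>R (sproc l u \<omega> - \<zeta> u \<omega>)))\<^sup>2 = indicator {0<..} u * (norm (sproc l u \<omega> - \<zeta> u \<omega>))\<^sup>2" for u :: real and \<omega>
    by (auto simp: indicator_def)
  show "AE \<omega> in M. integrable lborel (\<lambda>u. indicator {0<..} u * (norm (sproc l u \<omega> - \<zeta> u \<omega>))\<^sup>2)"
    using ito_isometry_real(1)[OF d] unfolding eq by simp
  show "integrable M (total_err l)"
    using ito_isometry_real(2)[OF d] unfolding eq by (simp add: total_err_def[abs_def])
  have "expectation (\<lambda>\<omega>. (iint (trunc 0 l) \<omega> - J 0 \<omega>)\<^sup>2) = expectation (total_err l)"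
    using ito_isometry_real(3)[OF d] unfolding eq by (simp add: total_err_def[abs_def])
  moreover have "(\<integral>\<^sup>+\<omega>. ennreal ((iint (trunc 0 l) \<omega> - J 0 \<omega>)\<^sup>2) \<partial>M) = ennreal (expectation (\<lambda>\<omega>. (iint (trunc 0 l) \<omega> - J 0 \<omega>)\<^sup>2))"
    by (rule nn_integral_eq_integral[OF ito_square_integrable(1)[OF d]]) simp
  ultimately show "norm2 (\<lambda>u \<omega>. indicator {0<..} u *\<^sub>R (sproc l u \<omega> - \<zeta> u \<omega>)) = ennreal (expectation (total_err l))"
    using ito_isometry[OF d] by simp
qed

lemma approximating_simple:
  assumes "0 < e"
  obtains l where "simple l" "expectation (total_err l) < e"
proof -
  obtain l where l: "\<And>i. simple (l i)"
    and p: "(\<lambda>i. norm2 (\<lambda>s \<omega>. sproc (l i) s \<omega> - indicator {0<..} s *\<^sub>R \<zeta> s \<omega>)) \<longlonglongrightarrow> 0"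
    using J_ito[of 0] unfolding ito_def by auto
  have "eventually (\<lambda>i. norm2 (\<lambda>s \<omega>. sproc (l i) s \<omega> - indicator {0<..} s *\<^sub>R \<zeta> s \<omega>) < ennreal e) sequentially"
    using p by (rule order_tendstoD) (use assms in simp)
  then obtain i where i: "norm2 (\<lambda>s \<omega>. sproc (l i) s \<omega> - indicator {0<..} s *\<^sub>R \<zeta> s \<omega>) < ennreal e"
    using eventually_sequentially by auto
  have "norm2 (\<lambda>u \<omega>. indicator {0<..} u *\<^sub>R (sproc (l i) u \<omega> - \<zeta> u \<omega>)) \<le> norm2 (\<lambda>s \<omega>. sproc (l i) s \<omega> - indicator {0<..} s *\<^sub>R \<zeta> s \<omega>)"
    by (intro norm2_mono) (auto simp: indicator_def)
  also note i
  finally have "expectation (total_err (l i)) < e"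
    unfolding error_sq_integrable(3)[OF l] using assms by (simp add: ennreal_less_iff integral_nonneg_AE total_err_def)
  then show ?thesis using l that by blast
qed

text \<open>\<open>ito_mult\<close> takes bounded factors, so the positive part is first capped at
  \<open>n\<close>. The product of \<open>X s\<close> and the increment, both square integrable,
  dominates.\<close>

lemma pos_mult_increment_mean:
  assumes "0 \<le> s" "s \<le> t"
  shows "expectation (\<lambda>\<omega>. max 0 (X s \<omega>) * (J s \<omega> - J t \<omega>)) = 0"
proof -
  let ?I = "\<lambda>\<omega>. J s \<omega> - J t \<omega>"
  have [measurable]: "X s \<in> borel_measurable M" "J s \<in> borel_measurable M" "J t \<in> borel_measurable M"
    using X_measurable J_measurable assms by auto
  have z: "expectation (\<lambda>\<omega>. min (real n) (max 0 (X s \<omega>)) * ?I \<omega>) = 0" for n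
  proof -
    have "(\<lambda>\<omega>. min (real n) (max 0 (X s \<omega>))) \<in> borel_measurable (F s)"
      using X_F[OF assms(1)] by measurable
    then show ?thesis
      by (intro ito_mean[OF ito_scaled_increment[OF assms, of _ "real n"]]) auto
  qed
  have "(\<lambda>n. expectation (\<lambda>\<omega>. min (real n) (max 0 (X s \<omega>)) * ?I \<omega>)) \<longlonglongrightarrow> expectation (\<lambda>\<omega>. max 0 (X s \<omega>) * ?I \<omega>)"
  proof (rule integral_dominated_convergence[where w = "\<lambda>\<omega>. \<bar>X s \<omega> * ?I \<omega>\<bar>"])
    have "integrable M (\<lambda>\<omega>. X s \<omega> * ?I \<omega>)"
      using assms by (intro L2_mult_integrable X_sq L2_diff_integrable J_sq) auto
    then show "integrable M (\<lambda>\<omega>. \<bar>X s \<omega> * ?I \<omega>\<bar>)" by (rule integrable_abs)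
    show "AE \<omega> in M. (\<lambda>n. min (real n) (max 0 (X s \<omega>)) * ?I \<omega>) \<longlonglongrightarrow> max 0 (X s \<omega>) * ?I \<omega>"
    proof (rule AE_I2)
      fix \<omega>
      obtain N :: nat where N: "max 0 (X s \<omega>) \<le> real N" using real_arch_simple by blast
      have "eventually (\<lambda>n. min (real n) (max 0 (X s \<omega>)) * ?I \<omega> = max 0 (X s \<omega>) * ?I \<omega>) sequentially"
        unfolding eventually_sequentially using N by (intro exI[of _ N]) auto
      then show "(\<lambda>n. min (real n) (max 0 (X s \<omega>)) * ?I \<omega>) \<longlonglongrightarrow> max 0 (X s \<omega>) * ?I \<omega>"
        by (rule tendsto_eventually)
    qed
    show "AE \<omega> in M. norm (min (real n) (max 0 (X s \<omega>)) * ?I \<omega>) \<le> \<bar>X s \<omega> * ?I \<omega>\<bar>" for n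
      by (intro AE_I2) (auto simp: abs_mult intro!: mult_right_mono)
  qed measurable
  then show ?thesis unfolding z by (simp add: LIMSEQ_const_iff)
qed

text \<open>\<open>discrete_step\<close> under the expectation, with the indicator of
  \<open>B\<close> as \<open>\<beta>\<close>. The martingale term has mean zero, and the squares of
  the scaled increment, the increment and the approximation error become time integrals by the
  isometry. The square on \<open>B\<close> keeps its form, because \<open>B\<close> need not be
  known at time \<open>s\<close>.\<close>

lemma one_step:
  assumes st: "0 \<le> s" "s \<le> t" and l: "simple l" and B: "B \<in> sets M"
    and XB: "\<And>\<omega>. \<omega> \<in> space M \<Longrightarrow> \<bar>X t \<omega> - X s \<omega>\<bar> > \<eta> \<Longrightarrow> \<omega> \<in> B" and pos: "0 < \<eta>" "0 < \<epsilon>"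
  shows "expectation (\<lambda>\<omega>. (max 0 (X s \<omega>))\<^sup>2) \<le> expectation (\<lambda>\<omega>. (max 0 (X t \<omega>))\<^sup>2)
    + (expectation (\<lambda>\<omega>. 2 * (max 0 (X s \<omega>) * drift s t \<omega>) - (cutoff \<eta> (X s \<omega>))\<^sup>2 * bracket s t \<omega>)
    + \<epsilon> * expectation (bracket s t) + (1/\<epsilon> + 2) * expectation (\<lambda>\<omega>. (drift s t \<omega>)\<^sup>2)
    + 4 * expectation (approx_err l s t) + 4 * expectation (\<lambda>\<omega>. (window l s t \<omega>)\<^sup>2 * indicator B \<omega>))"
  and "integrable M (\<lambda>\<omega>. (drift s t \<omega>)\<^sup>2)"
  and "integrable M (\<lambda>\<omega>. 2 * (max 0 (X s \<omega>) * drift s t \<omega>) - (cutoff \<eta> (X s \<omega>))\<^sup>2 * bracket s t \<omega>)"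
proof -
  have t: "0 \<le> t" using st by simp
  have [measurable]: "X s \<in> borel_measurable M" "X t \<in> borel_measurable M" "J s \<in> borel_measurable M" "J t \<in> borel_measurable M"
    using X_measurable J_measurable st t by auto
  let ?I = "\<lambda>\<omega>. J s \<omega> - J t \<omega>"
  have ps: "integrable M (\<lambda>\<omega>. (max 0 (X r \<omega>))\<^sup>2)" if "0 \<le> r" for r
    using X_measurable[OF that] by (intro L2_bound_integrable[OF _ X_sq[OF that]]) auto
  have Isq: "integrable M (\<lambda>\<omega>. (?I \<omega>)\<^sup>2)" by (rule ito_square_integrable(1)[OF ito_increment[OF st]])
  show Gsq: "integrable M (\<lambda>\<omega>. (drift s t \<omega>)\<^sup>2)"
    by (intro L2_add_integrable L2_diff_integrable X_sq J_sq st t) measurable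
  have i1: "integrable M (\<lambda>\<omega>. max 0 (X s \<omega>) * ?I \<omega>)"
    by (intro L2_mult_integrable ps st Isq) measurable
  have i2: "integrable M (\<lambda>\<omega>. max 0 (X s \<omega>) * drift s t \<omega>)"
    by (intro L2_mult_integrable ps st Gsq) measurable
  have cF: "(\<lambda>\<omega>. cutoff \<eta> (X s \<omega>)) \<in> borel_measurable (F s)"
    using X_F[OF st(1)] by measurable
  have cb: "\<bar>cutoff \<eta> (X s \<omega>)\<bar> \<le> 1" for \<omega> using cutoff_range[of \<eta> "X s \<omega>"] by simp
  note sb = scaled_bracket[OF st cF cb]
  note ci = ito_square_integrable(1)[OF ito_scaled_increment[OF st cF cb]]
  show i3: "integrable M (\<lambda>\<omega>. 2 * (max 0 (X s \<omega>) * drift s t \<omega>) - (cutoff \<eta> (X s \<omega>))\<^sup>2 * bracket s t \<omega>)"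
    using i2 sb(1) by simp
  have wi: "integrable M (\<lambda>\<omega>. (window l s t \<omega>)\<^sup>2 * indicator B \<omega>)"
    by (rule integrable_real_mult_indicator[OF B ito_square_integrable(1)[OF ito_window[OF l st]]])
  have ei: "integrable M (\<lambda>\<omega>. (?I \<omega> - window l s t \<omega>)\<^sup>2)"
    by (rule ito_square_integrable(1)[OF ito_diff[OF ito_increment[OF st] ito_window[OF l st]]])
  have "expectation (\<lambda>\<omega>. (max 0 (X s \<omega>))\<^sup>2) \<le> expectation (\<lambda>\<omega>. (max 0 (X t \<omega>))\<^sup>2 - 2 * (max 0 (X s \<omega>) * ?I \<omega>)
     + (2 * (max 0 (X s \<omega>) * drift s t \<omega>) - (cutoff \<eta> (X s \<omega>) * ?I \<omega>)\<^sup>2)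
     + \<epsilon> * (?I \<omega>)\<^sup>2 + (1/\<epsilon> + 2) * (drift s t \<omega>)\<^sup>2 + 4 * (?I \<omega> - window l s t \<omega>)\<^sup>2 + 4 * ((window l s t \<omega>)\<^sup>2 * indicator B \<omega>))"
  proof (rule integral_mono[OF ps[OF st(1)]])
    show "integrable M (\<lambda>\<omega>. (max 0 (X t \<omega>))\<^sup>2 - 2 * (max 0 (X s \<omega>) * ?I \<omega>)
     + (2 * (max 0 (X s \<omega>) * drift s t \<omega>) - (cutoff \<eta> (X s \<omega>) * ?I \<omega>)\<^sup>2)
     + \<epsilon> * (?I \<omega>)\<^sup>2 + (1/\<epsilon> + 2) * (drift s t \<omega>)\<^sup>2 + 4 * (?I \<omega> - window l s t \<omega>)\<^sup>2 + 4 * ((window l s t \<omega>)\<^sup>2 * indicator B \<omega>))"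
      by (intro Bochner_Integration.integrable_add Bochner_Integration.integrable_diff integrable_mult_right ps i1 i2 ci Isq Gsq wi ei t)
    fix \<omega> assume \<omega>: "\<omega> \<in> space M"
    show "(max 0 (X s \<omega>))\<^sup>2 \<le> (max 0 (X t \<omega>))\<^sup>2 - 2 * (max 0 (X s \<omega>) * ?I \<omega>)
     + (2 * (max 0 (X s \<omega>) * drift s t \<omega>) - (cutoff \<eta> (X s \<omega>) * ?I \<omega>)\<^sup>2)
     + \<epsilon> * (?I \<omega>)\<^sup>2 + (1/\<epsilon> + 2) * (drift s t \<omega>)\<^sup>2 + 4 * (?I \<omega> - window l s t \<omega>)\<^sup>2 + 4 * ((window l s t \<omega>)\<^sup>2 * indicator B \<omega>)"
      by (rule discrete_step[OF pos]) (use XB[OF \<omega>] in \<open>auto simp: indicator_def\<close>)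
  qed
  also have "\<dots> = expectation (\<lambda>\<omega>. (max 0 (X t \<omega>))\<^sup>2) - 2 * expectation (\<lambda>\<omega>. max 0 (X s \<omega>) * ?I \<omega>)
     + (2 * expectation (\<lambda>\<omega>. max 0 (X s \<omega>) * drift s t \<omega>) - expectation (\<lambda>\<omega>. (cutoff \<eta> (X s \<omega>) * ?I \<omega>)\<^sup>2))
     + \<epsilon> * expectation (\<lambda>\<omega>. (?I \<omega>)\<^sup>2) + (1/\<epsilon> + 2) * expectation (\<lambda>\<omega>. (drift s t \<omega>)\<^sup>2) + 4 * expectation (\<lambda>\<omega>. (?I \<omega> - window l s t \<omega>)\<^sup>2)
     + 4 * expectation (\<lambda>\<omega>. (window l s t \<omega>)\<^sup>2 * indicator B \<omega>)"
    by (simp only: Bochner_Integration.integral_add Bochner_Integration.integral_diff integral_mult_right_zero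
        Bochner_Integration.integrable_add Bochner_Integration.integrable_diff integrable_mult_right ps[OF t] i1 i2 ci Isq Gsq wi ei)
  also have "2 * expectation (\<lambda>\<omega>. max 0 (X s \<omega>) * drift s t \<omega>) - expectation (\<lambda>\<omega>. (cutoff \<eta> (X s \<omega>) * ?I \<omega>)\<^sup>2)
     = expectation (\<lambda>\<omega>. 2 * (max 0 (X s \<omega>) * drift s t \<omega>) - (cutoff \<eta> (X s \<omega>))\<^sup>2 * bracket s t \<omega>)"
    unfolding sb(2) using i2 sb(1) by simp
  finally show "expectation (\<lambda>\<omega>. (max 0 (X s \<omega>))\<^sup>2) \<le> expectation (\<lambda>\<omega>. (max 0 (X t \<omega>))\<^sup>2)
    + (expectation (\<lambda>\<omega>. 2 * (max 0 (X s \<omega>) * drift s t \<omega>) - (cutoff \<eta> (X s \<omega>))\<^sup>2 * bracket s t \<omega>)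
    + \<epsilon> * expectation (bracket s t) + (1/\<epsilon> + 2) * expectation (\<lambda>\<omega>. (drift s t \<omega>)\<^sup>2)
    + 4 * expectation (approx_err l s t) + 4 * expectation (\<lambda>\<omega>. (window l s t \<omega>)\<^sup>2 * indicator B \<omega>))"
    unfolding pos_mult_increment_mean[OF st] bracket_isometry(2)[OF st] ito_error(2)[OF l st] by simp
qed

section \<open>Summation along an equidistant grid\<close>

definition grid :: "real \<Rightarrow> real \<Rightarrow> nat \<Rightarrow> nat \<Rightarrow> real" where
  "grid t T n k = t + (T - t) * (real k / real n)"

lemma grid_mono: "t \<le> T \<Longrightarrow> grid t T n k \<le> grid t T n (Suc k)"
  unfolding grid_def by (intro add_left_mono mult_left_mono divide_right_mono) auto

lemma grid_ends: "grid t T n 0 = t" "0 < n \<Longrightarrow> grid t T n n = T"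
  by (auto simp: grid_def)

lemma grid_range: "t \<le> T \<Longrightarrow> k \<le> n \<Longrightarrow> t \<le> grid t T n k \<and> grid t T n k \<le> T"
proof -
  assume "t \<le> T" "k \<le> n"
  then have "(T - t) * (real k / real n) \<le> (T - t) * 1"
    by (intro mult_left_mono) (auto simp: divide_le_eq_1)
  then show ?thesis using \<open>t \<le> T\<close> by (simp add: grid_def)
qed

lemma grid_nonneg: "0 \<le> t \<Longrightarrow> t \<le> T \<Longrightarrow> k \<le> n \<Longrightarrow> 0 \<le> grid t T n k"
  using grid_range[of t T k n] by simp

lemma grid_step: "0 < n \<Longrightarrow> grid t T n (Suc k) - grid t T n k = (T - t) / real n"
  by (simp add: grid_def field_simps)

lemma oscillation_set_measurable:
  assumes "\<And>k. k \<le> n \<Longrightarrow> 0 \<le> \<tau> k"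
  shows "{\<omega>\<in>space M. \<exists>k<n. \<bar>X (\<tau> (Suc k)) \<omega> - X (\<tau> k) \<omega>\<bar> > \<eta>} \<in> sets M"
proof -
  have "{\<omega>\<in>space M. \<bar>X (\<tau> (Suc k)) \<omega> - X (\<tau> k) \<omega>\<bar> > \<eta>} \<in> sets M" if "k < n" for k
  proof -
    have [measurable]: "X (\<tau> (Suc k)) \<in> borel_measurable M" "X (\<tau> k) \<in> borel_measurable M"
      using that by (auto intro!: X_measurable assms)
    show ?thesis by measurable
  qed
  then have "(\<Union>k\<in>{..<n}. {\<omega>\<in>space M. \<bar>X (\<tau> (Suc k)) \<omega> - X (\<tau> k) \<omega>\<bar> > \<eta>}) \<in> sets M" by (intro sets.finite_UN) auto
  also have "(\<Union>k\<in>{..<n}. {\<omega>\<in>space M. \<bar>X (\<tau> (Suc k)) \<omega> - X (\<tau> k) \<omega>\<bar> > \<eta>})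
    = {\<omega>\<in>space M. \<exists>k<n. \<bar>X (\<tau> (Suc k)) \<omega> - X (\<tau> k) \<omega>\<bar> > \<eta>}" by auto
  finally show ?thesis .
qed

text \<open>The one-step estimates telescope. One event \<open>B\<close> for the whole grid serves
  every step, so the window bounds add up to the total length \<open>T - t\<close>; brackets and
  approximation errors add up to at most their totals over all positive times.\<close>

lemma discrete_ito:
  assumes tT: "0 \<le> t" "t \<le> T" and n: "0 < n" and l: "simple l" and pos: "0 < \<eta>" "0 < \<epsilon>" "0 < c"
    and C: "\<And>s t B c. 0 \<le> s \<Longrightarrow> s \<le> t \<Longrightarrow> B \<in> sets M \<Longrightarrow> 0 < c \<Longrightarrow>
      expectation (\<lambda>\<omega>. (window l s t \<omega>)\<^sup>2 * indicator B \<omega>) \<le> C * ((t - s) * (2 * c + prob B / c))"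
  defines "\<tau> \<equiv> grid t T n"
  defines "B \<equiv> {\<omega>\<in>space M. \<exists>k<n. \<bar>X (\<tau> (Suc k)) \<omega> - X (\<tau> k) \<omega>\<bar> > \<eta>}"
  shows "expectation (\<lambda>\<omega>. (max 0 (X t \<omega>))\<^sup>2) \<le> expectation (\<lambda>\<omega>. (max 0 (X T \<omega>))\<^sup>2)
    + expectation (\<lambda>\<omega>. \<Sum>k<n. 2 * (max 0 (X (\<tau> k) \<omega>) * drift (\<tau> k) (\<tau> (Suc k)) \<omega>) - (cutoff \<eta> (X (\<tau> k) \<omega>))\<^sup>2 * bracket (\<tau> k) (\<tau> (Suc k)) \<omega>)
    + \<epsilon> * expectation total_bracket + (1/\<epsilon> + 2) * expectation (\<lambda>\<omega>. \<Sum>k<n. (drift (\<tau> k) (\<tau> (Suc k)) \<omega>)\<^sup>2)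
    + 4 * expectation (total_err l) + 4 * (C * ((T - t) * (2 * c + prob B / c)))"
proof -
  note \<tau>nn = grid_nonneg[OF tT, of _ n, folded \<tau>_def]
  have \<tau>m: "\<tau> k \<le> \<tau> (Suc k)" for k using grid_mono[OF tT(2)] by (simp add: \<tau>_def)
  have B: "B \<in> sets M" unfolding B_def by (rule oscillation_set_measurable) (rule \<tau>nn)
  let ?a = "\<lambda>k. expectation (\<lambda>\<omega>. (max 0 (X (\<tau> k) \<omega>))\<^sup>2)"
  let ?u = "\<lambda>k \<omega>. 2 * (max 0 (X (\<tau> k) \<omega>) * drift (\<tau> k) (\<tau> (Suc k)) \<omega>) - (cutoff \<eta> (X (\<tau> k) \<omega>))\<^sup>2 * bracket (\<tau> k) (\<tau> (Suc k)) \<omega>"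
  let ?w = "\<lambda>k. expectation (?u k) + \<epsilon> * expectation (bracket (\<tau> k) (\<tau> (Suc k))) + (1/\<epsilon> + 2) * expectation (\<lambda>\<omega>. (drift (\<tau> k) (\<tau> (Suc k)) \<omega>)\<^sup>2)
    + 4 * expectation (approx_err l (\<tau> k) (\<tau> (Suc k))) + 4 * (C * ((T - t) / real n * (2 * c + prob B / c)))"
  have kB: "\<omega> \<in> B" if "k < n" "\<omega> \<in> space M" "\<bar>X (\<tau> (Suc k)) \<omega> - X (\<tau> k) \<omega>\<bar> > \<eta>" for k \<omega>
    using that by (auto simp: B_def)
  have step: "?a k \<le> ?a (Suc k) + ?w k" if k: "k < n" for k
    using one_step(1)[OF \<tau>nn \<tau>m l B kB[OF k] pos(1,2), of k] C[OF \<tau>nn \<tau>m B pos(3), of k] k grid_step[OF n, of t T k]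
    by (simp add: \<tau>_def)
  have "?a 0 \<le> ?a m + (\<Sum>k<m. ?w k)" if "m \<le> n" for m
    using that
  proof (induction m)
    case (Suc m)
    then show ?case using step[of m] by simp
  qed simp
  from this[of n] have main: "expectation (\<lambda>\<omega>. (max 0 (X t \<omega>))\<^sup>2) \<le> expectation (\<lambda>\<omega>. (max 0 (X T \<omega>))\<^sup>2) + (\<Sum>k<n. ?w k)"
    by (simp add: \<tau>_def grid_ends n)
  have iu: "integrable M (?u k)" "integrable M (\<lambda>\<omega>. (drift (\<tau> k) (\<tau> (Suc k)) \<omega>)\<^sup>2)" if "k < n" for k
    using one_step(2,3)[OF \<tau>nn \<tau>m l B kB[OF that] pos(1,2), of k] that by auto
  have e1: "(\<Sum>k<n. expectation (?u k)) = expectation (\<lambda>\<omega>. \<Sum>k<n. ?u k \<omega>)"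
    by (rule Bochner_Integration.integral_sum[symmetric]) (use iu in auto)
  have e2: "(\<Sum>k<n. expectation (\<lambda>\<omega>. (drift (\<tau> k) (\<tau> (Suc k)) \<omega>)\<^sup>2)) = expectation (\<lambda>\<omega>. \<Sum>k<n. (drift (\<tau> k) (\<tau> (Suc k)) \<omega>)\<^sup>2)"
    by (rule Bochner_Integration.integral_sum[symmetric]) (use iu in auto)
  have e3: "(\<Sum>k<n. expectation (bracket (\<tau> k) (\<tau> (Suc k)))) \<le> expectation total_bracket"
  proof -
    have bi: "integrable M (bracket (\<tau> k) (\<tau> (Suc k)))" if "k < n" for k
      using bracket_isometry(1)[OF \<tau>nn \<tau>m, of k] that by simp
    have "(\<Sum>k<n. expectation (bracket (\<tau> k) (\<tau> (Suc k)))) = expectation (\<lambda>\<omega>. \<Sum>k<n. bracket (\<tau> k) (\<tau> (Suc k)) \<omega>)"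
      by (rule Bochner_Integration.integral_sum[symmetric]) (use bi in auto)
    also have "\<dots> \<le> expectation total_bracket"
    proof (rule integral_mono_AE[OF _ total_bracket_integrable])
      show "integrable M (\<lambda>\<omega>. \<Sum>k<n. bracket (\<tau> k) (\<tau> (Suc k)) \<omega>)" using bi by (intro Bochner_Integration.integrable_sum) auto
      show "AE \<omega> in M. (\<Sum>k<n. bracket (\<tau> k) (\<tau> (Suc k)) \<omega>) \<le> total_bracket \<omega>"
        using zeta_sq_integrable
      proof eventually_elim
        case (elim \<omega>)
        show ?case unfolding bracket_def total_bracket_def sum_window[where \<tau> = \<tau>, OF elim \<tau>m] by (rule integral_indicator_times_le[OF elim]) simp_all
      qed
    qed
    finally show ?thesis .
  qed
  have e4: "(\<Sum>k<n. expectation (approx_err l (\<tau> k) (\<tau> (Suc k)))) \<le> expectation (total_err l)"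
  proof -
    have bi: "integrable M (approx_err l (\<tau> k) (\<tau> (Suc k)))" if "k < n" for k
      using ito_error(1)[OF l \<tau>nn \<tau>m, of k] that by simp
    have "(\<Sum>k<n. expectation (approx_err l (\<tau> k) (\<tau> (Suc k)))) = expectation (\<lambda>\<omega>. \<Sum>k<n. approx_err l (\<tau> k) (\<tau> (Suc k)) \<omega>)"
      by (rule Bochner_Integration.integral_sum[symmetric]) (use bi in auto)
    also have "\<dots> \<le> expectation (total_err l)"
    proof (rule integral_mono_AE[OF _ error_sq_integrable(2)[OF l]])
      show "integrable M (\<lambda>\<omega>. \<Sum>k<n. approx_err l (\<tau> k) (\<tau> (Suc k)) \<omega>)" using bi by (intro Bochner_Integration.integrable_sum) auto
      show "AE \<omega> in M. (\<Sum>k<n. approx_err l (\<tau> k) (\<tau> (Suc k)) \<omega>) \<le> total_err l \<omega>"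
        using error_sq_integrable(1)[OF l]
      proof eventually_elim
        case (elim \<omega>)
        show ?case unfolding approx_err_def total_err_def sum_window[where \<tau> = \<tau>, OF elim \<tau>m] by (rule integral_indicator_times_le[OF elim]) simp_all
      qed
    qed
    finally show ?thesis .
  qed
  have "(\<Sum>k<n. ?w k) = expectation (\<lambda>\<omega>. \<Sum>k<n. ?u k \<omega>) + \<epsilon> * (\<Sum>k<n. expectation (bracket (\<tau> k) (\<tau> (Suc k))))
     + (1/\<epsilon> + 2) * expectation (\<lambda>\<omega>. \<Sum>k<n. (drift (\<tau> k) (\<tau> (Suc k)) \<omega>)\<^sup>2)
     + 4 * (\<Sum>k<n. expectation (approx_err l (\<tau> k) (\<tau> (Suc k)))) + 4 * (C * ((T - t) * (2 * c + prob B / c)))"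
    using n unfolding e1[symmetric] e2[symmetric] by (simp add: sum.distrib sum_distrib_left)
  then show ?thesis using main mult_left_mono[OF e3, of \<epsilon>] pos(2) e4 by linarith
qed

end

lemma (in ito_process) grid_modulus:
  fixes h :: "real \<Rightarrow> real"
  assumes h: "continuous_on {0..} h" and tT: "0 \<le> t" "t \<le> T" and e: "0 < e"
  shows "eventually (\<lambda>n. \<forall>k<n. \<forall>s\<in>{grid t T n k..grid t T n (Suc k)}. \<bar>h s - h (grid t T n k)\<bar> \<le> e) sequentially"
proof -
  have "uniformly_continuous_on {t..T} h"
    using tT by (intro compact_uniformly_continuous continuous_on_subset[OF h]) auto
  then obtain d where d: "0 < d" "\<And>x y. x \<in> {t..T} \<Longrightarrow> y \<in> {t..T} \<Longrightarrow> dist y x < d \<Longrightarrow> dist (h y) (h x) < e"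
    using e unfolding uniformly_continuous_on_def by metis
  obtain N :: nat where N: "(T - t) / d < real N" using reals_Archimedean2 by blast
  show ?thesis unfolding eventually_sequentially
  proof (intro exI[of _ "Suc N"] allI impI ballI)
    fix n k s assume n: "Suc N \<le> n" and k: "k < n" and s: "s \<in> {grid t T n k..grid t T n (Suc k)}"
    have r: "grid t T n k \<in> {t..T}" "grid t T n (Suc k) \<in> {t..T}" using grid_range[OF tT(2)] k by auto
    have "(T - t) / d < real n" using N n by linarith
    then have "(T - t) / real n < d" using d(1) n by (simp add: field_simps)
    then have "dist s (grid t T n k) < d"
      using s grid_step[of n t T k] n by (auto simp: dist_real_def)
    then have "dist (h s) (h (grid t T n k)) < e" using r s by (intro d(2)) auto
    then show "\<bar>h s - h (grid t T n k)\<bar> \<le> e" by (simp add: dist_real_def)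
  qed
qed

text \<open>Adds the equation and the one-sided drift estimate. The influence of the other
  components is hidden in \<open>\<kappa>\<close>, so each component can be treated on its own.
  \<open>\<Lambda>\<close> dominates the total variation of the drift part, and the bound on
  \<open>\<kappa>\<close> supplies integrability.\<close>

locale ito_bound = ito_process M W X J \<zeta> S for M :: "'a measure" and W :: "real \<Rightarrow> 'a \<Rightarrow> real ^ 'd"
    and X J :: "real \<Rightarrow> 'a \<Rightarrow> real" and \<zeta> :: "real \<Rightarrow> 'a \<Rightarrow> real^'d" and S :: "'a \<Rightarrow> real" +
  fixes g \<kappa> :: "real \<Rightarrow> 'a \<Rightarrow> real" and \<Lambda> \<xi> :: "'a \<Rightarrow> real" and \<psi> \<delta> :: "real \<Rightarrow> real"
  assumes \<Lambda>_measurable: "\<Lambda> \<in> borel_measurable M" and \<Lambda>_sq: "integrable M (\<lambda>\<omega>. (\<Lambda> \<omega>)\<^sup>2)"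
    and g_int: "AE \<omega> in M. set_integrable lborel {0..} (\<lambda>s. g s \<omega>) \<and> (LINT s:{0..}|lborel. \<bar>g s \<omega>\<bar>) \<le> \<Lambda> \<omega>"
    and X_eq: "AE \<omega> in M. \<forall>t\<ge>0. X t \<omega> = \<xi> \<omega> + (LINT s:{t..}|lborel. g s \<omega>) - J t \<omega>"
    and \<xi>_le: "AE \<omega> in M. \<xi> \<omega> \<le> 0"
    and \<kappa>_jm: "joint_measurable \<kappa>"
    and \<kappa>_le: "\<omega> \<in> space M \<Longrightarrow> 0 \<le> s \<Longrightarrow> 0 \<le> \<kappa> s \<omega> \<and> \<kappa> s \<omega> \<le> \<psi> s * S \<omega>"
    and \<psi>_int: "set_integrable lborel {0..} \<psi>"
    and \<delta>_int: "set_integrable lborel {0..} (\<lambda>s. (\<delta> s)\<^sup>2)"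
    and g_le: "AE \<omega> in M. AE s in lborel. 0 \<le> s \<longrightarrow> 0 < X s \<omega> \<longrightarrow> g s \<omega> \<le> \<kappa> s \<omega> + \<delta> s * norm (\<zeta> s \<omega>)"
begin

abbreviation g0 :: "'a \<Rightarrow> real \<Rightarrow> real" where "g0 \<omega> u \<equiv> indicator {0..} u * g u \<omega>"
abbreviation Z :: "'a \<Rightarrow> real \<Rightarrow> real" where "Z \<omega> u \<equiv> indicator {0<..} u * (norm (\<zeta> u \<omega>))\<^sup>2"

text \<open>Constant extension to negative times, so that measurability can be stated on the product
  with all of \<open>lborel\<close>.\<close>

definition Xe :: "real \<Rightarrow> 'a \<Rightarrow> real" where "Xe u \<omega> = X (max 0 u) \<omega>"

text \<open>The sum of the two densities below dominates \<open>2 X\<^sup>+ g - (cutoff \<eta> X)\<^sup>2 |\<zeta>|\<^sup>2\<close>, by completing the square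
  in \<open>|\<zeta>|\<close>; the second one disappears as \<open>\<eta> \<rightarrow> 0\<close>.\<close>

definition lipschitz_density :: "real \<Rightarrow> 'a \<Rightarrow> real \<Rightarrow> real" where
  "lipschitz_density t \<omega> u = indicator {t<..} u * (2 * (max 0 (Xe u \<omega>) * \<kappa> u \<omega>) + (\<delta> u)\<^sup>2 * (max 0 (Xe u \<omega>))\<^sup>2)"

definition cutoff_density :: "real \<Rightarrow> 'a \<Rightarrow> real \<Rightarrow> real" where
  "cutoff_density \<eta> \<omega> u = (indicator {0<..} (Xe u \<omega>) - (cutoff \<eta> (Xe u \<omega>))\<^sup>2) * Z \<omega> u"

section \<open>Measurability and bounds of the two densities\<close>

lemma joint_measurable_Xe: "joint_measurable Xe"
proof (rule joint_measurable_continuous)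
  show "Xe t \<in> borel_measurable M" for t unfolding Xe_def[abs_def] by (rule X_measurable) simp
  show "continuous_on UNIV (\<lambda>t. Xe t \<omega>)" if "\<omega> \<in> space M" for \<omega>
    unfolding Xe_def by (rule continuous_on_compose2[OF X_cont[OF that]]) (auto intro!: continuous_intros)
qed

lemma Xe_measurable [measurable]: "(\<lambda>x. Xe (snd x) (fst x)) \<in> borel_measurable (M \<Otimes>\<^sub>M lborel)"
  using joint_measurable_Xe by (simp add: joint_measurable_def)

lemma \<kappa>_measurable [measurable]: "(\<lambda>x. \<kappa> (snd x) (fst x)) \<in> borel_measurable (M \<Otimes>\<^sub>M lborel)"
  using \<kappa>_jm by (simp add: joint_measurable_def)

lemma Z_measurable [measurable]: "(\<lambda>x. Z (fst x) (snd x)) \<in> borel_measurable (M \<Otimes>\<^sub>M lborel)"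
proof -
  have "(\<lambda>x. indicator {0<..} (snd x) *\<^sub>R \<zeta> (snd x) (fst x)) \<in> borel_measurable (M \<Otimes>\<^sub>M lborel)"
    using J_ito[of 0] by (simp add: ito_def joint_measurable_def)
  then have "(\<lambda>x. (norm (indicator {0<..} (snd x) *\<^sub>R \<zeta> (snd x) (fst x)))\<^sup>2) \<in> borel_measurable (M \<Otimes>\<^sub>M lborel)" by measurable
  also have "(\<lambda>x. (norm (indicator {0<..} (snd x) *\<^sub>R \<zeta> (snd x) (fst x)))\<^sup>2) = (\<lambda>x. Z (fst x) (snd x))"
    by (auto simp: indicator_def)
  finally show ?thesis .
qed

lemma \<delta>_measurable [measurable]: "(\<lambda>u. indicator {0<..} u * (\<delta> u)\<^sup>2) \<in> borel_measurable lborel"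
proof -
  have "(\<lambda>u. indicator {0<..} u * (indicator {0..} u * (\<delta> u)\<^sup>2)) \<in> borel_measurable lborel"
    using borel_measurable_integrable[OF \<delta>_int[unfolded set_integrable_def]] by simp
  also have "(\<lambda>u. indicator {0<..} u * (indicator {0..} u * (\<delta> u)\<^sup>2)) = (\<lambda>u. indicator {0<..} u * (\<delta> u)\<^sup>2)"
    by (auto simp: indicator_def)
  finally show ?thesis .
qed

lemma lipschitz_density_measurable: "0 \<le> t \<Longrightarrow> (\<lambda>x. lipschitz_density t (fst x) (snd x)) \<in> borel_measurable (M \<Otimes>\<^sub>M lborel)"
proof -
  assume "0 \<le> t"
  then have "(\<lambda>x. lipschitz_density t (fst x) (snd x)) = (\<lambda>x. indicator {t<..} (snd x) * (2 * (max 0 (Xe (snd x) (fst x)) * \<kappa> (snd x) (fst x))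
    + (indicator {0<..} (snd x) * (\<delta> (snd x))\<^sup>2) * (max 0 (Xe (snd x) (fst x)))\<^sup>2))"
    by (auto simp: lipschitz_density_def indicator_def)
  also have "\<dots> \<in> borel_measurable (M \<Otimes>\<^sub>M lborel)"
    using measurable_compose[OF measurable_snd \<delta>_measurable, of M] by measurable
  finally show ?thesis .
qed

lemma cutoff_density_measurable: "(\<lambda>x. cutoff_density \<eta> (fst x) (snd x)) \<in> borel_measurable (M \<Otimes>\<^sub>M lborel)"
  unfolding cutoff_density_def by measurable

lemma section_measurable:
  "(\<lambda>x. f (fst x) (snd x)) \<in> borel_measurable (M \<Otimes>\<^sub>M lborel) \<Longrightarrow> \<omega> \<in> space M \<Longrightarrow> f \<omega> \<in> borel_measurable lborel"
  using measurable_compose[OF measurable_Pair1', of \<omega> M "\<lambda>x. f (fst x) (snd x)" lborel borel] by simp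

lemma S_nonneg: "\<omega> \<in> space M \<Longrightarrow> 0 \<le> S \<omega>"
  using X_le[of \<omega> 0] by linarith

lemma Xe_pos_le: "\<omega> \<in> space M \<Longrightarrow> max 0 (Xe u \<omega>) \<le> S \<omega>"
  using X_le[of \<omega> "max 0 u"] S_nonneg[of \<omega>] by (simp add: Xe_def abs_le_iff)

lemma lipschitz_density_bounds:
  assumes "\<omega> \<in> space M" "0 \<le> t"
  shows "0 \<le> lipschitz_density t \<omega> u" "lipschitz_density t \<omega> u \<le> (S \<omega>)\<^sup>2 * (2 * (indicator {0..} u * \<psi> u) + indicator {0..} u * (\<delta> u)\<^sup>2)"
proof -
  show "0 \<le> lipschitz_density t \<omega> u" using assms \<kappa>_le[of \<omega> u] by (auto simp: lipschitz_density_def indicator_def)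
  show "lipschitz_density t \<omega> u \<le> (S \<omega>)\<^sup>2 * (2 * (indicator {0..} u * \<psi> u) + indicator {0..} u * (\<delta> u)\<^sup>2)"
  proof (cases "t < u")
    case True
    let ?x = "max 0 (Xe u \<omega>)"
    have x: "0 \<le> ?x" "?x \<le> S \<omega>" using Xe_pos_le[OF assms(1)] by auto
    have k: "0 \<le> \<kappa> u \<omega>" "\<kappa> u \<omega> \<le> \<psi> u * S \<omega>" using \<kappa>_le[OF assms(1), of u] True assms by auto
    have 1: "?x * \<kappa> u \<omega> \<le> S \<omega> * (\<psi> u * S \<omega>)" using x k S_nonneg[OF assms(1)] by (intro mult_mono) auto
    have "?x\<^sup>2 \<le> (S \<omega>)\<^sup>2" using x by (intro power_mono) auto
    then have 2: "(\<delta> u)\<^sup>2 * ?x\<^sup>2 \<le> (\<delta> u)\<^sup>2 * (S \<omega>)\<^sup>2" by (intro mult_left_mono) auto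
    show ?thesis using 1 2 True assms by (simp add: lipschitz_density_def power2_eq_square algebra_simps)
  next
    case False
    \<comment> \<open>The sign of \<open>\<psi>\<close> is not among the assumptions of the locale;
      \<open>\<kappa>_le\<close> gives it after multiplication by \<open>S \<omega>\<close>, which
      the factor \<open>(S \<omega>)\<^sup>2\<close> in the claim makes sufficient.\<close>
    have "0 \<le> \<psi> u * S \<omega>" if "0 \<le> u" using \<kappa>_le[OF assms(1) that] by linarith
    then have "0 \<le> (S \<omega>)\<^sup>2 * \<psi> u" if "0 \<le> u" using that S_nonneg[OF assms(1)]
      by (metis mult.assoc mult.commute mult_nonneg_nonneg power2_eq_square)
    then have "0 \<le> (S \<omega>)\<^sup>2 * (2 * (indicator {0..} u * \<psi> u) + indicator {0..} u * (\<delta> u)\<^sup>2)"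
      by (auto simp: indicator_def algebra_simps)
    then show ?thesis using False by (simp add: lipschitz_density_def)
  qed
qed

lemma cutoff_density_bounds:
  assumes "0 < \<eta>"
  shows "0 \<le> cutoff_density \<eta> \<omega> u" "cutoff_density \<eta> \<omega> u \<le> Z \<omega> u"
proof -
  let ?c = "indicator {0<..} (Xe u \<omega>) - (cutoff \<eta> (Xe u \<omega>))\<^sup>2"
  have c: "0 \<le> ?c" "?c \<le> 1"
    using cutoff_sq_le_1[of \<eta> "Xe u \<omega>"] cutoff_eq_0[OF assms, of "Xe u \<omega>"] assms
    by (auto simp: indicator_def not_less)
  have z: "0 \<le> Z \<omega> u" by simp
  show "0 \<le> cutoff_density \<eta> \<omega> u" unfolding cutoff_density_def by (rule mult_nonneg_nonneg[OF c(1) z])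
  show "cutoff_density \<eta> \<omega> u \<le> Z \<omega> u" unfolding cutoff_density_def using mult_right_mono[OF c(2) z] by simp
qed

lemma lipschitz_density_integrable: 
  assumes "\<omega> \<in> space M" "0 \<le> t"
  shows "integrable lborel (lipschitz_density t \<omega>)"
proof (rule Bochner_Integration.integrable_bound)
  show "integrable lborel (\<lambda>u. (S \<omega>)\<^sup>2 * (2 * (indicator {0..} u * \<psi> u) + indicator {0..} u * (\<delta> u)\<^sup>2))"
    using \<psi>_int \<delta>_int by (simp add: set_integrable_def)
  show "lipschitz_density t \<omega> \<in> borel_measurable lborel" using lipschitz_density_measurable[OF assms(2)] assms(1) by (rule section_measurable)
  have "norm (lipschitz_density t \<omega> u) \<le> norm ((S \<omega>)\<^sup>2 * (2 * (indicator {0..} u * \<psi> u) + indicator {0..} u * (\<delta> u)\<^sup>2))" for u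
    using lipschitz_density_bounds[OF assms, of u] by simp
  then show "AE u in lborel. norm (lipschitz_density t \<omega> u) \<le> norm ((S \<omega>)\<^sup>2 * (2 * (indicator {0..} u * \<psi> u) + indicator {0..} u * (\<delta> u)\<^sup>2))" by simp
qed

lemma cutoff_density_integrable:
  assumes "\<omega> \<in> space M" "0 < \<eta>" "integrable lborel (Z \<omega>)"
  shows "integrable lborel (cutoff_density \<eta> \<omega>)"
proof (rule Bochner_Integration.integrable_bound[OF assms(3)])
  show "cutoff_density \<eta> \<omega> \<in> borel_measurable lborel" using cutoff_density_measurable assms(1) by (rule section_measurable)
  have "norm (cutoff_density \<eta> \<omega> u) \<le> norm (Z \<omega> u)" for u
    using cutoff_density_bounds[OF assms(2), of \<omega> u] by simp
  then show "AE u in lborel. norm (cutoff_density \<eta> \<omega> u) \<le> norm (Z \<omega> u)" by simp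
qed

definition lipschitz_term :: "real \<Rightarrow> 'a \<Rightarrow> real" where "lipschitz_term t \<omega> = (LINT u|lborel. lipschitz_density t \<omega> u)"
definition cutoff_defect :: "real \<Rightarrow> 'a \<Rightarrow> real" where "cutoff_defect \<eta> \<omega> = (LINT u|lborel. cutoff_density \<eta> \<omega> u)"

lemma lipschitz_term_integrable: assumes "0 \<le> t" shows "integrable M (lipschitz_term t)"
proof (rule Bochner_Integration.integrable_bound)
  let ?K = "LINT u|lborel. 2 * (indicator {0..} u * \<psi> u) + indicator {0..} u * (\<delta> u)\<^sup>2"
  show "integrable M (\<lambda>\<omega>. (S \<omega>)\<^sup>2 * ?K)" using S_sq by simp
  show "lipschitz_term t \<in> borel_measurable M" unfolding lipschitz_term_def[abs_def]
    using lipschitz_density_measurable[OF assms] by (intro lborel.borel_measurable_lebesgue_integral) (simp add: case_prod_beta)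
  have "norm (lipschitz_term t \<omega>) \<le> norm ((S \<omega>)\<^sup>2 * ?K)" if "\<omega> \<in> space M" for \<omega>
  proof -
    have "lipschitz_term t \<omega> \<le> (LINT u|lborel. (S \<omega>)\<^sup>2 * (2 * (indicator {0..} u * \<psi> u) + indicator {0..} u * (\<delta> u)\<^sup>2))"
      unfolding lipschitz_term_def using \<psi>_int \<delta>_int
      by (intro integral_mono lipschitz_density_integrable that assms lipschitz_density_bounds) (simp add: set_integrable_def)
    moreover have "0 \<le> lipschitz_term t \<omega>" unfolding lipschitz_term_def by (intro integral_nonneg_AE AE_I2 lipschitz_density_bounds that assms)
    ultimately show ?thesis by simp
  qed
  then show "AE \<omega> in M. norm (lipschitz_term t \<omega>) \<le> norm ((S \<omega>)\<^sup>2 * ?K)" by (rule AE_I2)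
qed

lemma cutoff_defect_integrable: assumes "0 < \<eta>" shows "integrable M (cutoff_defect \<eta>)" and "AE \<omega> in M. 0 \<le> cutoff_defect \<eta> \<omega> \<and> cutoff_defect \<eta> \<omega> \<le> total_bracket \<omega>"
proof -
  show b: "AE \<omega> in M. 0 \<le> cutoff_defect \<eta> \<omega> \<and> cutoff_defect \<eta> \<omega> \<le> total_bracket \<omega>"
    using zeta_sq_integrable AE_space
  proof eventually_elim
    case (elim \<omega>)
    show ?case unfolding cutoff_defect_def total_bracket_def
      using cutoff_density_integrable[OF elim(2) assms elim(1)] elim(1) cutoff_density_bounds[OF assms, of \<omega>]
      by (auto intro!: integral_mono integral_nonneg_AE)
  qed
  show "integrable M (cutoff_defect \<eta>)"
  proof (rule Bochner_Integration.integrable_bound[OF total_bracket_integrable])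
    show "cutoff_defect \<eta> \<in> borel_measurable M" unfolding cutoff_defect_def[abs_def]
      using cutoff_density_measurable by (intro lborel.borel_measurable_lebesgue_integral) (simp add: case_prod_beta)
    show "AE \<omega> in M. norm (cutoff_defect \<eta> \<omega>) \<le> norm (total_bracket \<omega>)" using b by eventually_elim auto
  qed
qed

text \<open>Two readings of the drift: as an integral over the step it enters the Riemann sums, as a
  difference of tails it inherits a modulus of continuity. They differ at the end points only, which
  are null sets.\<close>

lemma drift_eq:
  assumes eq: "\<forall>t\<ge>0. X t \<omega> = \<xi> \<omega> + (LINT s:{t..}|lborel. g s \<omega>) - J t \<omega>"
    and g: "integrable lborel (g0 \<omega>)" and st: "0 \<le> s" "s \<le> t"
  shows "drift s t \<omega> = (LINT u|lborel. indicator {s<..t} u * g0 \<omega> u)"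
    "drift s t \<omega> = (LINT u|lborel. indicator {s..} u *\<^sub>R g0 \<omega> u) - (LINT u|lborel. indicator {t..} u *\<^sub>R g0 \<omega> u)"
proof -
  note i = integrable_indicator_times[OF g]
  have l: "(LINT u:{r..}|lborel. g u \<omega>) = (LINT u|lborel. indicator {r..} u * g0 \<omega> u)" if "0 \<le> r" for r
    unfolding set_lebesgue_integral_def using that
    by (intro Bochner_Integration.integral_cong) (auto simp: indicator_def)
  have "drift s t \<omega> = (LINT u|lborel. indicator {s..} u * g0 \<omega> u) - (LINT u|lborel. indicator {t..} u * g0 \<omega> u)"
    using eq st by (simp add: l)
  then show "drift s t \<omega> = (LINT u|lborel. indicator {s..} u *\<^sub>R g0 \<omega> u) - (LINT u|lborel. indicator {t..} u *\<^sub>R g0 \<omega> u)" by simp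
  note this
  also have "\<dots> = (LINT u|lborel. indicator {s..} u * g0 \<omega> u - indicator {t..} u * g0 \<omega> u)"
    by (simp add: i)
  also have "\<dots> = (LINT u|lborel. indicator {s<..t} u * g0 \<omega> u)"
  proof (rule integral_cong_AE)
    have "AE u in lborel. u \<noteq> s \<and> u \<noteq> t" using AE_lborel_singleton[of s] AE_lborel_singleton[of t] by eventually_elim simp
    then show "AE u in lborel. indicator {s..} u * g0 \<omega> u - indicator {t..} u * g0 \<omega> u = indicator {s<..t} u * g0 \<omega> u"
      by eventually_elim (use st in \<open>auto simp: indicator_def\<close>)
  qed (use i borel_measurable_integrable in auto)
  finally show "drift s t \<omega> = (LINT u|lborel. indicator {s<..t} u * g0 \<omega> u)" .
qed

abbreviation regular :: "'a \<Rightarrow> bool" where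
  "regular \<omega> \<equiv> \<omega> \<in> space M \<and> integrable lborel (g0 \<omega>) \<and> (LINT u|lborel. \<bar>g0 \<omega> u\<bar>) \<le> \<Lambda> \<omega> \<and>
    (\<forall>t\<ge>0. X t \<omega> = \<xi> \<omega> + (LINT s:{t..}|lborel. g s \<omega>) - J t \<omega>) \<and> integrable lborel (Z \<omega>) \<and>
    (AE s in lborel. 0 \<le> s \<longrightarrow> 0 < X s \<omega> \<longrightarrow> g s \<omega> \<le> \<kappa> s \<omega> + \<delta> s * norm (\<zeta> s \<omega>)) \<and> \<xi> \<omega> \<le> 0"

lemma AE_regular: "AE \<omega> in M. regular \<omega>"
  using g_int X_eq g_le zeta_sq_integrable \<xi>_le AE_space
proof eventually_elim
  case (elim \<omega>)
  have "(LINT u|lborel. \<bar>g0 \<omega> u\<bar>) = (LINT s:{0..}|lborel. \<bar>g s \<omega>\<bar>)"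
    unfolding set_lebesgue_integral_def by (intro Bochner_Integration.integral_cong) (auto simp: abs_mult)
  then show ?case using elim by (simp add: set_integrable_def)
qed

section \<open>Limits along refining grids\<close>

lemma window_abs_sum:
  assumes "regular \<omega>" and \<tau>: "\<And>k. k \<le> n \<Longrightarrow> 0 \<le> \<tau> k" "\<And>k. \<tau> k \<le> \<tau> (Suc k)"
  shows "(\<Sum>k<n. \<bar>drift (\<tau> k) (\<tau> (Suc k)) \<omega>\<bar>) \<le> \<Lambda> \<omega>"
proof -
  have g: "integrable lborel (g0 \<omega>)" using assms by blast
  have ga: "integrable lborel (\<lambda>u. \<bar>g0 \<omega> u\<bar>)" using g by (rule integrable_abs)
  have "(\<Sum>k<n. \<bar>drift (\<tau> k) (\<tau> (Suc k)) \<omega>\<bar>) \<le> (\<Sum>k<n. LINT u|lborel. indicator {\<tau> k<..\<tau> (Suc k)} u * \<bar>g0 \<omega> u\<bar>)"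
  proof (rule sum_mono)
    fix k assume "k \<in> {..<n}"
    then have "drift (\<tau> k) (\<tau> (Suc k)) \<omega> = (LINT u|lborel. indicator {\<tau> k<..\<tau> (Suc k)} u * g0 \<omega> u)"
      using assms by (intro drift_eq) auto
    also have "\<bar>\<dots>\<bar> \<le> (LINT u|lborel. \<bar>indicator {\<tau> k<..\<tau> (Suc k)} u * g0 \<omega> u\<bar>)" by (rule integral_abs_bound)
    also have "\<dots> = (LINT u|lborel. indicator {\<tau> k<..\<tau> (Suc k)} u * \<bar>g0 \<omega> u\<bar>)" by (simp add: abs_mult)
    finally show "\<bar>drift (\<tau> k) (\<tau> (Suc k)) \<omega>\<bar> \<le> (LINT u|lborel. indicator {\<tau> k<..\<tau> (Suc k)} u * \<bar>g0 \<omega> u\<bar>)" .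
  qed
  also have "\<dots> = (LINT u|lborel. indicator {\<tau> 0<..\<tau> n} u * \<bar>g0 \<omega> u\<bar>)" by (rule sum_window[OF ga]) (rule \<tau>(2))
  also have "\<dots> \<le> (LINT u|lborel. \<bar>g0 \<omega> u\<bar>)"
    by (rule integral_indicator_times_le[OF ga]) simp_all
  also have "\<dots> \<le> \<Lambda> \<omega>" using assms by blast
  finally show ?thesis .
qed

text \<open>A continuous path of finite variation has no quadratic variation: the sum is at most the
  largest increment times the total variation. The square of \<open>\<Lambda>\<close>
  dominates.\<close>

lemma drift_sq_sum_tendsto:
  assumes tT: "0 \<le> t" "t \<le> T"
  shows "(\<lambda>n. expectation (\<lambda>\<omega>. \<Sum>k<n. (drift (grid t T n k) (grid t T n (Suc k)) \<omega>)\<^sup>2)) \<longlonglongrightarrow> 0"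
proof -
  let ?s = "\<lambda>n \<omega>. \<Sum>k<n. (drift (grid t T n k) (grid t T n (Suc k)) \<omega>)\<^sup>2"
  note gnn = grid_nonneg[OF tT]
  have "(\<lambda>n. expectation (?s n)) \<longlonglongrightarrow> expectation (\<lambda>_. 0)"
  proof (rule integral_dominated_convergence[where w = "\<lambda>\<omega>. (\<Lambda> \<omega>)\<^sup>2"])
    show "?s n \<in> borel_measurable M" for n
      by (intro borel_measurable_sum borel_measurable_power borel_measurable_add borel_measurable_diff X_measurable J_measurable gnn) auto
    show "AE \<omega> in M. (\<lambda>n. ?s n \<omega>) \<longlonglongrightarrow> 0"
      using AE_regular
    proof eventually_elim
      case (elim \<omega>)
      have g: "integrable lborel (g0 \<omega>)" using elim by blast
      let ?h = "\<lambda>s. LINT u|lborel. indicator {s..} u *\<^sub>R g0 \<omega> u"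
      have h: "continuous_on {0..} ?h" by (rule continuous_on_subset[OF tail_integral_continuous[OF g]]) simp
      have L0: "0 \<le> \<Lambda> \<omega>"
      proof -
        have "0 \<le> (LINT u|lborel. \<bar>g0 \<omega> u\<bar>)" by simp
        then show ?thesis using elim by linarith
      qed
      show ?case
      proof (rule LIMSEQ_I)
        fix r :: real assume r: "0 < r"
        \<comment> \<open>The added 1 covers the case that \<open>\<Lambda> \<omega>\<close> is
          0.\<close>
        define e where "e = r / (\<Lambda> \<omega> + 1)"
        have e: "0 < e" "e * \<Lambda> \<omega> < r" using r L0 by (auto simp: e_def field_simps)
        from grid_modulus[OF h tT e(1)] obtain N where N: "\<And>n k s. n \<ge> N \<Longrightarrow> k < n \<Longrightarrow> s \<in> {grid t T n k..grid t T n (Suc k)} \<Longrightarrow> \<bar>?h s - ?h (grid t T n k)\<bar> \<le> e"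
          unfolding eventually_sequentially by blast
        show "\<exists>no. \<forall>n\<ge>no. norm (?s n \<omega> - 0) < r"
        proof (intro exI[of _ N] allI impI)
          fix n assume n: "n \<ge> N"
          have "?s n \<omega> \<le> (\<Sum>k<n. e * \<bar>drift (grid t T n k) (grid t T n (Suc k)) \<omega>\<bar>)"
          proof (rule sum_mono)
            fix k assume k: "k \<in> {..<n}"
            let ?d = "drift (grid t T n k) (grid t T n (Suc k)) \<omega>"
            have "?d = ?h (grid t T n k) - ?h (grid t T n (Suc k))"
              by (rule drift_eq(2)) (use elim gnn k grid_mono[OF tT(2)] in auto)
            then have "\<bar>?d\<bar> \<le> e" using N[OF n, of k "grid t T n (Suc k)"] k grid_mono[OF tT(2)] by (auto simp: abs_minus_commute)
            then have "\<bar>?d\<bar> * \<bar>?d\<bar> \<le> e * \<bar>?d\<bar>" by (rule mult_right_mono) simp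
            then show "?d\<^sup>2 \<le> e * \<bar>?d\<bar>" by (simp add: power2_eq_square)
          qed
          also have "\<dots> \<le> e * \<Lambda> \<omega>"
            unfolding sum_distrib_left[symmetric]
            by (rule mult_left_mono[OF window_abs_sum[where \<tau> = "grid t T n"]]) (use elim gnn grid_mono[OF tT(2)] e in auto)
          finally have "?s n \<omega> < r" using e by simp
          moreover have "0 \<le> ?s n \<omega>" by (intro sum_nonneg) simp
          ultimately show "norm (?s n \<omega> - 0) < r" by simp
        qed
      qed
    qed
    show "AE \<omega> in M. norm (?s n \<omega>) \<le> (\<Lambda> \<omega>)\<^sup>2" for n
      using AE_regular
    proof eventually_elim
      case (elim \<omega>)
      let ?d = "\<lambda>k. drift (grid t T n k) (grid t T n (Suc k)) \<omega>"
      have s: "(\<Sum>k<n. \<bar>?d k\<bar>) \<le> \<Lambda> \<omega>"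
        by (rule window_abs_sum[where \<tau> = "grid t T n"]) (use elim gnn grid_mono[OF tT(2)] in auto)
      have "?s n \<omega> \<le> (\<Sum>k<n. \<Lambda> \<omega> * \<bar>?d k\<bar>)"
      proof (rule sum_mono)
        fix k assume "k \<in> {..<n}"
        then have "\<bar>?d k\<bar> \<le> (\<Sum>k<n. \<bar>?d k\<bar>)" by (intro member_le_sum[of k "{..<n}" "\<lambda>k. \<bar>?d k\<bar>"]) auto
        then have "\<bar>?d k\<bar> * \<bar>?d k\<bar> \<le> \<Lambda> \<omega> * \<bar>?d k\<bar>" using s by (intro mult_right_mono) auto
        then show "(?d k)\<^sup>2 \<le> \<Lambda> \<omega> * \<bar>?d k\<bar>" by (simp add: power2_eq_square)
      qed
      also have "\<dots> \<le> \<Lambda> \<omega> * \<Lambda> \<omega>" unfolding sum_distrib_left[symmetric]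
      proof (rule mult_left_mono[OF s])
        have "0 \<le> (\<Sum>k<n. \<bar>?d k\<bar>)" by (intro sum_nonneg) simp
        then show "0 \<le> \<Lambda> \<omega>" using s by linarith
      qed
      finally show ?case by (simp add: power2_eq_square sum_nonneg)
    qed
  qed (use \<Lambda>_sq in auto)
  then show ?thesis by simp
qed

text \<open>Every path is uniformly continuous on \<open>{t..T}\<close> and therefore leaves the
  event once the grid is fine enough; dominated convergence then applies to the indicators.\<close>

lemma oscillation_prob_tendsto:
  assumes tT: "0 \<le> t" "t \<le> T" and \<eta>: "0 < \<eta>"
  shows "(\<lambda>n. prob {\<omega>\<in>space M. \<exists>k<n. \<bar>X (grid t T n (Suc k)) \<omega> - X (grid t T n k) \<omega>\<bar> > \<eta>}) \<longlonglongrightarrow> 0"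
proof -
  let ?B = "\<lambda>n. {\<omega>\<in>space M. \<exists>k<n. \<bar>X (grid t T n (Suc k)) \<omega> - X (grid t T n k) \<omega>\<bar> > \<eta>}"
  have B: "?B n \<in> sets M" for n by (rule oscillation_set_measurable[where \<tau> = "grid t T n", OF grid_nonneg[OF tT]])
  have lim: "(\<lambda>n. expectation (indicator (?B n))) \<longlonglongrightarrow> expectation (\<lambda>_. 0 :: real)"
  proof (rule integral_dominated_convergence[where w = "\<lambda>_. 1"])
    show "AE \<omega> in M. (\<lambda>n. indicator (?B n) \<omega> :: real) \<longlonglongrightarrow> 0"
    proof (rule AE_I2)
      fix \<omega> assume \<omega>: "\<omega> \<in> space M"
      have "eventually (\<lambda>n. indicator (?B n) \<omega> = (0::real)) sequentially"
        using grid_modulus[OF X_cont[OF \<omega>] tT \<eta>]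
      proof eventually_elim
        case (elim n)
        have "\<bar>X (grid t T n (Suc k)) \<omega> - X (grid t T n k) \<omega>\<bar> \<le> \<eta>" if "k < n" for k
          using elim that grid_mono[OF tT(2), of n k] by auto
        then show ?case by (force simp: indicator_def)
      qed
      then show "(\<lambda>n. indicator (?B n) \<omega> :: real) \<longlonglongrightarrow> 0" by (rule tendsto_eventually)
    qed
    show "indicator (?B n) \<in> borel_measurable M" for n using B by (rule borel_measurable_indicator)
    show "AE \<omega> in M. norm (indicator (?B n) \<omega> :: real) \<le> 1" for n
      by (rule AE_I2) (simp only: real_norm_def indicator_abs_le_1)
  qed simp_all
  have ind: "expectation (indicator A) = prob A" if "A \<in> sets M" for A
    using that by simp
  show ?thesis using lim unfolding ind[OF B] integral_zero .
qed

abbreviation riemann_sum :: "real \<Rightarrow> real \<Rightarrow> real \<Rightarrow> nat \<Rightarrow> 'a \<Rightarrow> real" where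
  "riemann_sum t T \<eta> n \<omega> \<equiv> \<Sum>k<n. 2 * (max 0 (X (grid t T n k) \<omega>) * drift (grid t T n k) (grid t T n (Suc k)) \<omega>)
     - (cutoff \<eta> (X (grid t T n k) \<omega>))\<^sup>2 * bracket (grid t T n k) (grid t T n (Suc k)) \<omega>"

lemma riemann_sum_integrable:
  assumes "0 \<le> t" "t \<le> T" "0 < \<eta>"
  shows "integrable M (riemann_sum t T \<eta> n)"
proof (rule Bochner_Integration.integrable_sum)
  fix k assume k: "k \<in> {..<n}"
  show "integrable M (\<lambda>\<omega>. 2 * (max 0 (X (grid t T n k) \<omega>) * drift (grid t T n k) (grid t T n (Suc k)) \<omega>)
     - (cutoff \<eta> (X (grid t T n k) \<omega>))\<^sup>2 * bracket (grid t T n k) (grid t T n (Suc k)) \<omega>)"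
    \<comment> \<open>Any simple list, event and weight will do for integrability; the empty list,
      the whole space and 1 meet the assumptions trivially.\<close>
    using k assms grid_range[OF assms(2), of k n]
    by (intro one_step(3)[where l = "[]" and B = "space M" and \<epsilon> = 1] grid_mono) auto
qed

lemma integrand_bound:
  assumes \<omega>: "regular \<omega>" and \<eta>: "0 < \<eta>" and t: "0 \<le> t"
  shows "AE u in lborel. t < u \<longrightarrow>
     2 * (max 0 (X u \<omega>) * g0 \<omega> u) - (cutoff \<eta> (X u \<omega>))\<^sup>2 * Z \<omega> u \<le> lipschitz_density t \<omega> u + cutoff_density \<eta> \<omega> u"
proof -
  have "AE s in lborel. 0 \<le> s \<longrightarrow> 0 < X s \<omega> \<longrightarrow> g s \<omega> \<le> \<kappa> s \<omega> + \<delta> s * norm (\<zeta> s \<omega>)"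
    using \<omega> by blast
  then show ?thesis
  proof eventually_elim
    case (elim u)
    show ?case
    proof
      assume u: "t < u"
      then have u0: "0 < u" using t by simp
      then have Xe: "Xe u \<omega> = X u \<omega>" by (simp add: Xe_def)
      show "2 * (max 0 (X u \<omega>) * g0 \<omega> u) - (cutoff \<eta> (X u \<omega>))\<^sup>2 * Z \<omega> u \<le> lipschitz_density t \<omega> u + cutoff_density \<eta> \<omega> u"
      proof (cases "0 < X u \<omega>")
        case True
        let ?x = "X u \<omega>" and ?z = "norm (\<zeta> u \<omega>)"
        have "?x * g u \<omega> \<le> ?x * (\<kappa> u \<omega> + \<delta> u * ?z)"
          using elim u0 True by (intro mult_left_mono) auto
        \<comment> \<open>This spends all of \<open>?z\<^sup>2\<close>, although only the fraction
          \<open>(cutoff \<eta> ?x)\<^sup>2\<close> of it is available on the left; the difference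
          is \<open>cutoff_density\<close>.\<close>
        moreover have "2 * (?x * (\<delta> u * ?z)) \<le> (\<delta> u)\<^sup>2 * ?x\<^sup>2 + ?z\<^sup>2"
          using sum_squares_bound[of "\<delta> u * ?x" ?z] by (simp add: power_mult_distrib algebra_simps)
        ultimately have "2 * (?x * g u \<omega>) \<le> 2 * (?x * \<kappa> u \<omega>) + (\<delta> u)\<^sup>2 * ?x\<^sup>2 + ?z\<^sup>2"
          by (simp add: algebra_simps)
        then show ?thesis using True u u0 by (simp add: lipschitz_density_def cutoff_density_def Xe algebra_simps)
      next
        case False
        then have "cutoff \<eta> (X u \<omega>) = 0" using \<eta> by (intro cutoff_eq_0) auto
        then show ?thesis using False u u0 by (simp add: lipschitz_density_def cutoff_density_def Xe)
      qed
    qed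
  qed
qed

text \<open>On each step the values at the left grid point are replaced by those at
  \<open>u\<close>, at a price \<open>e\<close> by uniform continuity, and then
  \<open>integrand_bound\<close> applies under the integral. The result is one-sided because the
  drift estimate is.\<close>

lemma riemann_sum_eventually_le:
  assumes tT: "0 \<le> t" "t \<le> T" and \<eta>: "0 < \<eta>" and \<omega>: "regular \<omega>" and e: "0 < e"
  shows "eventually (\<lambda>n. riemann_sum t T \<eta> n \<omega> \<le> lipschitz_term t \<omega> + cutoff_defect \<eta> \<omega> + e * (2 * (LINT u|lborel. \<bar>g0 \<omega> u\<bar>) + (LINT u|lborel. Z \<omega> u))) sequentially"
proof -
  have \<omega>M: "\<omega> \<in> space M" and g: "integrable lborel (g0 \<omega>)" and z: "integrable lborel (Z \<omega>)" using \<omega> by auto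
  have ga: "integrable lborel (\<lambda>u. \<bar>g0 \<omega> u\<bar>)" using g by (rule integrable_abs)
  note Xc = X_cont[OF \<omega>M]
  have c1: "continuous_on {0..} (\<lambda>s. max 0 (X s \<omega>))" by (intro continuous_intros Xc)
  have c2: "continuous_on {0..} (\<lambda>s. (cutoff \<eta> (X s \<omega>))\<^sup>2)"
    by (intro continuous_intros continuous_on_compose2[OF cutoff_continuous Xc, of UNIV]) auto
  let ?w = "\<lambda>u. lipschitz_density t \<omega> u + cutoff_density \<eta> \<omega> u + e * (2 * \<bar>g0 \<omega> u\<bar> + Z \<omega> u)"
  have wi: "integrable lborel ?w"
    using lipschitz_density_integrable[OF \<omega>M tT(1)] cutoff_density_integrable[OF \<omega>M \<eta> z] ga z by simp
  have w0: "0 \<le> ?w u" for u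
    using lipschitz_density_bounds(1)[OF \<omega>M tT(1), of u] cutoff_density_bounds(1)[OF \<eta>, of \<omega> u] e by (intro add_nonneg_nonneg mult_nonneg_nonneg) auto
  show ?thesis
    using grid_modulus[OF c1 tT e] grid_modulus[OF c2 tT e]
  proof eventually_elim
    case (elim n)
    have "riemann_sum t T \<eta> n \<omega> \<le> (\<Sum>k<n. LINT u|lborel. indicator {grid t T n k<..grid t T n (Suc k)} u * ?w u)"
    proof (rule sum_mono)
      fix k assume k: "k \<in> {..<n}"
      let ?a = "grid t T n k" and ?b = "grid t T n (Suc k)"
      have ab: "0 \<le> ?a" "?a \<le> ?b" "t \<le> ?a" using grid_range[OF tT(2), of k n] grid_mono[OF tT(2)] tT k by auto
      let ?x = "max 0 (X ?a \<omega>)" and ?c = "(cutoff \<eta> (X ?a \<omega>))\<^sup>2"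
      have "2 * (?x * drift ?a ?b \<omega>) - ?c * bracket ?a ?b \<omega>
        = 2 * ?x * (LINT u|lborel. indicator {?a<..?b} u * g0 \<omega> u) - ?c * (LINT u|lborel. indicator {?a<..?b} u * Z \<omega> u)"
        using drift_eq(1)[OF _ g ab(1,2)] \<omega> by (simp add: bracket_def)
      also have "\<dots> = (LINT u|lborel. 2 * ?x * (indicator {?a<..?b} u * g0 \<omega> u) - ?c * (indicator {?a<..?b} u * Z \<omega> u))"
        using integrable_indicator_times[OF g] integrable_indicator_times[OF z] by simp
      also have "\<dots> \<le> (LINT u|lborel. indicator {?a<..?b} u * ?w u)"
      proof (rule integral_mono_AE)
        show "integrable lborel (\<lambda>u. 2 * ?x * (indicator {?a<..?b} u * g0 \<omega> u) - ?c * (indicator {?a<..?b} u * Z \<omega> u))"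
          using integrable_indicator_times[OF g] integrable_indicator_times[OF z] by simp
        show "integrable lborel (\<lambda>u. indicator {?a<..?b} u * ?w u)" by (rule integrable_indicator_times[OF wi]) simp
        show "AE u in lborel. 2 * ?x * (indicator {?a<..?b} u * g0 \<omega> u) - ?c * (indicator {?a<..?b} u * Z \<omega> u) \<le> indicator {?a<..?b} u * ?w u"
          using integrand_bound[OF \<omega> \<eta> tT(1)]
        proof eventually_elim
          case b: (elim u)
          show ?case
          proof (cases "u \<in> {?a<..?b}")
            case True
            let ?xu = "max 0 (X u \<omega>)" and ?cu = "(cutoff \<eta> (X u \<omega>))\<^sup>2"
            have m: "\<bar>?xu - ?x\<bar> \<le> e" "\<bar>?cu - ?c\<bar> \<le> e" using elim k True by auto
            have "(?x - ?xu) * g0 \<omega> u \<le> \<bar>(?x - ?xu) * g0 \<omega> u\<bar>" by simp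
            also have "\<dots> \<le> e * \<bar>g0 \<omega> u\<bar>" unfolding abs_mult[of "?x - ?xu"] using m(1) by (intro mult_right_mono) (auto simp: abs_minus_commute)
            finally have 1: "?x * g0 \<omega> u \<le> ?xu * g0 \<omega> u + e * \<bar>g0 \<omega> u\<bar>" by (simp only: left_diff_distrib)
            have "(?cu - ?c) * Z \<omega> u \<le> e * Z \<omega> u" using m(2) by (intro mult_right_mono) auto
            then have 2: "?cu * Z \<omega> u - e * Z \<omega> u \<le> ?c * Z \<omega> u" by (simp only: left_diff_distrib)
            have "2 * (?xu * g0 \<omega> u) - ?cu * Z \<omega> u \<le> lipschitz_density t \<omega> u + cutoff_density \<eta> \<omega> u" using b True ab by simp
            then have "2 * ?x * g0 \<omega> u - ?c * Z \<omega> u \<le> ?w u"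
              using 1 2 unfolding mult.assoc distrib_left by linarith
            then show ?thesis using True by simp
          qed simp
        qed
      qed
      finally show "2 * (?x * drift ?a ?b \<omega>) - ?c * bracket ?a ?b \<omega> \<le> (LINT u|lborel. indicator {?a<..?b} u * ?w u)" .
    qed
    also have "\<dots> = (LINT u|lborel. indicator {grid t T n 0<..grid t T n n} u * ?w u)"
      by (rule sum_window[where \<tau> = "grid t T n", OF wi grid_mono[OF tT(2)]])
    also have "\<dots> \<le> (LINT u|lborel. ?w u)"
      by (rule integral_indicator_times_le[OF wi w0]) simp
    also have "\<dots> = lipschitz_term t \<omega> + cutoff_defect \<eta> \<omega> + e * (2 * (LINT u|lborel. \<bar>g0 \<omega> u\<bar>) + (LINT u|lborel. Z \<omega> u))"
      using lipschitz_density_integrable[OF \<omega>M tT(1)] cutoff_density_integrable[OF \<omega>M \<eta> z] ga z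
      unfolding lipschitz_term_def cutoff_defect_def by simp
    finally show ?case .
  qed
qed

text \<open>A bound independent of the grid, integrable because \<open>S\<close> and
  \<open>\<Lambda>\<close> are square integrable: the majorant for dominated convergence.\<close>

lemma riemann_sum_abs_le:
  assumes tT: "0 \<le> t" "t \<le> T" and \<omega>: "regular \<omega>"
  shows "\<bar>riemann_sum t T \<eta> n \<omega>\<bar> \<le> 2 * (S \<omega> * \<Lambda> \<omega>) + total_bracket \<omega>"
proof -
  have \<omega>M: "\<omega> \<in> space M" and z: "integrable lborel (Z \<omega>)" using \<omega> by auto
  note gnn = grid_nonneg[OF tT]
  let ?d = "\<lambda>k. drift (grid t T n k) (grid t T n (Suc k)) \<omega>" and ?q = "\<lambda>k. bracket (grid t T n k) (grid t T n (Suc k)) \<omega>"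
  have q0: "0 \<le> ?q k" for k unfolding bracket_def by (intro integral_nonneg_AE) auto
  have "\<bar>riemann_sum t T \<eta> n \<omega>\<bar> \<le> (\<Sum>k<n. \<bar>2 * (max 0 (X (grid t T n k) \<omega>) * ?d k) - (cutoff \<eta> (X (grid t T n k) \<omega>))\<^sup>2 * ?q k\<bar>)"
    by (rule sum_abs)
  also have "\<dots> \<le> (\<Sum>k<n. 2 * (S \<omega> * \<bar>?d k\<bar>) + ?q k)"
  proof (rule sum_mono)
    fix k assume k: "k \<in> {..<n}"
    have "\<bar>X (grid t T n k) \<omega>\<bar> \<le> S \<omega>" using X_le[OF \<omega>M gnn] k by simp
    then have "\<bar>max 0 (X (grid t T n k) \<omega>)\<bar> \<le> S \<omega>" using S_nonneg[OF \<omega>M] by auto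
    then have 1: "\<bar>max 0 (X (grid t T n k) \<omega>) * ?d k\<bar> \<le> S \<omega> * \<bar>?d k\<bar>" unfolding abs_mult by (rule mult_right_mono) simp
    have "\<bar>(cutoff \<eta> (X (grid t T n k) \<omega>))\<^sup>2 * ?q k\<bar> \<le> 1 * ?q k"
      unfolding abs_mult using q0[of k] cutoff_sq_le_1 by (intro mult_mono) auto
    then show "\<bar>2 * (max 0 (X (grid t T n k) \<omega>) * ?d k) - (cutoff \<eta> (X (grid t T n k) \<omega>))\<^sup>2 * ?q k\<bar> \<le> 2 * (S \<omega> * \<bar>?d k\<bar>) + ?q k"
      using 1 by linarith
  qed
  also have "\<dots> = 2 * (S \<omega> * (\<Sum>k<n. \<bar>?d k\<bar>)) + (\<Sum>k<n. ?q k)" by (simp add: sum.distrib sum_distrib_left)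
  also have "\<dots> \<le> 2 * (S \<omega> * \<Lambda> \<omega>) + total_bracket \<omega>"
  proof (intro add_mono mult_left_mono S_nonneg \<omega>M)
    show "(\<Sum>k<n. \<bar>?d k\<bar>) \<le> \<Lambda> \<omega>" by (rule window_abs_sum[where \<tau> = "grid t T n", OF \<omega> gnn grid_mono[OF tT(2)]])
    show "(\<Sum>k<n. ?q k) \<le> total_bracket \<omega>"
      unfolding bracket_def total_bracket_def sum_window[where \<tau> = "grid t T n", OF z grid_mono[OF tT(2)]]
      by (rule integral_indicator_times_le[OF z]) simp_all
  qed simp_all
  finally show ?thesis .
qed

text \<open>Only an upper bound on the Riemann sums is known, so only their positive excess is shown
  to vanish. That suffices, as the mean of a difference is at most the mean of its positive
  part.\<close>

lemma riemann_sum_excess_tendsto: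
  assumes tT: "0 \<le> t" "t \<le> T" and \<eta>: "0 < \<eta>"
  shows "(\<lambda>n. expectation (\<lambda>\<omega>. max 0 (riemann_sum t T \<eta> n \<omega> - (lipschitz_term t \<omega> + cutoff_defect \<eta> \<omega>)))) \<longlonglongrightarrow> 0"
proof -
  let ?f = "\<lambda>n \<omega>. max 0 (riemann_sum t T \<eta> n \<omega> - (lipschitz_term t \<omega> + cutoff_defect \<eta> \<omega>))"
  have "(\<lambda>n. expectation (?f n)) \<longlonglongrightarrow> expectation (\<lambda>_. 0)"
  proof (rule integral_dominated_convergence[where w = "\<lambda>\<omega>. 2 * (S \<omega> * \<Lambda> \<omega>) + total_bracket \<omega>"])
    show "?f n \<in> borel_measurable M" for n
      using borel_measurable_integrable[OF riemann_sum_integrable[OF tT \<eta>, of n]] borel_measurable_integrable[OF lipschitz_term_integrable[OF tT(1)]]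
        borel_measurable_integrable[OF cutoff_defect_integrable(1)[OF \<eta>]] by (intro borel_measurable_max borel_measurable_diff borel_measurable_add) auto
    show "integrable M (\<lambda>\<omega>. 2 * (S \<omega> * \<Lambda> \<omega>) + total_bracket \<omega>)"
      using L2_mult_integrable[OF S_measurable \<Lambda>_measurable S_sq \<Lambda>_sq] total_bracket_integrable by simp
    show "AE \<omega> in M. (\<lambda>n. ?f n \<omega>) \<longlonglongrightarrow> 0"
      using AE_regular
    proof eventually_elim
      case (elim \<omega>)
      define K where "K = 2 * (LINT u|lborel. \<bar>g0 \<omega> u\<bar>) + (LINT u|lborel. Z \<omega> u)"
      have K: "0 \<le> K" unfolding K_def by (intro add_nonneg_nonneg mult_nonneg_nonneg integral_nonneg_AE) auto
      show ?case
      proof (rule LIMSEQ_I)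
        fix r :: real assume r: "0 < r"
        define e where "e = r / (K + 1)"
        have e: "0 < e" "e * K < r" using r K by (auto simp: e_def field_simps)
        from riemann_sum_eventually_le[OF tT \<eta> elim e(1), folded K_def]
        obtain N where N: "\<And>n. n \<ge> N \<Longrightarrow> riemann_sum t T \<eta> n \<omega> \<le> lipschitz_term t \<omega> + cutoff_defect \<eta> \<omega> + e * K"
          unfolding eventually_sequentially by blast
        show "\<exists>no. \<forall>n\<ge>no. norm (?f n \<omega> - 0) < r"
        proof (intro exI[of _ N] allI impI)
          fix n assume "n \<ge> N"
          from N[OF this] show "norm (?f n \<omega> - 0) < r" using e r by (simp add: max_def)
        qed
      qed
    qed
    show "AE \<omega> in M. norm (?f n \<omega>) \<le> 2 * (S \<omega> * \<Lambda> \<omega>) + total_bracket \<omega>" for n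
      using AE_regular cutoff_defect_integrable(2)[OF \<eta>]
    proof eventually_elim
      case (elim \<omega>)
      have "0 \<le> lipschitz_term t \<omega>" unfolding lipschitz_term_def using elim by (intro integral_nonneg_AE AE_I2 lipschitz_density_bounds tT) auto
      moreover have "norm (max 0 (x - (a + b))) \<le> K" if "\<bar>x\<bar> \<le> K" "0 \<le> a" "0 \<le> b" for x a b K :: real
        using that by auto
      ultimately show ?case using riemann_sum_abs_le[OF tT elim(1), where \<eta> = \<eta> and n = n] elim(2) by blast
    qed
  qed simp_all
  then show ?thesis by simp
qed

section \<open>Removing the grid, the cutoff and the horizon\<close>

text \<open>With the simple list, \<open>\<epsilon>\<close> and \<open>c\<close> fixed, the grid is
  refined first: the excess, the squared drifts and the probability of large oscillation disappear.
  What remains is then made small by the choice of these three.\<close>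

lemma ito_inequality_cutoff:
  assumes tT: "0 \<le> t" "t \<le> T" and \<eta>: "0 < \<eta>"
  shows "expectation (\<lambda>\<omega>. (max 0 (X t \<omega>))\<^sup>2) \<le> expectation (\<lambda>\<omega>. (max 0 (X T \<omega>))\<^sup>2) + expectation (lipschitz_term t) + expectation (cutoff_defect \<eta>)"
proof -
  let ?\<Delta> = "expectation (\<lambda>\<omega>. (max 0 (X t \<omega>))\<^sup>2) - expectation (\<lambda>\<omega>. (max 0 (X T \<omega>))\<^sup>2) - (expectation (lipschitz_term t) + expectation (cutoff_defect \<eta>))"
  have iV: "integrable M (\<lambda>\<omega>. lipschitz_term t \<omega> + cutoff_defect \<eta> \<omega>)" using lipschitz_term_integrable[OF tT(1)] cutoff_defect_integrable(1)[OF \<eta>] by simp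
  have tb: "0 \<le> expectation total_bracket" unfolding total_bracket_def[abs_def] by (intro integral_nonneg_AE AE_I2) auto
  have key: "?\<Delta> \<le> \<epsilon> * expectation total_bracket + 4 * expectation (total_err l) + 8 * (C * (T - t)) * c"
    if pos: "0 < \<epsilon>" "0 < c" and l: "simple l" and C: "\<And>s t B c. 0 \<le> s \<Longrightarrow> s \<le> t \<Longrightarrow> B \<in> sets M \<Longrightarrow> 0 < c \<Longrightarrow>
      expectation (\<lambda>\<omega>. (window l s t \<omega>)\<^sup>2 * indicator B \<omega>) \<le> C * ((t - s) * (2 * c + prob B / c))" for \<epsilon> c l C
  proof -
    let ?B = "\<lambda>n. {\<omega>\<in>space M. \<exists>k<n. \<bar>X (grid t T n (Suc k)) \<omega> - X (grid t T n k) \<omega>\<bar> > \<eta>}"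
    let ?r = "\<lambda>n. expectation (\<lambda>\<omega>. max 0 (riemann_sum t T \<eta> n \<omega> - (lipschitz_term t \<omega> + cutoff_defect \<eta> \<omega>)))
      + \<epsilon> * expectation total_bracket + (1/\<epsilon> + 2) * expectation (\<lambda>\<omega>. \<Sum>k<n. (drift (grid t T n k) (grid t T n (Suc k)) \<omega>)\<^sup>2)
      + 4 * expectation (total_err l) + 4 * (C * ((T - t) * (2 * c + prob (?B n) / c)))"
    have "?\<Delta> \<le> ?r n" if n: "n \<ge> 1" for n
    proof -
      have "expectation (riemann_sum t T \<eta> n) - (expectation (lipschitz_term t) + expectation (cutoff_defect \<eta>)) = expectation (\<lambda>\<omega>. riemann_sum t T \<eta> n \<omega> - (lipschitz_term t \<omega> + cutoff_defect \<eta> \<omega>))"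
        using riemann_sum_integrable[OF tT \<eta>, of n] iV lipschitz_term_integrable[OF tT(1)] cutoff_defect_integrable(1)[OF \<eta>] by simp
      also have "\<dots> \<le> expectation (\<lambda>\<omega>. max 0 (riemann_sum t T \<eta> n \<omega> - (lipschitz_term t \<omega> + cutoff_defect \<eta> \<omega>)))"
        using riemann_sum_integrable[OF tT \<eta>, of n] iV by (intro integral_mono) auto
      finally have "expectation (riemann_sum t T \<eta> n) - (expectation (lipschitz_term t) + expectation (cutoff_defect \<eta>))
        \<le> expectation (\<lambda>\<omega>. max 0 (riemann_sum t T \<eta> n \<omega> - (lipschitz_term t \<omega> + cutoff_defect \<eta> \<omega>)))" .
      moreover have "0 < n" using n by simp
      note discrete_ito[OF tT this l \<eta> pos C]
      ultimately show ?thesis by linarith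
    qed
    moreover have "?r \<longlonglongrightarrow> 0 + \<epsilon> * expectation total_bracket + (1/\<epsilon> + 2) * 0
      + 4 * expectation (total_err l) + 4 * (C * ((T - t) * (2 * c + 0 / c)))"
      by (intro tendsto_intros riemann_sum_excess_tendsto[OF tT \<eta>] drift_sq_sum_tendsto[OF tT] oscillation_prob_tendsto[OF tT \<eta>]) (use pos in auto)
    ultimately have "?\<Delta> \<le> 0 + \<epsilon> * expectation total_bracket + (1/\<epsilon> + 2) * 0
      + 4 * expectation (total_err l) + 4 * (C * ((T - t) * (2 * c + 0 / c)))"
      by (intro LIMSEQ_le_const) auto
    then show ?thesis by (simp add: algebra_simps)
  qed
  have "?\<Delta> \<le> 0 + e" if e: "0 < e" for e
  proof -
    \<comment> \<open>The error of \<open>l\<close> enters with the factor 4, so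
      \<open>e / 12\<close> uses up a third of \<open>e\<close>. Since \<open>C\<close> belongs to
      \<open>l\<close>, the weight \<open>c\<close> is chosen only after both.\<close>
    obtain l where l: "simple l" "expectation (total_err l) < e / 12" using approximating_simple[of "e/12"] e by auto
    obtain C where C: "C \<ge> 0" "\<And>s t B c. 0 \<le> s \<Longrightarrow> s \<le> t \<Longrightarrow> B \<in> sets M \<Longrightarrow> 0 < c \<Longrightarrow>
      expectation (\<lambda>\<omega>. (window l s t \<omega>)\<^sup>2 * indicator B \<omega>) \<le> C * ((t - s) * (2 * c + prob B / c))"
      using window_bound[OF l(1)] by blast
    \<comment> \<open>The added 1 in the denominator covers \<open>a = 0\<close>.\<close>
    have ex: "\<exists>x>0. a * x \<le> e / 3" if "0 \<le> a" for a :: real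
      using e that by (intro exI[of _ "e / (3 * (a + 1))"]) (auto simp: field_simps)
    obtain \<epsilon> where \<epsilon>: "0 < \<epsilon>" "\<epsilon> * expectation total_bracket \<le> e / 3"
      using ex[OF tb] by (auto simp: mult.commute)
    obtain c where c: "0 < c" "8 * (C * (T - t)) * c \<le> e / 3" using ex[of "8 * (C * (T - t))"] C(1) tT by auto
    show ?thesis using key[OF \<epsilon>(1) c(1) l(1) C(2)] \<epsilon>(2) c(2) l(2) by linarith
  qed
  then have "?\<Delta> \<le> 0" by (rule field_le_epsilon)
  then show ?thesis by simp
qed

text \<open>The cutoff is 1 from \<open>2 * \<eta>\<close> on and 0 up to \<open>\<eta>\<close>, so
  at each point the density is eventually 0. At the value 0 of the process both terms vanish, since
  the indicator is that of the open half-line. The bracket dominates.\<close>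

lemma cutoff_defect_tendsto: "(\<lambda>n. expectation (cutoff_defect (1 / real (Suc n)))) \<longlonglongrightarrow> 0"
proof -
  have "(\<lambda>n. expectation (cutoff_defect (1 / real (Suc n)))) \<longlonglongrightarrow> expectation (\<lambda>_. 0)"
  proof (rule integral_dominated_convergence[OF _ _ total_bracket_integrable])
    show "cutoff_defect (1 / real (Suc n)) \<in> borel_measurable M" for n
      by (rule borel_measurable_integrable[OF cutoff_defect_integrable(1)]) simp
    show "AE \<omega> in M. norm (cutoff_defect (1 / real (Suc n)) \<omega>) \<le> total_bracket \<omega>" for n
    proof -
      have "0 < 1 / real (Suc n)" by simp
      from cutoff_defect_integrable(2)[OF this] show ?thesis by eventually_elim auto
    qed
    show "AE \<omega> in M. (\<lambda>n. cutoff_defect (1 / real (Suc n)) \<omega>) \<longlonglongrightarrow> 0"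
      using AE_regular
    proof eventually_elim
      case (elim \<omega>)
      then have \<omega>M: "\<omega> \<in> space M" and z: "integrable lborel (Z \<omega>)" by auto
      have "(\<lambda>n. LINT u|lborel. cutoff_density (1 / real (Suc n)) \<omega> u) \<longlonglongrightarrow> (LINT (u::real)|lborel. 0)"
      proof (rule integral_dominated_convergence[OF _ _ z])
        show "cutoff_density (1 / real (Suc n)) \<omega> \<in> borel_measurable lborel" for n
          using cutoff_density_measurable \<omega>M by (rule section_measurable)
        show "AE u in lborel. norm (cutoff_density (1 / real (Suc n)) \<omega> u) \<le> Z \<omega> u" for n
        proof (rule AE_I2)
          fix u
          show "norm (cutoff_density (1 / real (Suc n)) \<omega> u) \<le> Z \<omega> u"
            using cutoff_density_bounds[of "1 / real (Suc n)" \<omega> u] by simp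
        qed
        show "AE u in lborel. (\<lambda>n. cutoff_density (1 / real (Suc n)) \<omega> u) \<longlonglongrightarrow> 0"
        proof (rule AE_I2)
          fix u
          let ?x = "Xe u \<omega>"
          have "eventually (\<lambda>n. cutoff_density (1 / real (Suc n)) \<omega> u = 0) sequentially"
          proof (cases "0 < ?x")
            case True
            obtain N :: nat where N: "2 / ?x < real N" using reals_Archimedean2 by blast
            show ?thesis unfolding eventually_sequentially
            proof (intro exI[of _ N] allI impI)
              fix n assume "N \<le> n"
              then have "2 / ?x < real (Suc n)" using N by linarith
              then have "2 < real (Suc n) * ?x" using True by (simp add: pos_divide_less_eq)
              moreover have "(?x - 1 / m) / (1 / m) = m * ?x - 1" if "0 < m" for m :: real
                using that by (simp add: field_simps)
              from this[of "real (Suc n)"] have "(?x - 1 / real (Suc n)) / (1 / real (Suc n)) = real (Suc n) * ?x - 1" by simp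
              ultimately have "1 \<le> (?x - 1 / real (Suc n)) / (1 / real (Suc n))" by linarith
              then have "cutoff (1 / real (Suc n)) ?x = 1" by (simp add: cutoff_def)
              then show "cutoff_density (1 / real (Suc n)) \<omega> u = 0" using True by (simp add: cutoff_density_def)
            qed
          next
            case False
            then have "cutoff (1 / real (Suc n)) ?x = 0" for n
              by (intro cutoff_eq_0) (auto simp: not_less intro: order_trans)
            then show ?thesis using False by (simp add: cutoff_density_def)
          qed
          then show "(\<lambda>n. cutoff_density (1 / real (Suc n)) \<omega> u) \<longlonglongrightarrow> 0" by (rule tendsto_eventually)
        qed
      qed simp
      then show ?case by (simp add: cutoff_defect_def)
    qed
  qed simp
  then show ?thesis by simp
qed

lemma ito_inequality_finite:
  assumes tT: "0 \<le> t" "t \<le> T"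
  shows "expectation (\<lambda>\<omega>. (max 0 (X t \<omega>))\<^sup>2) \<le> expectation (\<lambda>\<omega>. (max 0 (X T \<omega>))\<^sup>2) + expectation (lipschitz_term t)"
proof -
  have "(\<lambda>n. expectation (\<lambda>\<omega>. (max 0 (X T \<omega>))\<^sup>2) + expectation (lipschitz_term t) + expectation (cutoff_defect (1 / real (Suc n))))
     \<longlonglongrightarrow> expectation (\<lambda>\<omega>. (max 0 (X T \<omega>))\<^sup>2) + expectation (lipschitz_term t) + 0"
    by (intro tendsto_add tendsto_const cutoff_defect_tendsto)
  then have "expectation (\<lambda>\<omega>. (max 0 (X t \<omega>))\<^sup>2) \<le> expectation (\<lambda>\<omega>. (max 0 (X T \<omega>))\<^sup>2) + expectation (lipschitz_term t) + 0"
    by (rule LIMSEQ_le_const) (use ito_inequality_cutoff[OF tT] in auto)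
  then show ?thesis by simp
qed

text \<open>By the equation, \<open>X + J\<close> at time \<open>n\<close> is the nonpositive
  terminal value plus a tail of the drift, so its positive part is bounded by the tail of the
  absolute drift. The remaining \<open>J\<close> at time \<open>n\<close> tends to 0 in L2 by the
  isometry.\<close>

lemma terminal_tendsto: "(\<lambda>n. expectation (\<lambda>\<omega>. (max 0 (X (real n) \<omega>))\<^sup>2)) \<longlonglongrightarrow> 0"
proof -
  let ?p = "\<lambda>n \<omega>. (max 0 (X (real n) \<omega> + J (real n) \<omega>))\<^sup>2"
  have pm: "?p n \<in> borel_measurable M" for n
    by (intro borel_measurable_power borel_measurable_max borel_measurable_add X_measurable J_measurable) auto
  have pb: "?p n \<omega> \<le> (LINT u|lborel. indicator {real n..} u * \<bar>g0 \<omega> u\<bar>)\<^sup>2" "?p n \<omega> \<le> (\<Lambda> \<omega>)\<^sup>2" if \<omega>: "regular \<omega>" for n \<omega>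
  proof -
    have g: "integrable lborel (\<lambda>u. \<bar>g0 \<omega> u\<bar>)" using \<omega> by auto
    have "X (real n) \<omega> + J (real n) \<omega> = \<xi> \<omega> + (LINT s:{real n..}|lborel. g s \<omega>)" using \<omega> by simp
    also have "(LINT s:{real n..}|lborel. g s \<omega>) = (LINT u|lborel. indicator {real n..} u * g0 \<omega> u)"
      unfolding set_lebesgue_integral_def by (intro Bochner_Integration.integral_cong) (auto simp: indicator_def)
    also have "\<xi> \<omega> + (LINT u|lborel. indicator {real n..} u * g0 \<omega> u) \<le> \<bar>LINT u|lborel. indicator {real n..} u * g0 \<omega> u\<bar>" using \<omega> by auto
    also have "\<dots> \<le> (LINT u|lborel. \<bar>indicator {real n..} u * g0 \<omega> u\<bar>)" by (rule integral_abs_bound)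
    also have "\<dots> = (LINT u|lborel. indicator {real n..} u * \<bar>g0 \<omega> u\<bar>)" by (simp add: abs_mult)
    finally have 1: "X (real n) \<omega> + J (real n) \<omega> \<le> (LINT u|lborel. indicator {real n..} u * \<bar>g0 \<omega> u\<bar>)" .
    have 2: "0 \<le> (LINT u|lborel. indicator {real n..} u * \<bar>g0 \<omega> u\<bar>)" by (intro integral_nonneg_AE) auto
    have "(LINT u|lborel. indicator {real n..} u * \<bar>g0 \<omega> u\<bar>) \<le> (LINT u|lborel. \<bar>g0 \<omega> u\<bar>)"
      by (rule integral_indicator_times_le[OF g]) simp_all
    also have "\<dots> \<le> \<Lambda> \<omega>" using \<omega> by blast
    finally have 3: "(LINT u|lborel. indicator {real n..} u * \<bar>g0 \<omega> u\<bar>) \<le> \<Lambda> \<omega>" .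
    show "?p n \<omega> \<le> (LINT u|lborel. indicator {real n..} u * \<bar>g0 \<omega> u\<bar>)\<^sup>2" using 1 2 by (intro power_mono) auto
    show "?p n \<omega> \<le> (\<Lambda> \<omega>)\<^sup>2" using 1 2 3 by (intro power_mono max.boundedI order_trans[OF 1 3] order_trans[OF 2 3]) auto
  qed
  have P: "(\<lambda>n. expectation (?p n)) \<longlonglongrightarrow> expectation (\<lambda>_. 0)"
  proof (rule integral_dominated_convergence[OF _ pm \<Lambda>_sq])
    show "AE \<omega> in M. norm (?p n \<omega>) \<le> (\<Lambda> \<omega>)\<^sup>2" for n
      using AE_regular by eventually_elim (use pb(2) in auto)
    show "AE \<omega> in M. (\<lambda>n. ?p n \<omega>) \<longlonglongrightarrow> 0"
      using AE_regular
    proof eventually_elim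
      case (elim \<omega>)
      then have g: "integrable lborel (\<lambda>u. \<bar>g0 \<omega> u\<bar>)" by auto
      have "(\<lambda>n. (LINT u|lborel. indicator {real n..} u * \<bar>g0 \<omega> u\<bar>)\<^sup>2) \<longlonglongrightarrow> 0\<^sup>2"
        by (intro tendsto_power tail_tendsto_0(1) g)
      then show ?case
        by (intro tendsto_sandwich[of "\<lambda>_. 0" "\<lambda>n. ?p n \<omega>" sequentially "\<lambda>n. (LINT u|lborel. indicator {real n..} u * \<bar>g0 \<omega> u\<bar>)\<^sup>2" 0])
          (use pb(1)[OF elim] in auto)
    qed
  qed simp
  have Jq: "(\<lambda>n. expectation (\<lambda>\<omega>. (J (real n) \<omega>)\<^sup>2)) \<longlonglongrightarrow> expectation (\<lambda>_. 0)"
  proof -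
    let ?q = "\<lambda>n \<omega>. LINT u|lborel. indicator {real n<..} u * Z \<omega> u"
    have eq: "(LINT u|lborel. (norm (indicator {real n<..} u *\<^sub>R \<zeta> u \<omega>))\<^sup>2) = ?q n \<omega>" for n \<omega>
      by (intro Bochner_Integration.integral_cong) (auto simp: indicator_def)
    have E: "expectation (\<lambda>\<omega>. (J (real n) \<omega>)\<^sup>2) = expectation (?q n)" "integrable M (?q n)" for n
      using ito_isometry_real(2,3)[OF J_ito[of "real n"]] unfolding eq by auto
    show ?thesis unfolding E(1)
    proof (rule integral_dominated_convergence[OF _ borel_measurable_integrable[OF E(2)] total_bracket_integrable])
      show "AE \<omega> in M. (\<lambda>n. ?q n \<omega>) \<longlonglongrightarrow> 0"
        using zeta_sq_integrable by eventually_elim (rule tail_tendsto_0(2))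
      show "AE \<omega> in M. norm (?q n \<omega>) \<le> total_bracket \<omega>" for n
        using zeta_sq_integrable
      proof eventually_elim
        case (elim \<omega>)
        have "?q n \<omega> \<le> (LINT u|lborel. Z \<omega> u)"
          by (rule integral_indicator_times_le[OF elim]) simp_all
        moreover have "0 \<le> ?q n \<omega>" by (intro integral_nonneg_AE) auto
        ultimately show ?case by (simp add: total_bracket_def)
      qed
    qed simp
  qed
  have le: "expectation (\<lambda>\<omega>. (max 0 (X (real n) \<omega>))\<^sup>2) \<le> 2 * expectation (?p n) + 2 * expectation (\<lambda>\<omega>. (J (real n) \<omega>)\<^sup>2)" for n
  proof -
    have pi: "integrable M (?p n)"
    proof (rule Bochner_Integration.integrable_bound[OF \<Lambda>_sq pm])
      show "AE \<omega> in M. norm (?p n \<omega>) \<le> norm ((\<Lambda> \<omega>)\<^sup>2)"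
        using AE_regular by eventually_elim (use pb(2) in auto)
    qed
    have Ji: "integrable M (\<lambda>\<omega>. (J (real n) \<omega>)\<^sup>2)" by (rule J_sq) simp
    have "expectation (\<lambda>\<omega>. (max 0 (X (real n) \<omega>))\<^sup>2) \<le> expectation (\<lambda>\<omega>. 2 * ?p n \<omega> + 2 * (J (real n) \<omega>)\<^sup>2)"
    proof (rule integral_mono)
      show "integrable M (\<lambda>\<omega>. (max 0 (X (real n) \<omega>))\<^sup>2)"
        by (rule L2_bound_integrable[OF borel_measurable_max X_sq[of "real n"]]) (auto intro: X_measurable)
      show "integrable M (\<lambda>\<omega>. 2 * ?p n \<omega> + 2 * (J (real n) \<omega>)\<^sup>2)" using pi Ji by simp
      fix \<omega>
      let ?a = "max 0 (X (real n) \<omega> + J (real n) \<omega>)" and ?b = "\<bar>J (real n) \<omega>\<bar>"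
      have "max 0 (X (real n) \<omega>) \<le> ?a + ?b" by auto
      then have "(max 0 (X (real n) \<omega>))\<^sup>2 \<le> (?a + ?b)\<^sup>2" by (rule power_mono) simp
      also have "\<dots> \<le> 2 * ?a\<^sup>2 + 2 * ?b\<^sup>2" by (rule sq_add_le)
      finally show "(max 0 (X (real n) \<omega>))\<^sup>2 \<le> 2 * ?p n \<omega> + 2 * (J (real n) \<omega>)\<^sup>2" by simp
    qed
    then show ?thesis using pi Ji by simp
  qed
  have lim: "(\<lambda>n. 2 * expectation (?p n) + 2 * expectation (\<lambda>\<omega>. (J (real n) \<omega>)\<^sup>2)) \<longlonglongrightarrow> 2 * 0 + 2 * 0"
    using P Jq by (intro tendsto_intros) (simp_all only: integral_zero)
  show ?thesis
  proof (rule tendsto_sandwich)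
    show "\<forall>\<^sub>F n in sequentially. 0 \<le> expectation (\<lambda>\<omega>. (max 0 (X (real n) \<omega>))\<^sup>2)"
      by (intro always_eventually allI integral_nonneg_AE AE_I2) (rule zero_le_power2)
    show "\<forall>\<^sub>F n in sequentially. expectation (\<lambda>\<omega>. (max 0 (X (real n) \<omega>))\<^sup>2) \<le> 2 * expectation (?p n) + 2 * expectation (\<lambda>\<omega>. (J (real n) \<omega>)\<^sup>2)"
      by (intro always_eventually allI le)
    show "(\<lambda>n. 2 * expectation (?p n) + 2 * expectation (\<lambda>\<omega>. (J (real n) \<omega>)\<^sup>2)) \<longlonglongrightarrow> 0"
      using lim by (simp only: mult_zero_right add_0_right)
  qed (rule tendsto_const)
qed

lemma ito_inequality:
  assumes t: "0 \<le> t"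
  shows "expectation (\<lambda>\<omega>. (max 0 (X t \<omega>))\<^sup>2) \<le> expectation (lipschitz_term t)"
proof -
  have "(\<lambda>n. expectation (\<lambda>\<omega>. (max 0 (X (real n) \<omega>))\<^sup>2) + expectation (lipschitz_term t)) \<longlonglongrightarrow> 0 + expectation (lipschitz_term t)"
    by (intro tendsto_add tendsto_const terminal_tendsto)
  moreover obtain N :: nat where N: "t \<le> real N" using real_arch_simple by blast
  then have "expectation (\<lambda>\<omega>. (max 0 (X t \<omega>))\<^sup>2) \<le> expectation (\<lambda>\<omega>. (max 0 (X (real n) \<omega>))\<^sup>2) + expectation (lipschitz_term t)" if "n \<ge> N" for n
    using that by (intro ito_inequality_finite t) (simp add: order_trans)
  ultimately have "expectation (\<lambda>\<omega>. (max 0 (X t \<omega>))\<^sup>2) \<le> 0 + expectation (lipschitz_term t)"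
    by (intro LIMSEQ_le_const) auto
  then show ?thesis by simp
qed

end

section \<open>Properties of solutions\<close>

text \<open>The conditions on the coefficients hold for almost all pairs of time and path, while the
  estimates are made along one path at a time.\<close>

lemma (in sigma_finite_measure) AE_pair_swapped:
  assumes "AE x in lborel \<Otimes>\<^sub>M M. P x"
  shows "AE \<omega> in M. AE t in (lborel :: real measure). P (t, \<omega>)"
proof -
  interpret L: pair_sigma_finite "lborel :: real measure" M ..
  have "AE x in distr (M \<Otimes>\<^sub>M lborel) (lborel \<Otimes>\<^sub>M M) (\<lambda>(x, y). (y, x)). P x"
    using assms unfolding L.distr_pair_swap[symmetric] .
  then have "AE x in M \<Otimes>\<^sub>M lborel. P (case x of (x, y) \<Rightarrow> (y, x))"
    by (rule AE_distrD[rotated]) (rule measurable_pair_swap')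
  then have "AE x in M \<Otimes>\<^sub>M lborel. P (snd x, fst x)" by (simp add: case_prod_beta)
  interpret R: pair_sigma_finite M "lborel :: real measure" ..
  from R.AE_pair[OF \<open>AE x in M \<Otimes>\<^sub>M lborel. P (snd x, fst x)\<close>] show ?thesis by simp
qed

context brownian begin

text \<open>The supremum over all times may fail to be measurable. The supremum over rational times
  is measurable, its integral is at most the one in \<open>S2_space\<close> by monotonicity, and on
  continuous paths it bounds all times.\<close>

lemma S2_dominated:
  fixes v :: "real \<Rightarrow> 'a \<Rightarrow> 'b::euclidean_space"
  assumes v: "v \<in> S2_space M W" and c: "AE \<omega> in M. continuous_on {0..} (\<lambda>t. v t \<omega>)"
  obtains s where "s \<in> borel_measurable M" "integrable M (\<lambda>\<omega>. (s \<omega>)\<^sup>2)" "\<And>\<omega>. 0 \<le> s \<omega>"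
    "AE \<omega> in M. \<forall>t\<ge>0. norm (v t \<omega>) \<le> s \<omega>"
proof -
  define Y where "Y \<omega> = (SUP q\<in>\<rat> \<inter> {0..}. ennreal ((norm (v q \<omega>))\<^sup>2))" for \<omega>
  have vm: "v t \<in> borel_measurable M" if "0 \<le> t" for t
    using v that F_measurable by (auto simp: S2_space_def adapted_process_def)
  have Ym: "Y \<in> borel_measurable M" unfolding Y_def[abs_def]
  proof (rule borel_measurable_SUP)
    show "countable (\<rat> \<inter> {0::real..})" using countable_rat by blast
    show "(\<lambda>\<omega>. ennreal ((norm (v q \<omega>))\<^sup>2)) \<in> borel_measurable M" if "q \<in> \<rat> \<inter> {0..}" for q
      using vm[of q] that by simp
  qed
  have Yf: "(\<integral>\<^sup>+\<omega>. Y \<omega> \<partial>M) < \<infinity>"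
  proof -
    have "(\<integral>\<^sup>+\<omega>. Y \<omega> \<partial>M) \<le> (\<integral>\<^sup>+\<omega>. (SUP t\<in>{0..}. ennreal ((norm (v t \<omega>))\<^sup>2)) \<partial>M)"
      unfolding Y_def by (intro nn_integral_mono SUP_subset_mono) auto
    also have "\<dots> < \<infinity>" using v by (simp add: S2_space_def)
    finally show ?thesis .
  qed
  then have AEY: "AE \<omega> in M. Y \<omega> \<noteq> \<infinity>" by (intro nn_integral_PInf_AE Ym) auto
  show ?thesis
  proof (rule that[of "\<lambda>\<omega>. sqrt (enn2real (Y \<omega>))"])
    show "(\<lambda>\<omega>. sqrt (enn2real (Y \<omega>))) \<in> borel_measurable M" using Ym by measurable
    have "integrable M (\<lambda>\<omega>. enn2real (Y \<omega>))"
    proof (rule integrableI_nonneg)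
      have "(\<integral>\<^sup>+\<omega>. ennreal (enn2real (Y \<omega>)) \<partial>M) \<le> (\<integral>\<^sup>+\<omega>. Y \<omega> \<partial>M)"
        by (intro nn_integral_mono) (simp add: ennreal_enn2real_if)
      then show "(\<integral>\<^sup>+\<omega>. ennreal (enn2real (Y \<omega>)) \<partial>M) < \<infinity>" using Yf by (rule order_le_less_trans)
    qed (use Ym in auto)
    then show "integrable M (\<lambda>\<omega>. (sqrt (enn2real (Y \<omega>)))\<^sup>2)" by simp
    show "AE \<omega> in M. \<forall>t\<ge>0. norm (v t \<omega>) \<le> sqrt (enn2real (Y \<omega>))"
      using AEY c
    proof eventually_elim
      case (elim \<omega>)
      have "(norm (v t \<omega>))\<^sup>2 - enn2real (Y \<omega>) \<le> 0" if "0 \<le> t" for t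
      proof (rule nonpos_if_nonpos_on_rationals[OF _ _ that])
        show "continuous_on {0..} (\<lambda>t. (norm (v t \<omega>))\<^sup>2 - enn2real (Y \<omega>))"
          by (intro continuous_intros elim)
        fix q :: real assume "q \<in> \<rat>" "0 \<le> q"
        then have "ennreal ((norm (v q \<omega>))\<^sup>2) \<le> Y \<omega>" unfolding Y_def by (intro SUP_upper) auto
        also have "Y \<omega> = ennreal (enn2real (Y \<omega>))" using elim(1) by (simp add: ennreal_enn2real_if)
        finally show "(norm (v q \<omega>))\<^sup>2 - enn2real (Y \<omega>) \<le> 0" by simp
      qed
      then show ?case by (auto intro: real_le_rsqrt)
    qed
  qed simp
qed

text \<open>Clamping at 0 extends the process to all real times from the nonnegative ones, where its
  measurability is given.\<close>

lemma H2_joint_measurable: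
  fixes z :: "real \<Rightarrow> 'a \<Rightarrow> 'b::euclidean_space"
  assumes z: "z \<in> H2_space M W"
  shows "(\<lambda>x. z (max 0 (snd x)) (fst x)) \<in> borel_measurable (M \<Otimes>\<^sub>M lborel)"
proof -
  have m: "(\<lambda>(t, \<omega>). z t \<omega>) \<in> borel_measurable (restrict_space borel {0..} \<Otimes>\<^sub>M M)"
    using z by (simp add: H2_space_def)
  have "(\<lambda>x. (max 0 (snd x), fst x)) \<in> measurable (M \<Otimes>\<^sub>M (lborel::real measure)) (restrict_space borel {0..} \<Otimes>\<^sub>M M)"
    by (intro measurable_Pair measurable_restrict_space2) auto
  from measurable_compose[OF this m] show ?thesis by simp
qed

section \<open>Rows of matrix-valued integrals as scalar integrals\<close>

definition coords :: "'d list" where "coords = (SOME l. set l = UNIV \<and> distinct l)"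

lemma coords: "set coords = UNIV" "distinct coords"
proof -
  have "\<exists>l::'d list. set l = UNIV \<and> distinct l" using finite_distinct_list[of "UNIV :: 'd set"] by simp
  from someI_ex[OF this] show "set coords = UNIV" "distinct coords" unfolding coords_def by auto
qed

definition block :: "real \<Rightarrow> real \<Rightarrow> ('a \<Rightarrow> real^'d) \<Rightarrow> ('a, 'd) elem list" where
  "block a b h = map (\<lambda>c. (a, b, c, \<lambda>\<omega>. h \<omega> $ c)) coords"

lemma iint_block: "iint (block a b h) \<omega> = h \<omega> \<bullet> (W b \<omega> - W a \<omega>)"
proof -
  have "iint (block a b h) \<omega> = (\<Sum>c\<leftarrow>coords. h \<omega> $ c * inc c a b \<omega>)"
    unfolding iint_def block_def map_map comp_def elem_int_def prod.case ..
  also have "\<dots> = (\<Sum>c\<in>UNIV. h \<omega> $ c * inc c a b \<omega>)"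
    using sum_list_distinct_conv_sum_set[OF coords(2)] coords(1) by simp
  finally show ?thesis by (simp only: inner_vec_def inner_real_def)
qed

lemma sproc_block: "sproc (block a b h) s \<omega> = indicator {a<..b} s *\<^sub>R h \<omega>"
proof -
  have "sproc (block a b h) s \<omega> = (\<Sum>c\<leftarrow>coords. axis c (indicator {a<..b} s * h \<omega> $ c))"
    unfolding sproc_def block_def map_map comp_def elem_proc_def prod.case ..
  also have "\<dots> = (\<Sum>c\<in>UNIV. axis c (indicator {a<..b} s * h \<omega> $ c))"
    using sum_list_distinct_conv_sum_set[OF coords(2)] coords(1) by simp
  finally show ?thesis by (simp add: vec_eq_iff axis_def if_distrib cong: if_cong)
qed

lemma simple_block:
  assumes "0 \<le> a" "a \<le> b" "h \<in> borel_measurable (F a)" "\<And>\<omega>. \<omega> \<in> space M \<Longrightarrow> norm (h \<omega>) \<le> C"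
  shows "simple (block a b h)"
proof -
  have "\<bar>h \<omega> $ c\<bar> \<le> C" if "\<omega> \<in> space M" for c \<omega>
    using component_le_norm_cart[of "h \<omega>" c] assms(4)[OF that] by simp
  then show ?thesis unfolding simple_def block_def
    using assms by (auto simp: elem_ok_def intro!: measurable_compose[OF assms(3) borel_measurable_vec_nth])
qed

definition row_list :: "nat \<Rightarrow> (nat \<Rightarrow> real) \<Rightarrow> (nat \<Rightarrow> 'a \<Rightarrow> real ^ 'd ^ 'm) \<Rightarrow> 'm \<Rightarrow> ('a, 'd) elem list" where
  "row_list n \<tau> H j = concat (map (\<lambda>k. block (\<tau> k) (\<tau> (Suc k)) (\<lambda>\<omega>. H k \<omega> $ j)) [0..<n])"

lemma row_list_simps: "row_list 0 \<tau> H j = []" "row_list (Suc n) \<tau> H j = row_list n \<tau> H j @ block (\<tau> n) (\<tau> (Suc n)) (\<lambda>\<omega>. H n \<omega> $ j)"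
  by (simp_all add: row_list_def)

lemma iint_row_list: "iint (row_list n \<tau> H j) \<omega> = simple_ito_integral W n \<tau> H \<omega> $ j"
  by (induction n) (simp_all add: row_list_simps iint_block simple_ito_integral_def matrix_vector_mult_def inner_vec_def)

lemma sproc_row_list: "sproc (row_list n \<tau> H j) s \<omega> = simple_process n \<tau> H s \<omega> $ j"
  by (induction n) (simp_all add: row_list_simps sproc_block simple_process_def)

lemma simple_row_list:
  fixes H :: "nat \<Rightarrow> 'a \<Rightarrow> real^'d^'m"
  assumes "simple_integrand M W n \<tau> H"
  shows "simple (row_list n \<tau> H j)"
proof -
  have \<tau>: "0 \<le> \<tau> k" if "k \<le> n" for k
    using that
  proof (induction k)
    case 0
    show ?case using assms by (simp add: simple_integrand_def)
  next
    case (Suc k)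
    then have "\<tau> k \<le> \<tau> (Suc k)" using assms by (simp add: simple_integrand_def)
    then show ?case using Suc by simp
  qed
  have "simple (row_list k \<tau> H j)" if "k \<le> n" for k
    using that
  proof (induction k)
    case (Suc k)
    then have k: "k < n" by simp
    have H: "H k \<in> borel_measurable (F (\<tau> k))" using assms k by (simp add: simple_integrand_def)
    obtain C where C: "\<And>\<omega>. \<omega> \<in> space M \<Longrightarrow> norm (H k \<omega>) \<le> C" using assms k unfolding simple_integrand_def by blast
    have "simple (block (\<tau> k) (\<tau> (Suc k)) (\<lambda>\<omega>. H k \<omega> $ j))"
    proof (rule simple_block)
      show "0 \<le> \<tau> k" using \<tau> k by simp
      show "\<tau> k \<le> \<tau> (Suc k)" using assms k by (simp add: simple_integrand_def)
      have "(\<lambda>x::real^'d^'m. x $ j) \<in> borel_measurable borel"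
        by (intro borel_measurable_continuous_onI continuous_intros)
      from measurable_compose[OF H this] show "(\<lambda>\<omega>. H k \<omega> $ j) \<in> borel_measurable (F (\<tau> k))" .
      show "norm (H k \<omega> $ j) \<le> C" if "\<omega> \<in> space M" for \<omega>
        using Finite_Cartesian_Product.norm_nth_le[of "H k \<omega>" j] C[OF that] by simp
    qed
    then show ?case using Suc by (simp add: row_list_simps)
  qed (simp add: row_list_simps)
  then show ?thesis by simp
qed

text \<open>The norm of a row is at most that of the matrix, so approximants of the matrix integral
  yield approximants of each row. \<open>norm2\<close> counts negative times as well; there the
  lists vanish, since their intervals start at nonnegative times.\<close>

lemma has_ito_component:
  fixes z :: "real \<Rightarrow> 'a \<Rightarrow> real^'d^'m"
  assumes i: "has_ito_integral M W (\<lambda>s \<omega>. indicator {t<..} s *\<^sub>R z s \<omega>) I" and z: "z \<in> H2_space M W" and t: "0 \<le> t"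
  shows "ito (\<lambda>s \<omega>. indicator {t<..} s *\<^sub>R (z s \<omega> $ j)) (\<lambda>\<omega>. I \<omega> $ j)"
proof -
  obtain n \<tau> H where I: "I \<in> borel_measurable M" and s: "\<And>i::nat. simple_integrand M W (n i) (\<tau> i) (H i)"
    and p: "(\<lambda>i. \<integral>\<^sup>+\<omega>. (\<integral>\<^sup>+s\<in>{0..}. ennreal ((norm (simple_process (n i) (\<tau> i) (H i) s \<omega> - indicator {t<..} s *\<^sub>R z s \<omega>))\<^sup>2) \<partial>lborel) \<partial>M) \<longlonglongrightarrow> 0"
    and q: "(\<lambda>i. \<integral>\<^sup>+\<omega>. ennreal ((norm (simple_ito_integral W (n i) (\<tau> i) (H i) \<omega> - I \<omega>))\<^sup>2) \<partial>M) \<longlonglongrightarrow> 0"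
    using i unfolding has_ito_integral_def by blast
  let ?l = "\<lambda>i. row_list (n i) (\<tau> i) (H i) j"
  have l: "simple (?l i)" for i by (rule simple_row_list[OF s])
  \<comment> \<open>Truncation at 0 leaves the list unchanged, so the formula for truncated lists
    gives the claim.\<close>
  have l0: "sproc (?l i) s \<omega> = 0" if "s \<le> 0" for i s \<omega>
  proof -
    have "sproc (trunc 0 (?l i)) s \<omega> = 0" using that by (simp add: sproc_trunc)
    moreover have "trunc 0 (?l i) = ?l i" unfolding trunc_def using l[of i]
      by (intro map_idI) (fastforce simp: simple_def elem_ok_def)
    ultimately show ?thesis by simp
  qed
  show ?thesis unfolding ito_def
  proof (intro conjI exI[of _ ?l] allI l)
    have "(\<lambda>x::real^'d^'m. x $ j) \<in> borel_measurable borel"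
      by (intro borel_measurable_continuous_onI continuous_intros)
    from measurable_compose[OF H2_joint_measurable[OF z] this]
    have "(\<lambda>x. indicator {t<..} (snd x) *\<^sub>R (z (max 0 (snd x)) (fst x) $ j)) \<in> borel_measurable (M \<Otimes>\<^sub>M lborel)" by measurable
    also have "(\<lambda>x. indicator {t<..} (snd x) *\<^sub>R (z (max 0 (snd x)) (fst x) $ j)) = (\<lambda>x. indicator {t<..} (snd x) *\<^sub>R (z (snd x) (fst x) $ j))"
      using t by (intro ext) (auto simp: indicator_def)
    finally show "joint_measurable (\<lambda>s \<omega>. indicator {t<..} s *\<^sub>R (z s \<omega> $ j))" unfolding joint_measurable_def .
    show "(\<lambda>\<omega>. I \<omega> $ j) \<in> borel_measurable M" by (rule measurable_compose[OF I borel_measurable_vec_nth])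
    have "norm2 (\<lambda>s \<omega>. sproc (?l i) s \<omega> - indicator {t<..} s *\<^sub>R (z s \<omega> $ j))
      \<le> (\<integral>\<^sup>+\<omega>. (\<integral>\<^sup>+s\<in>{0..}. ennreal ((norm (simple_process (n i) (\<tau> i) (H i) s \<omega> - indicator {t<..} s *\<^sub>R z s \<omega>))\<^sup>2) \<partial>lborel) \<partial>M)" for i
      unfolding norm2_def
    proof (intro nn_integral_mono)
      fix \<omega> s
      show "ennreal ((norm (sproc (?l i) s \<omega> - indicator {t<..} s *\<^sub>R (z s \<omega> $ j)))\<^sup>2)
        \<le> ennreal ((norm (simple_process (n i) (\<tau> i) (H i) s \<omega> - indicator {t<..} s *\<^sub>R z s \<omega>))\<^sup>2) * indicator {0..} s"
      proof (cases "0 \<le> s")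
        case True
        have "sproc (?l i) s \<omega> - indicator {t<..} s *\<^sub>R (z s \<omega> $ j) = (simple_process (n i) (\<tau> i) (H i) s \<omega> - indicator {t<..} s *\<^sub>R z s \<omega>) $ j"
          by (simp add: sproc_row_list)
        then show ?thesis using True Finite_Cartesian_Product.norm_nth_le[of "simple_process (n i) (\<tau> i) (H i) s \<omega> - indicator {t<..} s *\<^sub>R z s \<omega>" j]
          by (simp add: ennreal_leI power_mono)
      next
        case False
        then show ?thesis using t l0[of s i \<omega>] by (simp add: indicator_def)
      qed
    qed
    then show "(\<lambda>i. norm2 (\<lambda>s \<omega>. sproc (?l i) s \<omega> - indicator {t<..} s *\<^sub>R (z s \<omega> $ j))) \<longlonglongrightarrow> 0"
      using p by (rule tendsto_0_le_ennreal) simp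
    have "(\<integral>\<^sup>+\<omega>. ennreal ((iint (?l i) \<omega> - I \<omega> $ j)\<^sup>2) \<partial>M) \<le> (\<integral>\<^sup>+\<omega>. ennreal ((norm (simple_ito_integral W (n i) (\<tau> i) (H i) \<omega> - I \<omega>))\<^sup>2) \<partial>M)" for i
    proof (intro nn_integral_mono ennreal_leI)
      fix \<omega>
      have "\<bar>iint (?l i) \<omega> - I \<omega> $ j\<bar> \<le> norm (simple_ito_integral W (n i) (\<tau> i) (H i) \<omega> - I \<omega>)"
        using component_le_norm_cart[of "simple_ito_integral W (n i) (\<tau> i) (H i) \<omega> - I \<omega>" j] by (simp add: iint_row_list)
      from power_mono[OF this, of 2] show "(iint (?l i) \<omega> - I \<omega> $ j)\<^sup>2 \<le> (norm (simple_ito_integral W (n i) (\<tau> i) (H i) \<omega> - I \<omega>))\<^sup>2" by simp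
    qed
    then show "(\<lambda>i. \<integral>\<^sup>+\<omega>. ennreal ((iint (?l i) \<omega> - I \<omega> $ j)\<^sup>2) \<partial>M) \<longlonglongrightarrow> 0"
      using q by (rule tendsto_0_le_ennreal) simp
  qed
qed

section \<open>Continuity of solutions and domination of their drivers\<close>

text \<open>\<open>S2_space\<close> says nothing about paths; continuity is read off the equation,
  from the tail integral and the continuous version of the stochastic integral.\<close>

lemma solution_continuous:
  assumes "bsde_solution M W f \<xi> y z"
  shows "AE \<omega> in M. continuous_on {0..} (\<lambda>t. y t \<omega>)"
proof -
  obtain J where "AE \<omega> in M. continuous_on {0..} (\<lambda>t. J t \<omega>)"
    "AE \<omega> in M. set_integrable lborel {0..} (\<lambda>s. f \<omega> s (y s \<omega>) (z s \<omega>)) \<and>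
       (\<forall>t\<ge>0. y t \<omega> = \<xi> \<omega> + (LINT s:{t..}|lborel. f \<omega> s (y s \<omega>) (z s \<omega>)) - J t \<omega>)"
    using assms unfolding bsde_solution_def by blast
  then show ?thesis
  proof eventually_elim
    case (elim \<omega>)
    let ?g = "\<lambda>s. indicator {0..} s *\<^sub>R f \<omega> s (y s \<omega>) (z s \<omega>)"
    have g: "integrable lborel ?g" using elim(2) by (simp add: set_integrable_def)
    have "continuous_on {0..} (\<lambda>t. \<xi> \<omega> + (LINT s|lborel. indicator {t..} s *\<^sub>R ?g s) - J t \<omega>)"
      by (intro continuous_intros elim(1) continuous_on_subset[OF tail_integral_continuous[OF g]]) simp
    also have "?this \<longleftrightarrow> continuous_on {0..} (\<lambda>t. y t \<omega>)"
    proof (rule continuous_on_cong[OF refl])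
      fix t :: real assume "t \<in> {0..}"
      moreover from this have "(LINT s|lborel. indicator {t..} s *\<^sub>R ?g s) = (LINT s:{t..}|lborel. f \<omega> s (y s \<omega>) (z s \<omega>))"
        unfolding set_lebesgue_integral_def by (intro Bochner_Integration.integral_cong) (auto simp: indicator_def)
      ultimately show "\<xi> \<omega> + (LINT s|lborel. indicator {t..} s *\<^sub>R ?g s) - J t \<omega> = y t \<omega>" using elim(2) by simp
    qed
    finally show ?case .
  qed
qed

text \<open>Progressive measurability concerns times up to \<open>n\<close> and the information at
  \<open>n\<close>. Capping the time at \<open>n\<close> carries it over to the full product, and at
  each fixed time the cap is eventually inactive.\<close>

lemma generator_measurable:
  assumes "generator_h1 M W f"
  shows "(\<lambda>x. f (fst x) (max 0 (snd x)) y z) \<in> borel_measurable (M \<Otimes>\<^sub>M lborel)"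
proof (rule borel_measurable_LIMSEQ_metric)
  fix n :: nat
  have m: "(\<lambda>(s, \<omega>). f \<omega> s y z) \<in> borel_measurable (restrict_space borel {0..real n} \<Otimes>\<^sub>M F (real n))"
    using assms by (simp add: generator_h1_def progressive_process_def)
  have "(\<lambda>x. (min (real n) (max 0 (snd x)), fst x)) \<in> measurable (M \<Otimes>\<^sub>M (lborel::real measure)) (restrict_space borel {0..real n} \<Otimes>\<^sub>M F (real n))"
  proof (intro measurable_Pair measurable_restrict_space2)
    have "(\<lambda>x. x) \<in> measurable M (F (real n))" using F_subset[of "real n"]
      by (intro measurableI) (auto dest: sets.sets_into_space simp: Int_absorb2)
    from measurable_compose[OF measurable_fst this] show "fst \<in> measurable (M \<Otimes>\<^sub>M (lborel::real measure)) (F (real n))" .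
  qed auto
  from measurable_compose[OF this m] show "(\<lambda>x. f (fst x) (min (real n) (max 0 (snd x))) y z) \<in> borel_measurable (M \<Otimes>\<^sub>M lborel)" by simp
next
  fix x :: "'a \<times> real"
  obtain N :: nat where N: "max 0 (snd x) \<le> real N" using real_arch_simple by blast
  have "max 0 (snd x) \<le> real n" if "N \<le> n" for n using N that by (meson of_nat_mono order_trans)
  then have "eventually (\<lambda>n. f (fst x) (min (real n) (max 0 (snd x))) y z = f (fst x) (max 0 (snd x)) y z) sequentially"
    unfolding eventually_sequentially by (intro exI[of _ N]) (simp add: min_absorb2)
  then show "(\<lambda>n. f (fst x) (min (real n) (max 0 (snd x))) y z) \<longlonglongrightarrow> f (fst x) (max 0 (snd x)) y z"
    by (rule tendsto_eventually)
qed

text \<open>The Lipschitz condition bounds the driver by \<open>norm (f \<omega> u 0 0) + \<psi> u *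
  s \<omega> + \<delta> u * norm (z u \<omega>)\<close>. The time integral of the first term is
  square integrable by \<open>generator_h1\<close>, that of the second is a multiple of
  \<open>s\<close>, and Cauchy-Schwarz in time bounds that of the third by the norms of
  \<open>\<delta>\<close> and \<open>z\<close>.\<close>

lemma solution_drift_dominated:
  fixes f :: "'a \<Rightarrow> real \<Rightarrow> real ^ 'm \<Rightarrow> real ^ 'd ^ 'm \<Rightarrow> real ^ 'm"
  assumes h1: "generator_h1 M W f" and h2: "generator_h2 M f" and sol: "bsde_solution M W f \<xi> y z"
    and s: "s \<in> borel_measurable M" "integrable M (\<lambda>\<omega>. (s \<omega>)\<^sup>2)" "\<And>\<omega>. 0 \<le> s \<omega>" "AE \<omega> in M. \<forall>t\<ge>0. norm (y t \<omega>) \<le> s \<omega>"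
  obtains \<Lambda> where "\<Lambda> \<in> borel_measurable M" "integrable M (\<lambda>\<omega>. (\<Lambda> \<omega>)\<^sup>2)"
    "AE \<omega> in M. set_integrable lborel {0..} (\<lambda>u. f \<omega> u (y u \<omega>) (z u \<omega>)) \<and>
       (LINT u:{0..}|lborel. norm (f \<omega> u (y u \<omega>) (z u \<omega>))) \<le> \<Lambda> \<omega>"
proof -
  obtain \<psi> \<delta> where pos: "\<And>t. 0 \<le> t \<Longrightarrow> 0 < \<psi> t \<and> 0 < \<delta> t"
    and \<psi>: "set_integrable lborel {0..} \<psi>" and \<delta>: "set_integrable lborel {0..} (\<lambda>t. (\<delta> t)\<^sup>2)"
    and lip: "AE (t, \<omega>) in lborel \<Otimes>\<^sub>M M. 0 \<le> t \<longrightarrow> (\<forall>y1 y2 z1 z2.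
              norm (f \<omega> t y1 z1 - f \<omega> t y2 z2) \<le> \<psi> t * norm (y1 - y2) + \<delta> t * norm (z1 - z2))"
    using h2 unfolding generator_h2_def by blast
  have z: "z \<in> H2_space M W" and int: "AE \<omega> in M. set_integrable lborel {0..} (\<lambda>u. f \<omega> u (y u \<omega>) (z u \<omega>))"
    using sol unfolding bsde_solution_def by auto
  define N where "N \<omega> = (\<integral>\<^sup>+u\<in>{0..}. ennreal (norm (f \<omega> u 0 0)) \<partial>lborel)" for \<omega>
  define Q where "Q \<omega> = (\<integral>\<^sup>+u\<in>{0..}. ennreal ((norm (z u \<omega>))\<^sup>2) \<partial>lborel)" for \<omega>
  define \<Psi> where "\<Psi> = (LINT u|lborel. indicator {0..} u * \<psi> u)"
  define \<Delta> where "\<Delta> = (LINT u|lborel. indicator {0..} u * (\<delta> u)\<^sup>2)"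
  have \<psi>i: "integrable lborel (\<lambda>u. indicator {0..} u * \<psi> u)" and \<delta>i: "integrable lborel (\<lambda>u. indicator {0..} u * (\<delta> u)\<^sup>2)"
    using \<psi> \<delta> by (simp_all add: set_integrable_def)
  have \<psi>0: "0 \<le> indicator {0..} u * \<psi> u" for u using pos[of u] by (auto simp: indicator_def)
  have \<Psi>0: "0 \<le> \<Psi>" and \<Delta>0: "0 \<le> \<Delta>"
    unfolding \<Psi>_def \<Delta>_def using \<psi>0 by (auto intro!: integral_nonneg_AE)
  have fm: "(\<lambda>x. ennreal (norm (f (fst x) (max 0 (snd x)) 0 0)) * indicator {0..} (snd x)) \<in> borel_measurable (M \<Otimes>\<^sub>M lborel)"
    using generator_measurable[OF h1, of 0 0] by measurable
  have fm': "(\<lambda>x. ennreal (norm (f (fst x) (snd x) 0 0)) * indicator {0..} (snd x)) \<in> borel_measurable (M \<Otimes>\<^sub>M lborel)"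
  proof -
    have "(\<lambda>x. ennreal (norm (f (fst x) (max 0 (snd x)) 0 0)) * indicator {0..} (snd x)) = (\<lambda>x. ennreal (norm (f (fst x) (snd x) 0 0)) * indicator {0..} (snd x))"
      by (rule ext) (auto simp: indicator_def)
    then show ?thesis using fm by simp
  qed
  have zm: "(\<lambda>x. ennreal ((norm (z (max 0 (snd x)) (fst x)))\<^sup>2) * indicator {0..} (snd x)) \<in> borel_measurable (M \<Otimes>\<^sub>M lborel)"
    using H2_joint_measurable[OF z] by measurable
  have zm': "(\<lambda>x. ennreal ((norm (z (snd x) (fst x)))\<^sup>2) * indicator {0..} (snd x)) \<in> borel_measurable (M \<Otimes>\<^sub>M lborel)"
  proof -
    have "(\<lambda>x. ennreal ((norm (z (max 0 (snd x)) (fst x)))\<^sup>2) * indicator {0..} (snd x)) = (\<lambda>x. ennreal ((norm (z (snd x) (fst x)))\<^sup>2) * indicator {0..} (snd x))"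
      by (rule ext) (auto simp: indicator_def)
    then show ?thesis using zm by simp
  qed
  have Nm: "N \<in> borel_measurable M" unfolding N_def[abs_def]
    using fm' by (intro lborel.borel_measurable_nn_integral) (simp add: case_prod_beta)
  have Qm: "Q \<in> borel_measurable M" unfolding Q_def[abs_def]
    using zm' by (intro lborel.borel_measurable_nn_integral) (simp add: case_prod_beta)
  have N2: "(\<integral>\<^sup>+\<omega>. (N \<omega>)\<^sup>2 \<partial>M) < \<infinity>" using h1 by (simp add: generator_h1_def N_def)
  have Q1: "(\<integral>\<^sup>+\<omega>. Q \<omega> \<partial>M) < \<infinity>" using z by (simp add: H2_space_def Q_def)
  have AEN: "AE \<omega> in M. N \<omega> \<noteq> \<infinity>"
  proof -
    have "AE \<omega> in M. (N \<omega>)\<^sup>2 \<noteq> \<infinity>" using N2 Nm by (intro nn_integral_PInf_AE) auto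
    then show ?thesis by eventually_elim (auto simp: power2_eq_square)
  qed
  have AEQ: "AE \<omega> in M. Q \<omega> \<noteq> \<infinity>" using Q1 Qm by (intro nn_integral_PInf_AE) auto
  let ?\<Lambda> = "\<lambda>\<omega>. (enn2real (N \<omega>) + \<Psi> * s \<omega>) + sqrt \<Delta> * sqrt (enn2real (Q \<omega>))"
  have iN: "integrable M (\<lambda>\<omega>. (enn2real (N \<omega>))\<^sup>2)"
  proof (rule integrableI_nonneg)
    have "(\<integral>\<^sup>+\<omega>. ennreal ((enn2real (N \<omega>))\<^sup>2) \<partial>M) \<le> (\<integral>\<^sup>+\<omega>. (N \<omega>)\<^sup>2 \<partial>M)"
    proof (rule nn_integral_mono)
      fix \<omega>
      have "ennreal (enn2real (N \<omega>)) \<le> N \<omega>" by (simp add: ennreal_enn2real_if)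
      from power_mono[OF this, of 2] show "ennreal ((enn2real (N \<omega>))\<^sup>2) \<le> (N \<omega>)\<^sup>2" by (simp add: ennreal_power)
    qed
    then show "(\<integral>\<^sup>+\<omega>. ennreal ((enn2real (N \<omega>))\<^sup>2) \<partial>M) < \<infinity>" using N2 by (rule order_le_less_trans)
  qed (use Nm in auto)
  have iQ: "integrable M (\<lambda>\<omega>. (sqrt \<Delta> * sqrt (enn2real (Q \<omega>)))\<^sup>2)"
  proof -
    have "integrable M (\<lambda>\<omega>. enn2real (Q \<omega>))"
    proof (rule integrableI_nonneg)
      have "(\<integral>\<^sup>+\<omega>. ennreal (enn2real (Q \<omega>)) \<partial>M) \<le> (\<integral>\<^sup>+\<omega>. Q \<omega> \<partial>M)"
        by (intro nn_integral_mono) (simp add: ennreal_enn2real_if)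
      then show "(\<integral>\<^sup>+\<omega>. ennreal (enn2real (Q \<omega>)) \<partial>M) < \<infinity>" using Q1 by (rule order_le_less_trans)
    qed (use Qm in auto)
    then show ?thesis using \<Delta>0 by (simp add: power_mult_distrib)
  qed
  have mN: "(\<lambda>\<omega>. enn2real (N \<omega>)) \<in> borel_measurable M" and mQ: "(\<lambda>\<omega>. sqrt \<Delta> * sqrt (enn2real (Q \<omega>))) \<in> borel_measurable M"
    using Nm Qm by measurable
  have ms: "(\<lambda>\<omega>. \<Psi> * s \<omega>) \<in> borel_measurable M" using s(1) by simp
  have isq: "integrable M (\<lambda>\<omega>. (\<Psi> * s \<omega>)\<^sup>2)" using s(2) by (simp add: power_mult_distrib)
  show ?thesis
  proof (rule that[of ?\<Lambda>])
    show "?\<Lambda> \<in> borel_measurable M" by (intro borel_measurable_add mN ms mQ)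
    show "integrable M (\<lambda>\<omega>. (?\<Lambda> \<omega>)\<^sup>2)"
      by (intro L2_add_integrable borel_measurable_add mN ms mQ iN isq iQ)
    have lip': "AE \<omega> in M. AE t in lborel. 0 \<le> t \<longrightarrow> (\<forall>y1 y2 z1 z2.
              norm (f \<omega> t y1 z1 - f \<omega> t y2 z2) \<le> \<psi> t * norm (y1 - y2) + \<delta> t * norm (z1 - z2))"
      using AE_pair_swapped[OF lip] by simp
    show "AE \<omega> in M. set_integrable lborel {0..} (\<lambda>u. f \<omega> u (y u \<omega>) (z u \<omega>)) \<and>
       (LINT u:{0..}|lborel. norm (f \<omega> u (y u \<omega>) (z u \<omega>))) \<le> ?\<Lambda> \<omega>"
      using int AEN AEQ s(4) lip' AE_space
    proof eventually_elim
      case (elim \<omega>)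
      have i: "integrable lborel (\<lambda>u. indicator {0..} u * norm (f \<omega> u (y u \<omega>) (z u \<omega>)))"
        using integrable_norm[OF elim(1)[unfolded set_integrable_def]] by simp
      have nm: "(\<lambda>u. ennreal (norm (f \<omega> u 0 0)) * indicator {0..} u) \<in> borel_measurable lborel"
        using measurable_compose[OF measurable_Pair1'[OF elim(6)] fm'] by simp
      have qm: "(\<lambda>u. ennreal ((norm (z u \<omega>))\<^sup>2) * indicator {0..} u) \<in> borel_measurable lborel"
        using measurable_compose[OF measurable_Pair1'[OF elim(6)] zm'] by simp
      \<comment> \<open>The measurability at hand is that of the square of \<open>\<delta>\<close>;
        its root equals \<open>\<delta>\<close> on nonnegative times, where \<open>\<delta>\<close>
        is positive.\<close>
      let ?d = "\<lambda>u. ennreal (sqrt (indicator {0..} u * (\<delta> u)\<^sup>2))"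
      let ?z = "\<lambda>u. ennreal (norm (z (max 0 u) \<omega>) * indicator {0..} u)"
      have dm: "?d \<in> borel_measurable lborel" using borel_measurable_integrable[OF \<delta>i] by measurable
      have zzm: "?z \<in> borel_measurable lborel"
        using measurable_compose[OF measurable_Pair1'[OF elim(6)] H2_joint_measurable[OF z]] by simp
      have \<psi>m: "(\<lambda>u. ennreal (indicator {0..} u * \<psi> u) * ennreal (s \<omega>)) \<in> borel_measurable lborel"
        using borel_measurable_integrable[OF \<psi>i] by measurable
      have "ennreal (LINT u:{0..}|lborel. norm (f \<omega> u (y u \<omega>) (z u \<omega>))) = (\<integral>\<^sup>+u. ennreal (indicator {0..} u * norm (f \<omega> u (y u \<omega>) (z u \<omega>))) \<partial>lborel)"
        unfolding set_lebesgue_integral_def using i by (subst nn_integral_eq_integral) auto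
      also have "\<dots> \<le> (\<integral>\<^sup>+u. ennreal (norm (f \<omega> u 0 0)) * indicator {0..} u + ennreal (indicator {0..} u * \<psi> u) * ennreal (s \<omega>) + ?d u * ?z u \<partial>lborel)"
      proof (rule nn_integral_mono_AE)
        show "AE u in lborel. ennreal (indicator {0..} u * norm (f \<omega> u (y u \<omega>) (z u \<omega>)))
          \<le> ennreal (norm (f \<omega> u 0 0)) * indicator {0..} u + ennreal (indicator {0..} u * \<psi> u) * ennreal (s \<omega>) + ?d u * ?z u"
          using elim(5)
        proof eventually_elim
          case l: (elim u)
          show ?case
          proof (cases "0 \<le> u")
            case True
            have "norm (f \<omega> u (y u \<omega>) (z u \<omega>)) \<le> norm (f \<omega> u 0 0) + norm (f \<omega> u (y u \<omega>) (z u \<omega>) - f \<omega> u 0 0)"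
              by (rule norm_triangle_sub)
            also have "norm (f \<omega> u (y u \<omega>) (z u \<omega>) - f \<omega> u 0 0) \<le> \<psi> u * norm (y u \<omega> - 0) + \<delta> u * norm (z u \<omega> - 0)"
              using l True by blast
            also have "\<psi> u * norm (y u \<omega> - 0) \<le> \<psi> u * s \<omega>" using elim(4) True pos[OF True] by (intro mult_left_mono) auto
            finally have "norm (f \<omega> u (y u \<omega>) (z u \<omega>)) \<le> norm (f \<omega> u 0 0) + \<psi> u * s \<omega> + \<delta> u * norm (z u \<omega>)" by simp
            then have "ennreal (norm (f \<omega> u (y u \<omega>) (z u \<omega>))) \<le> ennreal (norm (f \<omega> u 0 0) + \<psi> u * s \<omega> + \<delta> u * norm (z u \<omega>))"
              by (rule ennreal_leI)
            also have "\<dots> = ennreal (norm (f \<omega> u 0 0)) + ennreal (\<psi> u) * ennreal (s \<omega>) + ennreal (\<delta> u) * ennreal (norm (z u \<omega>))"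
              using pos[OF True] s(3)[of \<omega>] by (simp add: ennreal_mult)
            finally show ?thesis using True pos[OF True] by (simp add: max_absorb2)
          qed simp
        qed
      qed
      also have "\<dots> = N \<omega> + (\<integral>\<^sup>+u. ennreal (indicator {0..} u * \<psi> u) * ennreal (s \<omega>) \<partial>lborel) + (\<integral>\<^sup>+u. ?d u * ?z u \<partial>lborel)"
        unfolding N_def using nm \<psi>m dm zzm by (subst nn_integral_add, simp, simp, subst nn_integral_add, simp_all)
      also have "(\<integral>\<^sup>+u. ennreal (indicator {0..} u * \<psi> u) * ennreal (s \<omega>) \<partial>lborel) = ennreal (\<Psi> * s \<omega>)"
      proof -
        have "(\<integral>\<^sup>+u. ennreal (indicator {0..} u * \<psi> u) * ennreal (s \<omega>) \<partial>lborel) = (\<integral>\<^sup>+u. ennreal (indicator {0..} u * \<psi> u) \<partial>lborel) * ennreal (s \<omega>)"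
          by (intro nn_integral_multc measurable_compose[OF borel_measurable_integrable[OF \<psi>i] measurable_ennreal])
        also have "(\<integral>\<^sup>+u. ennreal (indicator {0..} u * \<psi> u) \<partial>lborel) = ennreal \<Psi>"
          unfolding \<Psi>_def using \<psi>0 by (intro nn_integral_eq_integral[OF \<psi>i]) auto
        finally show ?thesis using s(3)[of \<omega>] \<Psi>0 by (simp add: ennreal_mult)
      qed
      also have "(\<integral>\<^sup>+u. ?d u * ?z u \<partial>lborel) \<le> ennreal (sqrt \<Delta> * sqrt (enn2real (Q \<omega>)))"
      proof -
        have q: "Q \<omega> = ennreal (enn2real (Q \<omega>))" using elim(3) by (simp add: ennreal_enn2real_if)
        have "(\<integral>\<^sup>+u. ?d u * ?z u \<partial>lborel)\<^sup>2 \<le> (\<integral>\<^sup>+u. (?d u)\<^sup>2 \<partial>lborel) * (\<integral>\<^sup>+u. (?z u)\<^sup>2 \<partial>lborel)"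
          by (rule Cauchy_Schwarz_nn_integral[OF dm zzm])
        also have "(\<integral>\<^sup>+u. (?d u)\<^sup>2 \<partial>lborel) = (\<integral>\<^sup>+u. ennreal (indicator {0..} u * (\<delta> u)\<^sup>2) \<partial>lborel)"
          by (intro nn_integral_cong) (simp add: ennreal_power)
        also have "\<dots> = ennreal \<Delta>"
          unfolding \<Delta>_def by (intro nn_integral_eq_integral[OF \<delta>i]) auto
        also have "(\<integral>\<^sup>+u. (?z u)\<^sup>2 \<partial>lborel) = Q \<omega>"
          unfolding Q_def by (intro nn_integral_cong) (auto simp: ennreal_power indicator_def max_absorb2)
        finally have c: "(\<integral>\<^sup>+u. ?d u * ?z u \<partial>lborel)\<^sup>2 \<le> ennreal \<Delta> * ennreal (enn2real (Q \<omega>))" using q by simp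
        then have c': "(\<integral>\<^sup>+u. ?d u * ?z u \<partial>lborel)\<^sup>2 \<le> ennreal (\<Delta> * enn2real (Q \<omega>))" using \<Delta>0 by (simp add: ennreal_mult)
        have "(\<integral>\<^sup>+u. ?d u * ?z u \<partial>lborel) \<noteq> \<infinity>"
        proof
          assume "(\<integral>\<^sup>+u. ?d u * ?z u \<partial>lborel) = \<infinity>"
          with c' show False by (simp add: power2_eq_square top_unique)
        qed
        then obtain r where r: "(\<integral>\<^sup>+u. ?d u * ?z u \<partial>lborel) = ennreal r" "0 \<le> r"
          by (cases "\<integral>\<^sup>+u. ?d u * ?z u \<partial>lborel") auto
        have "r\<^sup>2 \<le> \<Delta> * enn2real (Q \<omega>)" using c' r \<Delta>0 by (simp add: ennreal_power)
        then have "r \<le> sqrt (\<Delta> * enn2real (Q \<omega>))" by (rule real_le_rsqrt)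
        then show ?thesis using r by (simp add: real_sqrt_mult ennreal_leI)
      qed
      also have "N \<omega> = ennreal (enn2real (N \<omega>))" using elim(2) by (simp add: ennreal_enn2real_if)
      finally have "ennreal (LINT u:{0..}|lborel. norm (f \<omega> u (y u \<omega>) (z u \<omega>))) \<le> ennreal (enn2real (N \<omega>)) + ennreal (\<Psi> * s \<omega>) + ennreal (sqrt \<Delta> * sqrt (enn2real (Q \<omega>)))"
        by (simp add: add_left_mono)
      also have "\<dots> = ennreal (?\<Lambda> \<omega>)" using \<Psi>0 \<Delta>0 s(3)[of \<omega>] by simp
      finally have "(LINT u:{0..}|lborel. norm (f \<omega> u (y u \<omega>) (z u \<omega>))) \<le> ?\<Lambda> \<omega>"
        using \<Psi>0 \<Delta>0 s(3)[of \<omega>] by (subst (asm) ennreal_le_iff) auto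
      then show ?case using elim(1) by simp
    qed
  qed
qed

end

definition pos_part :: "real^'m \<Rightarrow> real^'m" where
  "pos_part x = (\<chi> j. max 0 (x $ j))"

lemma pos_part_measurable: "pos_part \<in> borel_measurable borel"
  unfolding pos_part_def[abs_def]
  by (intro borel_measurable_continuous_onI continuous_on_vec_lambda continuous_intros)

lemma norm_pos_part_le: "norm (pos_part x) \<le> norm x"
  by (rule norm_le_componentwise_cart) (simp add: pos_part_def)

lemma norm_pos_part_sq: "(norm (pos_part x))\<^sup>2 = (\<Sum>j\<in>UNIV. (max 0 (x $ j))\<^sup>2)"
  unfolding power2_norm_eq_inner inner_vec_def pos_part_def by (simp add: power2_eq_square)

text \<open>Quasi-monotonicity compares \<open>f2\<close> at \<open>(y2, z2)\<close> with \<open>f1\<close> at the point whose state is the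
  componentwise maximum of \<open>y1, y2\<close> and whose \<open>j\<close>-th row alone is taken from \<open>z2\<close>.\<close>

lemma quasi_monotone_drift_bound:
  fixes y1 y2 :: "real^'m" and z1 z2 :: "real^'d^'m" and F1 F2 :: "real^'m \<Rightarrow> real^'d^'m \<Rightarrow> real^'m"
  assumes lip: "\<And>y y' z z'. norm (F1 y z - F1 y' z') \<le> \<psi> * norm (y - y') + \<delta> * norm (z - z')"
    and qm: "\<And>s Y Y' Z Z'. Y $ s = Y' $ s \<Longrightarrow> Z $ s = Z' $ s \<Longrightarrow> (\<And>j. j \<noteq> s \<Longrightarrow> Y $ j \<ge> Y' $ j) \<Longrightarrow> F1 Y Z $ s \<ge> F2 Y' Z' $ s"
    and j: "y2 $ j > y1 $ j"
  shows "F2 y2 z2 $ j - F1 y1 z1 $ j \<le> \<psi> * norm (pos_part (y2 - y1)) + \<delta> * norm (z2 $ j - z1 $ j)"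
proof -
  define Y where "Y = (\<chi> k. max (y1 $ k) (y2 $ k))"
  define Z where "Z = (\<chi> k. if k = j then z2 $ k else z1 $ k)"
  \<comment> \<open>By assumption \<open>j\<close>, component \<open>j\<close> of \<open>Y\<close>
    is that of \<open>y2\<close>; the other components dominate those of \<open>y2\<close>, and the
    rows \<open>j\<close> of \<open>Z\<close> and \<open>z2\<close> coincide.\<close>
  have 1: "F2 y2 z2 $ j \<le> F1 Y Z $ j" by (rule qm) (use j in \<open>auto simp: Y_def Z_def\<close>)
  have Y: "Y - y1 = pos_part (y2 - y1)" by (auto simp: Y_def pos_part_def vec_eq_iff max_def)
  \<comment> \<open>The rows other than \<open>j\<close> cancel, which keeps them out of the final
    bound.\<close>
  have Z: "Z - z1 = axis j (z2 $ j - z1 $ j)" by (auto simp: Z_def axis_def vec_eq_iff)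
  have "F1 Y Z $ j - F1 y1 z1 $ j \<le> norm (F1 Y Z - F1 y1 z1)"
    using component_le_norm_cart[of "F1 Y Z - F1 y1 z1" j] by simp
  also have "\<dots> \<le> \<psi> * norm (Y - y1) + \<delta> * norm (Z - z1)" by (rule lip)
  finally show ?thesis using 1 unfolding Y Z by (simp add: norm_eq_sqrt_inner inner_axis_axis)
qed

section \<open>Comparison\<close>

context brownian begin

text \<open>\<open>ito_inequality\<close> is applied to every component and summed. The coupling
  \<open>\<kappa>\<close> is \<open>\<psi>\<close> times the norm of the whole positive part of
  \<open>y2 - y1\<close>, so the sum is an integral inequality for the second moment of that norm
  alone, to which \<open>gronwall_backward\<close> applies.\<close>

lemma comparison:
  fixes \<xi>1 \<xi>2 :: "'a \<Rightarrow> real ^ 'm"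
    and f1 f2 :: "'a \<Rightarrow> real \<Rightarrow> real ^ 'm \<Rightarrow> real ^ 'd ^ 'm \<Rightarrow> real ^ 'm"
  assumes \<xi>: "AE \<omega> in M. \<forall>j. \<xi>1 \<omega> $ j \<ge> \<xi>2 \<omega> $ j"
    and h1: "generator_h1 M W f1" "generator_h1 M W f2"
    and h2: "generator_h2 M f1" "generator_h2 M f2"
    and qm: "quasi_monotone M f1 f2"
    and sol: "bsde_solution M W f1 \<xi>1 y1 z1" "bsde_solution M W f2 \<xi>2 y2 z2"
  shows "AE \<omega> in M. \<forall>t\<ge>0. \<forall>j. y1 t \<omega> $ j \<ge> y2 t \<omega> $ j"
proof -
  \<comment> \<open>The moduli of \<open>f1\<close>, because the intermediate point of
    \<open>quasi_monotone_drift_bound\<close> is inserted into \<open>f1\<close>.\<close>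
  obtain \<psi> \<delta> where pos: "\<And>t. 0 \<le> t \<Longrightarrow> 0 < \<psi> t \<and> 0 < \<delta> t"
    and \<psi>: "set_integrable lborel {0..} \<psi>" and \<delta>: "set_integrable lborel {0..} (\<lambda>t. (\<delta> t)\<^sup>2)"
    and lip: "AE (t, \<omega>) in lborel \<Otimes>\<^sub>M M. 0 \<le> t \<longrightarrow> (\<forall>y1 y2 z1 z2.
              norm (f1 \<omega> t y1 z1 - f1 \<omega> t y2 z2) \<le> \<psi> t * norm (y1 - y2) + \<delta> t * norm (z1 - z2))"
    using h2(1) unfolding generator_h2_def by blast
  have yz: "y1 \<in> S2_space M W" "y2 \<in> S2_space M W" "z1 \<in> H2_space M W" "z2 \<in> H2_space M W"
    using sol unfolding bsde_solution_def by auto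
  note c1 = solution_continuous[OF sol(1)] and c2 = solution_continuous[OF sol(2)]
  obtain s1 where s1: "s1 \<in> borel_measurable M" "integrable M (\<lambda>\<omega>. (s1 \<omega>)\<^sup>2)" "\<And>\<omega>. 0 \<le> s1 \<omega>"
    "AE \<omega> in M. \<forall>t\<ge>0. norm (y1 t \<omega>) \<le> s1 \<omega>" using S2_dominated[OF yz(1) c1] by blast
  obtain s2 where s2: "s2 \<in> borel_measurable M" "integrable M (\<lambda>\<omega>. (s2 \<omega>)\<^sup>2)" "\<And>\<omega>. 0 \<le> s2 \<omega>"
    "AE \<omega> in M. \<forall>t\<ge>0. norm (y2 t \<omega>) \<le> s2 \<omega>" using S2_dominated[OF yz(2) c2] by blast
  obtain \<Lambda>1 where \<Lambda>1: "\<Lambda>1 \<in> borel_measurable M" "integrable M (\<lambda>\<omega>. (\<Lambda>1 \<omega>)\<^sup>2)"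
    "AE \<omega> in M. set_integrable lborel {0..} (\<lambda>u. f1 \<omega> u (y1 u \<omega>) (z1 u \<omega>)) \<and>
       (LINT u:{0..}|lborel. norm (f1 \<omega> u (y1 u \<omega>) (z1 u \<omega>))) \<le> \<Lambda>1 \<omega>"
    using solution_drift_dominated[OF h1(1) h2(1) sol(1) s1] by blast
  obtain \<Lambda>2 where \<Lambda>2: "\<Lambda>2 \<in> borel_measurable M" "integrable M (\<lambda>\<omega>. (\<Lambda>2 \<omega>)\<^sup>2)"
    "AE \<omega> in M. set_integrable lborel {0..} (\<lambda>u. f2 \<omega> u (y2 u \<omega>) (z2 u \<omega>)) \<and>
       (LINT u:{0..}|lborel. norm (f2 \<omega> u (y2 u \<omega>) (z2 u \<omega>))) \<le> \<Lambda>2 \<omega>"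
    using solution_drift_dominated[OF h1(2) h2(2) sol(2) s2] by blast
  obtain J1 where J1: "\<And>t. 0 \<le> t \<Longrightarrow> has_ito_integral M W (\<lambda>s \<omega>. indicator {t<..} s *\<^sub>R z1 s \<omega>) (J1 t)"
    and e1: "AE \<omega> in M. set_integrable lborel {0..} (\<lambda>s. f1 \<omega> s (y1 s \<omega>) (z1 s \<omega>)) \<and>
       (\<forall>t\<ge>0. y1 t \<omega> = \<xi>1 \<omega> + (LINT s:{t..}|lborel. f1 \<omega> s (y1 s \<omega>) (z1 s \<omega>)) - J1 t \<omega>)"
    using sol(1) unfolding bsde_solution_def by blast
  obtain J2 where J2: "\<And>t. 0 \<le> t \<Longrightarrow> has_ito_integral M W (\<lambda>s \<omega>. indicator {t<..} s *\<^sub>R z2 s \<omega>) (J2 t)"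
    and e2: "AE \<omega> in M. set_integrable lborel {0..} (\<lambda>s. f2 \<omega> s (y2 s \<omega>) (z2 s \<omega>)) \<and>
       (\<forall>t\<ge>0. y2 t \<omega> = \<xi>2 \<omega> + (LINT s:{t..}|lborel. f2 \<omega> s (y2 s \<omega>) (z2 s \<omega>)) - J2 t \<omega>)"
    using sol(2) unfolding bsde_solution_def by blast
  define good where "good \<omega> \<longleftrightarrow> continuous_on {0..} (\<lambda>t. y1 t \<omega>) \<and> continuous_on {0..} (\<lambda>t. y2 t \<omega>) \<and>
     (\<forall>t\<ge>0. norm (y1 t \<omega>) \<le> s1 \<omega>) \<and> (\<forall>t\<ge>0. norm (y2 t \<omega>) \<le> s2 \<omega>)" for \<omega>
  have "AE \<omega> in M. good \<omega>" unfolding good_def using c1 c2 s1(4) s2(4) by eventually_elim simp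
  then obtain N where N: "{\<omega> \<in> space M. \<not> good \<omega>} \<subseteq> N" "emeasure M N = 0" "N \<in> sets M" by (rule AE_E)
  then have N0: "N \<in> null_sets M" by blast
  \<comment> \<open>Equal to \<open>y2 - y1\<close> off \<open>N\<close> and 0 on \<open>N\<close>.
    So every path is continuous and dominated, as \<open>ito_process\<close> demands, and
    adaptedness is kept because \<open>N\<close> lies in every \<open>F t\<close>.\<close>
  define D where "D t \<omega> = indicator (space M - N) \<omega> *\<^sub>R (y2 t \<omega> - y1 t \<omega>)" for t \<omega>
  define S where "S \<omega> = s1 \<omega> + s2 \<omega>" for \<omega>
  have AED: "AE \<omega> in M. \<forall>t. D t \<omega> = y2 t \<omega> - y1 t \<omega>"
    using AE_not_in[OF N0] AE_space by eventually_elim (simp add: D_def)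
  have D_F: "D t \<in> borel_measurable (F t)" if "0 \<le> t" for t
  proof -
    have [measurable]: "y1 t \<in> borel_measurable (F t)" "y2 t \<in> borel_measurable (F t)"
      using yz that by (auto simp: S2_space_def adapted_process_def)
    have "space M - N \<in> sets (F t)" using null_F[OF N0, of t] sets.compl_sets[of N "F t"] by simp
    then have [measurable]: "indicator (space M - N) \<in> borel_measurable (F t)" by (rule borel_measurable_indicator)
    show ?thesis unfolding D_def[abs_def] by measurable
  qed
  have D_cont: "continuous_on {0..} (\<lambda>t. D t \<omega>)" if "\<omega> \<in> space M" for \<omega>
  proof (cases "\<omega> \<in> N")
    case True
    then show ?thesis by (simp add: D_def)
  next
    case False
    then have "good \<omega>" using N(1) that by blast
    then show ?thesis unfolding D_def good_def by (intro continuous_intros) auto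
  qed
  have D_le: "norm (D t \<omega>) \<le> S \<omega>" if "\<omega> \<in> space M" "0 \<le> t" for t \<omega>
  proof (cases "\<omega> \<in> N")
    case True
    then show ?thesis using s1(3)[of \<omega>] s2(3)[of \<omega>] by (simp add: D_def S_def)
  next
    case False
    then have "good \<omega>" using N(1) that by blast
    then have "norm (y1 t \<omega>) \<le> s1 \<omega>" "norm (y2 t \<omega>) \<le> s2 \<omega>" using that by (auto simp: good_def)
    then show ?thesis using norm_triangle_ineq4[of "y2 t \<omega>" "y1 t \<omega>"] False that by (simp add: D_def S_def)
  qed
  have S_m: "S \<in> borel_measurable M" and S_sq: "integrable M (\<lambda>\<omega>. (S \<omega>)\<^sup>2)"
    unfolding S_def[abs_def] using s1 s2 L2_add_integrable by auto
  have S0: "0 \<le> S \<omega>" for \<omega> using s1(3)[of \<omega>] s2(3)[of \<omega>] by (simp add: S_def)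
  have jmD: "(\<lambda>x. D (max 0 (snd x)) (fst x)) \<in> borel_measurable (M \<Otimes>\<^sub>M lborel)"
  proof -
    have "joint_measurable (\<lambda>t. D (max 0 t))"
    proof (rule joint_measurable_continuous)
      show "D (max 0 t) \<in> borel_measurable M" for t using D_F[of "max 0 t"] F_measurable by auto
      show "continuous_on UNIV (\<lambda>t. D (max 0 t) \<omega>)" if "\<omega> \<in> space M" for \<omega>
        by (rule continuous_on_compose2[OF D_cont[OF that]]) (auto intro!: continuous_intros)
    qed
    then show ?thesis by (simp add: joint_measurable_def)
  qed
  define P where "P u \<omega> = norm (pos_part (D (max 0 u) \<omega>))" for u \<omega>
  have Pm: "(\<lambda>x. P (snd x) (fst x)) \<in> borel_measurable (M \<Otimes>\<^sub>M lborel)"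
    unfolding P_def using measurable_compose[OF jmD pos_part_measurable] by measurable
  have P0: "0 \<le> P u \<omega>" for u \<omega> by (simp add: P_def)
  have PS: "P u \<omega> \<le> S \<omega>" if "\<omega> \<in> space M" for u \<omega>
    unfolding P_def using norm_pos_part_le[of "D (max 0 u) \<omega>"] D_le[OF that, of "max 0 u"] by simp
  \<comment> \<open>The indicator is attached to \<open>\<psi>\<close> because integrability of
    \<open>\<psi>\<close>, and with it measurability, is given on nonnegative times.\<close>
  define \<kappa> where "\<kappa> u \<omega> = (indicator {0..} u * \<psi> u) * P u \<omega>" for u \<omega>
  define g where "g j u \<omega> = (f2 \<omega> u (y2 u \<omega>) (z2 u \<omega>) - f1 \<omega> u (y1 u \<omega>) (z1 u \<omega>)) $ j" for j u \<omega>
  have \<psi>m: "(\<lambda>u. indicator {0..} u * \<psi> u) \<in> borel_measurable lborel"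
    using borel_measurable_integrable[OF \<psi>[unfolded set_integrable_def]] by simp
  have bound: "ito_bound M W (\<lambda>t \<omega>. D t \<omega> $ j) (\<lambda>t \<omega>. J2 t \<omega> $ j - J1 t \<omega> $ j) (\<lambda>u \<omega>. z2 u \<omega> $ j - z1 u \<omega> $ j) S
     (g j) \<kappa> (\<lambda>\<omega>. \<Lambda>1 \<omega> + \<Lambda>2 \<omega>) (\<lambda>\<omega>. \<xi>2 \<omega> $ j - \<xi>1 \<omega> $ j) \<psi> \<delta>" for j
  proof unfold_locales
    show "(\<lambda>\<omega>. D t \<omega> $ j) \<in> borel_measurable (F t)" if "0 \<le> t" for t
      by (rule measurable_compose[OF D_F[OF that] borel_measurable_vec_nth])
    show "continuous_on {0..} (\<lambda>t. D t \<omega> $ j)" if "\<omega> \<in> space M" for \<omega>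
      by (intro continuous_intros D_cont[OF that])
    show "\<bar>D t \<omega> $ j\<bar> \<le> S \<omega>" if "\<omega> \<in> space M" "0 \<le> t" for t \<omega>
      using component_le_norm_cart[of "D t \<omega>" j] D_le[OF that] by simp
    show "S \<in> borel_measurable M" by (rule S_m)
    show "integrable M (\<lambda>\<omega>. (S \<omega>)\<^sup>2)" by (rule S_sq)
    show "ito (\<lambda>u \<omega>. indicator {t<..} u *\<^sub>R (z2 u \<omega> $ j - z1 u \<omega> $ j)) (\<lambda>\<omega>. J2 t \<omega> $ j - J1 t \<omega> $ j)" if "0 \<le> t" for t
      by (rule ito_cong[OF ito_diff[OF has_ito_component[OF J2[OF that] yz(4) that] has_ito_component[OF J1[OF that] yz(3) that]]])
        (simp_all add: scaleR_diff_right)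
    show "(\<lambda>\<omega>. \<Lambda>1 \<omega> + \<Lambda>2 \<omega>) \<in> borel_measurable M" using \<Lambda>1(1) \<Lambda>2(1) by simp
    show "integrable M (\<lambda>\<omega>. (\<Lambda>1 \<omega> + \<Lambda>2 \<omega>)\<^sup>2)" by (rule L2_add_integrable[OF \<Lambda>1(1) \<Lambda>2(1) \<Lambda>1(2) \<Lambda>2(2)])
    show "AE \<omega> in M. set_integrable lborel {0..} (\<lambda>s. g j s \<omega>) \<and> (LINT s:{0..}|lborel. \<bar>g j s \<omega>\<bar>) \<le> \<Lambda>1 \<omega> + \<Lambda>2 \<omega>"
      using \<Lambda>1(3) \<Lambda>2(3)
    proof eventually_elim
      case (elim \<omega>)
      let ?a = "\<lambda>u. indicator {0..} u *\<^sub>R f1 \<omega> u (y1 u \<omega>) (z1 u \<omega>)" and ?b = "\<lambda>u. indicator {0..} u *\<^sub>R f2 \<omega> u (y2 u \<omega>) (z2 u \<omega>)"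
      have ab: "integrable lborel ?a" "integrable lborel ?b" using elim by (auto simp: set_integrable_def)
      have i: "integrable lborel (\<lambda>u. (?b u - ?a u) $ j)"
        using integrable_bounded_linear[OF bounded_linear_vec_nth Bochner_Integration.integrable_diff[OF ab(2,1)]] .
      also have "(\<lambda>u. (?b u - ?a u) $ j) = (\<lambda>u. indicator {0..} u *\<^sub>R g j u \<omega>)" by (auto simp: g_def algebra_simps)
      finally have gi: "integrable lborel (\<lambda>u. indicator {0..} u *\<^sub>R g j u \<omega>)" .
      have "(LINT u:{0..}|lborel. \<bar>g j u \<omega>\<bar>) \<le> (LINT u|lborel. norm (?a u) + norm (?b u))"
        unfolding set_lebesgue_integral_def
      proof (rule integral_mono)
        show "integrable lborel (\<lambda>u. indicator {0..} u *\<^sub>R \<bar>g j u \<omega>\<bar>)" using integrable_abs[OF gi] by (simp add: abs_mult)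
        show "integrable lborel (\<lambda>u. norm (?a u) + norm (?b u))" using ab by (intro Bochner_Integration.integrable_add integrable_norm)
        fix u
        have "\<bar>g j u \<omega>\<bar> \<le> norm (f2 \<omega> u (y2 u \<omega>) (z2 u \<omega>) - f1 \<omega> u (y1 u \<omega>) (z1 u \<omega>))"
          unfolding g_def by (rule component_le_norm_cart)
        also have "\<dots> \<le> norm (f2 \<omega> u (y2 u \<omega>) (z2 u \<omega>)) + norm (f1 \<omega> u (y1 u \<omega>) (z1 u \<omega>))" by (rule norm_triangle_ineq4)
        finally show "indicator {0..} u *\<^sub>R \<bar>g j u \<omega>\<bar> \<le> norm (?a u) + norm (?b u)" by (simp add: indicator_def)
      qed
      also have "\<dots> = (LINT u|lborel. norm (?a u)) + (LINT u|lborel. norm (?b u))"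
        using ab by (intro Bochner_Integration.integral_add integrable_norm)
      also have "\<dots> \<le> \<Lambda>1 \<omega> + \<Lambda>2 \<omega>" using elim by (simp add: set_lebesgue_integral_def)
      finally show ?case using gi by (simp add: set_integrable_def)
    qed
    show "AE \<omega> in M. \<forall>t\<ge>0. D t \<omega> $ j = \<xi>2 \<omega> $ j - \<xi>1 \<omega> $ j + (LINT s:{t..}|lborel. g j s \<omega>) - (J2 t \<omega> $ j - J1 t \<omega> $ j)"
      using AED e1 e2
    proof eventually_elim
      case (elim \<omega>)
      let ?a = "\<lambda>u. f1 \<omega> u (y1 u \<omega>) (z1 u \<omega>)" and ?b = "\<lambda>u. f2 \<omega> u (y2 u \<omega>) (z2 u \<omega>)"
      have "(LINT s:{t..}|lborel. g j s \<omega>) = ((LINT s:{t..}|lborel. ?b s) - (LINT s:{t..}|lborel. ?a s)) $ j" if t: "0 \<le> t" for t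
      proof -
        have ab: "set_integrable lborel {t..} ?a" "set_integrable lborel {t..} ?b"
          using elim t by (auto intro: set_integrable_subset)
        have "((LINT s:{t..}|lborel. ?b s) - (LINT s:{t..}|lborel. ?a s)) $ j = (LINT u|lborel. indicator {t..} u *\<^sub>R ?b u - indicator {t..} u *\<^sub>R ?a u) $ j"
          using ab unfolding set_integrable_def set_lebesgue_integral_def by simp
        also have "\<dots> = (LINT u|lborel. (indicator {t..} u *\<^sub>R ?b u - indicator {t..} u *\<^sub>R ?a u) $ j)"
          using ab unfolding set_integrable_def
          by (intro integral_bounded_linear[OF bounded_linear_vec_nth, symmetric] Bochner_Integration.integrable_diff)
        also have "\<dots> = (LINT s:{t..}|lborel. g j s \<omega>)"
          unfolding set_lebesgue_integral_def by (intro Bochner_Integration.integral_cong) (auto simp: g_def algebra_simps)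
        finally show ?thesis by simp
      qed
      then show ?case using elim by simp
    qed
    show "AE \<omega> in M. \<xi>2 \<omega> $ j - \<xi>1 \<omega> $ j \<le> 0" using \<xi> by eventually_elim simp
    show "joint_measurable \<kappa>" unfolding joint_measurable_def \<kappa>_def using Pm measurable_compose[OF measurable_snd \<psi>m, of M] by measurable
    show "0 \<le> \<kappa> s \<omega> \<and> \<kappa> s \<omega> \<le> \<psi> s * S \<omega>" if "\<omega> \<in> space M" "0 \<le> s" for s \<omega>
      using that pos[of s] P0[of s \<omega>] PS[of \<omega> s] by (auto simp: \<kappa>_def intro!: mult_left_mono)
    show "set_integrable lborel {0..} \<psi>" by (rule \<psi>)
    show "set_integrable lborel {0..} (\<lambda>s. (\<delta> s)\<^sup>2)" by (rule \<delta>)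
    have lip': "AE \<omega> in M. AE t in lborel. 0 \<le> t \<longrightarrow> (\<forall>y1 y2 z1 z2.
              norm (f1 \<omega> t y1 z1 - f1 \<omega> t y2 z2) \<le> \<psi> t * norm (y1 - y2) + \<delta> t * norm (z1 - z2))"
      using AE_pair_swapped[OF lip] by simp
    have qm': "AE \<omega> in M. AE t in lborel. 0 \<le> t \<longrightarrow>
        (\<forall>s Y Y' Z Z'. Y $ s = Y' $ s \<and> Z $ s = Z' $ s \<and> (\<forall>j. j \<noteq> s \<longrightarrow> Y $ j \<ge> Y' $ j) \<longrightarrow>
           f1 \<omega> t Y Z $ s \<ge> f2 \<omega> t Y' Z' $ s)"
      using AE_pair_swapped[OF qm[unfolded quasi_monotone_def]] by simp
    show "AE \<omega> in M. AE s in lborel. 0 \<le> s \<longrightarrow> 0 < D s \<omega> $ j \<longrightarrow> g j s \<omega> \<le> \<kappa> s \<omega> + \<delta> s * norm (z2 s \<omega> $ j - z1 s \<omega> $ j)"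
      using AED lip' qm'
    proof eventually_elim
      case (elim \<omega>)
      show ?case using elim(2,3)
      proof eventually_elim
        case e: (elim s)
        show ?case
        proof (intro impI)
          assume s: "0 \<le> s" and d: "0 < D s \<omega> $ j"
          have "f2 \<omega> s (y2 s \<omega>) (z2 s \<omega>) $ j - f1 \<omega> s (y1 s \<omega>) (z1 s \<omega>) $ j
             \<le> \<psi> s * norm (pos_part (y2 s \<omega> - y1 s \<omega>)) + \<delta> s * norm (z2 s \<omega> $ j - z1 s \<omega> $ j)"
          proof (rule quasi_monotone_drift_bound)
            show "norm (f1 \<omega> s y z - f1 \<omega> s y' z') \<le> \<psi> s * norm (y - y') + \<delta> s * norm (z - z')" for y y' z z'
              using e(1) s by blast
            show "f2 \<omega> s Y' Z' $ i \<le> f1 \<omega> s Y Z $ i" if "Y $ i = Y' $ i" "Z $ i = Z' $ i" "\<And>j. j \<noteq> i \<Longrightarrow> Y' $ j \<le> Y $ j" for i Y Y' Z Z'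
              using e(2) s that by blast
            show "y1 s \<omega> $ j < y2 s \<omega> $ j" using d elim(1) by simp
          qed
          then show "g j s \<omega> \<le> \<kappa> s \<omega> + \<delta> s * norm (z2 s \<omega> $ j - z1 s \<omega> $ j)"
            using s elim(1) by (simp add: g_def \<kappa>_def P_def)
        qed
      qed
    qed
  qed
  \<comment> \<open>Each of the \<open>CARD('m)\<close> components contributes at most
    \<open>2 * \<psi> u + (\<delta> u)\<^sup>2\<close> times the square of
    \<open>P u \<omega>\<close>: the first summand from the coupling, the second from the completed
    square.\<close>
  define k where "k u = real CARD('m) * (2 * \<psi> u + (\<delta> u)\<^sup>2)" for u
  have ki: "set_integrable lborel {0..} k" unfolding k_def
    using \<psi> \<delta> by (intro set_integrable_mult_right set_integral_add) auto
  have k0: "0 \<le> k t" if "0 \<le> t" for t using pos[OF that] by (simp add: k_def)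
  have kint: "integrable lborel (\<lambda>u. indicator {0<..} u * k u)"
  proof -
    have "set_integrable lborel {0<..} k" by (rule set_integrable_subset[OF ki]) auto
    then show ?thesis by (simp add: set_integrable_def)
  qed
  let ?w = "\<lambda>t \<omega> u. indicator {t<..} u * (k u * (P u \<omega>)\<^sup>2)"
  interpret L: pair_sigma_finite M "lborel :: real measure" ..
  \<comment> \<open>The square of \<open>S\<close> times an integrable function of time dominates on
    the product space; this licenses the exchange of expectation and time integral in
    \<open>fub\<close>.\<close>
  have wi: "integrable (M \<Otimes>\<^sub>M lborel) (\<lambda>(\<omega>, u). ?w t \<omega> u)" if t: "0 \<le> t" for t
  proof (rule Bochner_Integration.integrable_bound)
    show "integrable (M \<Otimes>\<^sub>M lborel) (\<lambda>(\<omega>, u). (S \<omega>)\<^sup>2 * (indicator {0<..} u * k u))"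
    proof (rule L.Fubini_integrable)
      show "(\<lambda>(\<omega>, u). (S \<omega>)\<^sup>2 * (indicator {0<..} u * k u)) \<in> borel_measurable (M \<Otimes>\<^sub>M lborel)"
        using measurable_compose[OF measurable_fst S_m, of lborel] measurable_compose[OF measurable_snd borel_measurable_integrable[OF kint], of M]
        unfolding case_prod_beta by measurable
      show "integrable M (\<lambda>\<omega>. LINT u|lborel. norm (case (\<omega>, u) of (\<omega>, u) \<Rightarrow> (S \<omega>)\<^sup>2 * (indicator {0<..} u * k u)))"
        using S_sq by (simp add: abs_mult)
      show "AE \<omega> in M. integrable lborel (\<lambda>u. case (\<omega>, u) of (\<omega>, u) \<Rightarrow> (S \<omega>)\<^sup>2 * (indicator {0<..} u * k u))"
        using kint by simp
    qed
    have "(\<lambda>x. indicator {t<..} (snd x) * ((indicator {0<..} (snd x) * k (snd x)) * (P (snd x) (fst x))\<^sup>2)) \<in> borel_measurable (M \<Otimes>\<^sub>M lborel)"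
      using Pm measurable_compose[OF measurable_snd borel_measurable_integrable[OF kint], of M] by measurable
    also have "(\<lambda>x. indicator {t<..} (snd x) * ((indicator {0<..} (snd x) * k (snd x)) * (P (snd x) (fst x))\<^sup>2)) = (\<lambda>(\<omega>, u). ?w t \<omega> u)"
      using t by (auto simp: indicator_def)
    finally show "(\<lambda>(\<omega>, u). ?w t \<omega> u) \<in> borel_measurable (M \<Otimes>\<^sub>M lborel)" .
    show "AE x in M \<Otimes>\<^sub>M lborel. norm (case x of (\<omega>, u) \<Rightarrow> ?w t \<omega> u) \<le> norm (case x of (\<omega>, u) \<Rightarrow> (S \<omega>)\<^sup>2 * (indicator {0<..} u * k u))"
    proof (rule AE_I2)
      fix x assume x: "x \<in> space (M \<Otimes>\<^sub>M (lborel :: real measure))"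
      obtain \<omega> u where xe: "x = (\<omega>, u)" by (cases x)
      have "(P u \<omega>)\<^sup>2 \<le> (S \<omega>)\<^sup>2" using x xe P0 PS by (intro power_mono) (auto simp: space_pair_measure)
      then have "k u * (P u \<omega>)\<^sup>2 \<le> k u * (S \<omega>)\<^sup>2" if "0 < u" using that k0[of u] by (intro mult_left_mono) auto
      then show "norm (case x of (\<omega>, u) \<Rightarrow> ?w t \<omega> u) \<le> norm (case x of (\<omega>, u) \<Rightarrow> (S \<omega>)\<^sup>2 * (indicator {0<..} u * k u))"
        using t k0[of u] by (auto simp: xe indicator_def mult.commute abs_mult)
    qed
  qed
  define v where "v t = expectation (\<lambda>\<omega>. (P t \<omega>)\<^sup>2)" for t
  have Psq: "integrable M (\<lambda>\<omega>. (P t \<omega>)\<^sup>2)" for t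
  proof (rule L2_bound_integrable[OF _ S_sq])
    show "P t \<in> borel_measurable M"
    proof -
      have "D (max 0 t) \<in> borel_measurable M" using D_F[of "max 0 t"] F_measurable by auto
      from measurable_compose[OF this pos_part_measurable] show ?thesis unfolding P_def[abs_def] by measurable
    qed
    show "\<bar>P t \<omega>\<bar> \<le> \<bar>S \<omega>\<bar>" if "\<omega> \<in> space M" for \<omega> using P0[of t \<omega>] PS[OF that, of t] by simp
  qed
  have fub: "expectation (\<lambda>\<omega>. LINT u|lborel. ?w t \<omega> u) = (LINT u|lborel. indicator {t<..} u * (k u * v u))" if "0 \<le> t" for t
    using L.Fubini_integral[OF wi[OF that]] by (simp add: v_def)
  have step: "v t \<le> (LINT u|lborel. indicator {t<..} u * (k u * v u))" if t: "0 \<le> t" for t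
  proof -
    let ?v1 = "\<lambda>j \<omega> u. indicator {t<..} u * (2 * (max 0 (D (max 0 u) \<omega> $ j) * \<kappa> u \<omega>) + (\<delta> u)\<^sup>2 * (max 0 (D (max 0 u) \<omega> $ j))\<^sup>2)"
    have E: "expectation (\<lambda>\<omega>. (max 0 (D t \<omega> $ j))\<^sup>2) \<le> expectation (\<lambda>\<omega>. LINT u|lborel. ?v1 j \<omega> u)"
      "integrable M (\<lambda>\<omega>. LINT u|lborel. ?v1 j \<omega> u)"
      "\<And>\<omega>. \<omega> \<in> space M \<Longrightarrow> integrable lborel (?v1 j \<omega>)" for j
    proof -
      interpret I: ito_bound M W "\<lambda>t \<omega>. D t \<omega> $ j" "\<lambda>t \<omega>. J2 t \<omega> $ j - J1 t \<omega> $ j" "\<lambda>u \<omega>. z2 u \<omega> $ j - z1 u \<omega> $ j" S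
        "g j" \<kappa> "\<lambda>\<omega>. \<Lambda>1 \<omega> + \<Lambda>2 \<omega>" "\<lambda>\<omega>. \<xi>2 \<omega> $ j - \<xi>1 \<omega> $ j" \<psi> \<delta> by (rule bound)
      show "expectation (\<lambda>\<omega>. (max 0 (D t \<omega> $ j))\<^sup>2) \<le> expectation (\<lambda>\<omega>. LINT u|lborel. ?v1 j \<omega> u)"
        using I.ito_inequality[OF t] unfolding I.lipschitz_term_def[abs_def] I.lipschitz_density_def I.Xe_def .
      show "integrable M (\<lambda>\<omega>. LINT u|lborel. ?v1 j \<omega> u)"
        using I.lipschitz_term_integrable[OF t] unfolding I.lipschitz_term_def[abs_def] I.lipschitz_density_def I.Xe_def .
      show "integrable lborel (?v1 j \<omega>)" if "\<omega> \<in> space M" for \<omega>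
        using I.lipschitz_density_integrable[OF that t] unfolding I.lipschitz_density_def[abs_def] I.Xe_def .
    qed
    have comp_sq: "integrable M (\<lambda>\<omega>. (max 0 (D t \<omega> $ j))\<^sup>2)" for j
    proof (rule L2_bound_integrable[OF _ S_sq])
      show "(\<lambda>\<omega>. max 0 (D t \<omega> $ j)) \<in> borel_measurable M"
        using measurable_compose[OF F_measurable[OF D_F[OF t]] borel_measurable_vec_nth, of j] by measurable
      show "\<bar>max 0 (D t \<omega> $ j)\<bar> \<le> \<bar>S \<omega>\<bar>" if "\<omega> \<in> space M" for \<omega>
        using component_le_norm_cart[of "D t \<omega>" j] D_le[OF that t] S0[of \<omega>] by auto
    qed
    have "v t = expectation (\<lambda>\<omega>. \<Sum>j\<in>UNIV. (max 0 (D t \<omega> $ j))\<^sup>2)"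
      unfolding v_def P_def norm_pos_part_sq using t by (simp add: max_absorb2)
    also have "\<dots> = (\<Sum>j\<in>UNIV. expectation (\<lambda>\<omega>. (max 0 (D t \<omega> $ j))\<^sup>2))"
      by (rule Bochner_Integration.integral_sum) (rule comp_sq)
    also have "\<dots> \<le> (\<Sum>j\<in>UNIV. expectation (\<lambda>\<omega>. LINT u|lborel. ?v1 j \<omega> u))"
      by (rule sum_mono) (rule E(1))
    also have "\<dots> = expectation (\<lambda>\<omega>. \<Sum>j\<in>UNIV. LINT u|lborel. ?v1 j \<omega> u)"
      by (rule Bochner_Integration.integral_sum[symmetric]) (rule E(2))
    also have "\<dots> \<le> expectation (\<lambda>\<omega>. LINT u|lborel. ?w t \<omega> u)"
    proof (rule integral_mono_AE)
      show "integrable M (\<lambda>\<omega>. \<Sum>j\<in>UNIV. LINT u|lborel. ?v1 j \<omega> u)" by (rule Bochner_Integration.integrable_sum) (rule E(2))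
      show "integrable M (\<lambda>\<omega>. LINT u|lborel. ?w t \<omega> u)" using L.integrable_fst[OF wi[OF t]] .
      show "AE \<omega> in M. (\<Sum>j\<in>UNIV. LINT u|lborel. ?v1 j \<omega> u) \<le> (LINT u|lborel. ?w t \<omega> u)"
        using L.AE_integrable_fst[OF wi[OF t]] AE_space
      proof eventually_elim
        case (elim \<omega>)
        have "(\<Sum>j\<in>UNIV. LINT u|lborel. ?v1 j \<omega> u) = (LINT u|lborel. (\<Sum>j\<in>UNIV. ?v1 j \<omega> u))"
          by (rule Bochner_Integration.integral_sum[symmetric]) (rule E(3)[OF elim(2)])
        also have "\<dots> \<le> (LINT u|lborel. ?w t \<omega> u)"
        proof (rule integral_mono[OF _ elim(1)])
          show "integrable lborel (\<lambda>u. \<Sum>j\<in>UNIV. ?v1 j \<omega> u)" by (rule Bochner_Integration.integrable_sum) (rule E(3)[OF elim(2)])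
          fix u
          show "(\<Sum>j\<in>UNIV. ?v1 j \<omega> u) \<le> ?w t \<omega> u"
          proof (cases "t < u")
            case True
            then have u: "0 \<le> u" using t by simp
            have "(\<Sum>j\<in>UNIV. ?v1 j \<omega> u) \<le> (\<Sum>j\<in>(UNIV::'m set). (2 * \<psi> u + (\<delta> u)\<^sup>2) * (P u \<omega>)\<^sup>2)"
            proof (rule sum_mono)
              fix j
              let ?x = "max 0 (D (max 0 u) \<omega> $ j)"
              have x: "0 \<le> ?x" "?x \<le> P u \<omega>"
                using component_le_norm_cart[of "pos_part (D (max 0 u) \<omega>)" j] by (auto simp: P_def pos_part_def)
              have "?x * \<kappa> u \<omega> \<le> P u \<omega> * (\<psi> u * P u \<omega>)" unfolding \<kappa>_def
                using x P0[of u \<omega>] pos[OF u] u by (intro mult_mono) auto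
              moreover have "(\<delta> u)\<^sup>2 * ?x\<^sup>2 \<le> (\<delta> u)\<^sup>2 * (P u \<omega>)\<^sup>2"
                using x by (intro mult_left_mono power_mono) auto
              ultimately show "?v1 j \<omega> u \<le> (2 * \<psi> u + (\<delta> u)\<^sup>2) * (P u \<omega>)\<^sup>2"
                using True by (simp add: power2_eq_square algebra_simps)
            qed
            also have "\<dots> = ?w t \<omega> u" using True by (simp add: k_def)
            finally show ?thesis .
          qed simp
        qed
        finally show ?case .
      qed
    qed
    also have "\<dots> = (LINT u|lborel. indicator {t<..} u * (k u * v u))" by (rule fub[OF t])
    finally show ?thesis .
  qed
  have v0: "v t = 0" if "0 \<le> t" for t
  proof (rule gronwall_backward[OF ki k0 _ _ _ step that])
    show "0 \<le> v t" for t unfolding v_def by (intro integral_nonneg_AE) auto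
    show "v t \<le> expectation (\<lambda>\<omega>. (S \<omega>)\<^sup>2)" for t unfolding v_def
      using P0 PS by (intro integral_mono Psq S_sq power_mono) auto
    have "integrable lborel (\<lambda>u. expectation (\<lambda>\<omega>. ?w 0 \<omega> u))" using L.integrable_snd[OF wi[OF order_refl]] .
    then show "integrable lborel (\<lambda>u. indicator {0<..} u * (k u * v u))" by (simp add: v_def)
  qed
  have AEt: "AE \<omega> in M. P t \<omega> = 0" if "0 \<le> t" for t
  proof -
    have "AE \<omega> in M. (P t \<omega>)\<^sup>2 = 0"
      using v0[OF that] integral_nonneg_eq_0_iff_AE[OF Psq[of t]] by (simp add: v_def)
    then show ?thesis by simp
  qed
  \<comment> \<open>A single null event for all rational times; continuity of the paths of
    \<open>D\<close> extends the conclusion to all times.\<close>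
  have "AE \<omega> in M. \<forall>q\<in>\<rat> \<inter> {0..}. P q \<omega> = 0"
    by (rule AE_ball_countable') (use AEt countable_rat in auto)
  then show ?thesis using AED AE_space
  proof eventually_elim
    case (elim \<omega>)
    show ?case
    proof (intro allI impI)
      fix t :: real and j assume t: "0 \<le> t"
      have "D t \<omega> $ j \<le> 0"
      proof (rule nonpos_if_nonpos_on_rationals[OF _ _ t])
        show "continuous_on {0..} (\<lambda>t. D t \<omega> $ j)" by (intro continuous_intros D_cont elim)
        fix q :: real assume q: "q \<in> \<rat>" "0 \<le> q"
        then have "pos_part (D q \<omega>) = 0" using elim(1) by (auto simp: P_def max_absorb2)
        then have "pos_part (D q \<omega>) $ j = 0" by simp
        then show "D q \<omega> $ j \<le> 0" by (simp add: pos_part_def)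
      qed
      then show "y1 t \<omega> $ j \<ge> y2 t \<omega> $ j" using elim(2) by simp
    qed
  qed
qed

end

theorem theorem6:
  fixes M :: "'a measure"
    and W :: "real \<Rightarrow> 'a \<Rightarrow> real ^ 'd"
    and \<xi>1 \<xi>2 :: "'a \<Rightarrow> real ^ 'm"
    and f1 f2 :: "'a \<Rightarrow> real \<Rightarrow> real ^ 'm \<Rightarrow> real ^ 'd ^ 'm \<Rightarrow> real ^ 'm"
    and y1 y2 :: "real \<Rightarrow> 'a \<Rightarrow> real ^ 'm"
    and z1 z2 :: "real \<Rightarrow> 'a \<Rightarrow> real ^ 'd ^ 'm"
  assumes "prob_space M"
    and "standard_brownian_motion M W"
    and "\<xi>1 \<in> L2_space M W" and "\<xi>2 \<in> L2_space M W"
    and "AE \<omega> in M. \<forall>j. \<xi>1 \<omega> $ j \<ge> \<xi>2 \<omega> $ j"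
    and "generator_h1 M W f1" and "generator_h2 M f1"
    and "generator_h1 M W f2" and "generator_h2 M f2"
    and "quasi_monotone M f1 f2"
    and "bsde_solution M W f1 \<xi>1 y1 z1"
    and "bsde_solution M W f2 \<xi>2 y2 z2"
  shows "AE \<omega> in M. \<forall>t\<ge>0. \<forall>j. y1 t \<omega> $ j \<ge> y2 t \<omega> $ j"
proof -
  interpret brownian M W
    using assms(1,2) by (simp add: brownian_def brownian_axioms_def)
  show ?thesis by (rule comparison[OF assms(5,6,8,7,9-12)])
qed

end
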